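(* Let $(X,\sigma_X)$ and $(Y,\sigma_Y)$ be non-trivial mixing shifts of finite type, and suppose there is an isomorphism of groups $\mathrm{Aut}^{(\infty)}(\sigma_X)\cong\mathrm{Aut}^{(\infty)}(\sigma_Y)$. Then $$\frac{h_{top}(\sigma_X)}{h_{top}(\sigma_Y)}\in\mathbb{Q}.$$
   Context: A subshift $(X,\sigma_X)$ is a nonempty closed shift-invariant subset $X\subset\mathcal{A}^{\mathbb{Z}}$ ($\mathcal{A}$ a finite alphabet) with $\sigma_X$ the restriction of the left shift. It is a shift of finite type if $X$ is the set of all points avoiding some finite set of forbidden words. It is mixing if for all words $u,v$ in its language there is $M$ such that for all $m\ge M$ there is a word $w$ of length $m$ with $uwv$ in the language. A mixing shift of finite type is trivial if it consists of only one finite orbit. $h_{top}$ denotes topological entropy. For a homeomorphism $T$ of a compact metric space $X$, $\mathrm{Aut}(T)$ is the group of homeomorphisms of $X$ commuting with $T$, and the stabilized automorphism group is $\mathrm{Aut}^{(\infty)}(T)=\bigcup_{n\ge1}\mathrm{Aut}(T^n)$, a subgroup of $\mathrm{Homeo}(X)$. *)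

theory Defs
  imports "HOL-Analysis.Analysis" "HOL-Algebra.Bij"
begin

section \<open>Stabilized automorphism groups\<close>

text \<open>
  A homeomorphism of a space is a function on the underlying type of which only the values on the
  carrier matter. As elements of an automorphism group, homeomorphisms are taken in
  \<^term>\<open>Bij (topspace T)\<close>, hence extensional, so that equality in the group is equality on the
  carrier.
\<close>

definition auts :: "'a topology \<Rightarrow> ('a \<Rightarrow> 'a) \<Rightarrow> ('a \<Rightarrow> 'a) set" where
  "auts T f =
    {g \<in> Bij (topspace T). homeomorphic_map T T g \<and> (\<forall>x\<in>topspace T. g (f x) = f (g x))}"

definition stabilized_auts :: "'a topology \<Rightarrow> ('a \<Rightarrow> 'a) \<Rightarrow> ('a \<Rightarrow> 'a) set" where
  "stabilized_auts T f = (\<Union>n\<in>{1..}. auts T (f ^^ n))"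

definition stabilized_aut_group :: "'a topology \<Rightarrow> ('a \<Rightarrow> 'a) \<Rightarrow> ('a \<Rightarrow> 'a) monoid" where
  "stabilized_aut_group T f = (BijGroup (topspace T))\<lparr>carrier := stabilized_auts T f\<rparr>"


section \<open>Topological entropy\<close>

text \<open>
  The open cover definition of Adler, Konheim and McAndrew. For a continuous self-map of a compact
  space the limit in \<open>cover_entropy\<close> exists by subadditivity.
\<close>

definition open_cover :: "'a topology \<Rightarrow> 'a set set \<Rightarrow> bool" where
  "open_cover T \<U> \<longleftrightarrow> (\<forall>U\<in>\<U>. openin T U) \<and> \<Union>\<U> = topspace T"

definition cover_number :: "'a topology \<Rightarrow> 'a set set \<Rightarrow> nat" where
  "cover_number T \<U> = (LEAST n. \<exists>\<V>\<subseteq>\<U>. finite \<V> \<and> card \<V> = n \<and> \<Union>\<V> = topspace T)"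

text \<open>
  The common refinement of the preimages of the cover under the first \<open>n\<close> iterates, starting
  with the identity.
\<close>

definition iterated_join :: "'a topology \<Rightarrow> ('a \<Rightarrow> 'a) \<Rightarrow> 'a set set \<Rightarrow> nat \<Rightarrow> 'a set set" where
  "iterated_join T f \<U> n =
    {{x \<in> topspace T. \<forall>k<n. (f ^^ k) x \<in> U k} | U. \<forall>k<n. U k \<in> \<U>}"

definition cover_entropy :: "'a topology \<Rightarrow> ('a \<Rightarrow> 'a) \<Rightarrow> 'a set set \<Rightarrow> ereal" where
  "cover_entropy T f \<U> =
    lim (\<lambda>n. ereal (ln (real (cover_number T (iterated_join T f \<U> n))) / real n))"

definition topological_entropy :: "'a topology \<Rightarrow> ('a \<Rightarrow> 'a) \<Rightarrow> ereal" where
  "topological_entropy T f = (SUP \<U>\<in>{\<U>. open_cover T \<U>}. cover_entropy T f \<U>)"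


section \<open>Subshifts\<close>

definition shift :: "(int \<Rightarrow> 'a) \<Rightarrow> int \<Rightarrow> 'a" where
  "shift x = (\<lambda>i. x (i + 1))"

definition full_shift :: "'a set \<Rightarrow> (int \<Rightarrow> 'a) topology" where
  "full_shift A = product_topology (\<lambda>_. discrete_topology A) UNIV"

definition subshift :: "'a set \<Rightarrow> (int \<Rightarrow> 'a) set \<Rightarrow> bool" where
  "subshift A X \<longleftrightarrow>
    finite A \<and> X \<noteq> {} \<and> closedin (full_shift A) X \<and> shift ` X = X"

definition shift_space :: "'a set \<Rightarrow> (int \<Rightarrow> 'a) set \<Rightarrow> (int \<Rightarrow> 'a) topology" where
  "shift_space A X = subtopology (full_shift A) X"

definition occurs :: "'a list \<Rightarrow> (int \<Rightarrow> 'a) \<Rightarrow> bool" where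
  "occurs w x \<longleftrightarrow> (\<exists>i. \<forall>k<length w. x (i + int k) = w ! k)"

definition language :: "(int \<Rightarrow> 'a) set \<Rightarrow> 'a list set" where
  "language X = {w. \<exists>x\<in>X. occurs w x}"

definition shift_of_finite_type :: "'a set \<Rightarrow> (int \<Rightarrow> 'a) set \<Rightarrow> bool" where
  "shift_of_finite_type A X \<longleftrightarrow>
    subshift A X \<and>
    (\<exists>F. finite F \<and> F \<subseteq> lists A \<and> X = {x. range x \<subseteq> A \<and> (\<forall>w\<in>F. \<not> occurs w x)})"

definition mixing :: "(int \<Rightarrow> 'a) set \<Rightarrow> bool" where
  "mixing X \<longleftrightarrow>
    (\<forall>u\<in>language X. \<forall>v\<in>language X.
      \<exists>M. \<forall>m\<ge>M. \<exists>w. length w = m \<and> u @ w @ v \<in> language X)"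

definition orbit :: "(int \<Rightarrow> 'a) \<Rightarrow> (int \<Rightarrow> 'a) set" where
  "orbit x = range (\<lambda>n i. x (i + n))"

definition trivial_shift :: "(int \<Rightarrow> 'a) set \<Rightarrow> bool" where
  "trivial_shift X \<longleftrightarrow> finite X \<and> (\<exists>x. X = orbit x)"

end

theory Submission
  imports Defs
begin

text \<open>
  Let \<open>s\<close> be the shift of \<open>X\<close>, let \<open>G\<close> be the stabilized automorphism group and let \<open>a\<^sub>n\<close> be the
  number of words of length \<open>n\<close>, so that the entropy is the limit of \<open>ln a\<^sub>n / n\<close>. The entropy can be
  read off from the pair \<open>(G, s)\<close>: for \<open>h \<in> G\<close> consider the least index of a subgroup of the
  centralizer of \<open>s\<^sup>n\<close> that does not contain \<open>h\<close>. If \<open>h\<close> is not the identity, it moves a point of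
  period \<open>n\<close> for all large \<open>n\<close>, and the stabilizer of this point has index at most \<open>a\<^sub>n\<close>. On the other
  hand the centralizer contains the permutations of long blocks with fixed ends. A subgroup of small
  index in a symmetric group contains all 3-cycles, so if \<open>h\<close> is a 3-cycle of blocks of length \<open>m\<close>,
  then for every multiple \<open>n\<close> of \<open>m\<close> the index is at least \<open>a\<^sub>n\<close> up to a constant factor.

  It remains to see that an isomorphism maps a power of one shift to a power of the other. The image \<open>g\<close>
  of a shift has, for every \<open>h\<close>, a power that commutes with \<open>h\<close>. So a power of \<open>g\<close> commutes with \<open>s\<close>
  and with all block permutations of some fixed level. Such a map sends a point \<open>\<dots> e\<^sub>0 e\<^sub>0 e\<^sub>1 e\<^sub>1 \<dots>\<close>
  to one of its translates, because it creates no new blocks. After composing with a power of \<open>s\<close> it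
  fixes this point, hence also all its images under block permutations and shifts, and these are dense.
\<close>

section \<open>Entropy of a subshift\<close>

text \<open>The two bounds on the index agree only up to a constant factor, and the lower one holds
  only along the multiples of one fixed level. Both losses vanish in the growth rate, because the
  limit defining it exists. The 3-cycle has to be chosen before the multiple, so that one group
  element serves for infinitely many powers of the shift; this works because a permutation of short
  windows is also a permutation of longer ones. For the density step, windows of three blocks are
  permuted. Such a window shows the neighbours of a block, so a permutation can act on the boundary
  between \<open>e0\<close> and \<open>e1\<close> without touching constant stretches. The obstacle
  is that it acts on all aligned occurrences of a pattern at once; most of the work on points with
  constant tails controls these side effects. Working with triples also forces a cube at the end:
  permutations of triples commute with translations by three blocks, but in general not with those
  by one.\<close>

lemma subadditive_quotients_converge:
  fixes u :: "nat \<Rightarrow> real"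
  assumes sub: "\<And>m n. u (m + n) \<le> u m + u n" and nn: "\<And>n. 0 \<le> u n"
  obtains L where "(\<lambda>n. u n / real n) \<longlonglongrightarrow> L"
proof -
  \<comment> \<open>This is Fekete's lemma, with the infimum as limit. The index starts at 1 because
    \<open>u 0 / 0\<close> is 0 and would spoil the infimum.\<close>
  define L where "L = (INF n\<in>{1..}. u n / real n)"
  have bdd: "bdd_below ((\<lambda>n. u n / real n) ` {1..})"
    by (rule bdd_belowI[of _ 0]) (use nn in auto)
  have low: "L \<le> u n / real n" if "n \<ge> 1" for n
    unfolding L_def by (rule cINF_lower[OF bdd]) (use that in auto)
  have mult: "u (q * k + r) \<le> real q * u k + u r" for q k r
  proof (induction q)
    case (Suc q)
    have "u (Suc q * k + r) = u (k + (q * k + r))" by (simp add: algebra_simps)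
    also have "\<dots> \<le> u k + u (q * k + r)" by (rule sub)
    also have "\<dots> \<le> real (Suc q) * u k + u r" using Suc by (simp add: algebra_simps)
    finally show ?case .
  qed simp
  have "(\<lambda>n. u n / real n) \<longlonglongrightarrow> L"
  proof (rule LIMSEQ_I)
    fix e :: real assume e: "0 < e"
    have "(INF n\<in>{1..}. u n / real n) < L + e / 2" using e by (simp add: L_def)
    then obtain k where k: "k \<ge> 1" "u k / real k < L + e / 2"
      using cINF_less_iff[OF _ bdd, of "L + e/2"] by auto
    \<comment> \<open>\<open>B\<close> bounds the contribution of the remainder modulo
      \<open>k\<close>, which disappears after division by \<open>n\<close>.\<close>
    define B where "B = Max (u ` {..<k})"
    have B: "u r \<le> B" if "r < k" for r unfolding B_def using that by (intro Max_ge) auto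
    have B0: "0 \<le> B" using B[of 0] k nn[of 0] by linarith
    obtain n0 where n0: "2 * B / e < real n0" using reals_Archimedean2 by blast
    show "\<exists>no. \<forall>n\<ge>no. norm (u n / real n - L) < e"
    proof (intro exI allI impI)
      fix n assume n: "n \<ge> max 1 n0"
      hence n1: "n \<ge> 1" "2 * B / e < real n" using n0 by auto
      have "u n = u ((n div k) * k + n mod k)" by simp
      also have "\<dots> \<le> real (n div k) * u k + u (n mod k)" by (rule mult)
      also have "\<dots> \<le> real (n div k) * u k + B" using B[of "n mod k"] k by simp
      also have "\<dots> \<le> real n / real k * u k + B"
        using nn[of k] by (intro add_right_mono mult_right_mono of_nat_div_le_of_nat) auto
      finally have "u n / real n \<le> (real n / real k * u k + B) / real n"
        by (rule divide_right_mono) simp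
      also have "\<dots> = u k / real k + B / real n" using n1 by (simp add: field_simps)
      finally have 1: "u n / real n \<le> u k / real k + B / real n" .
      have "B / real n < e / 2" using n1 e by (simp add: field_simps)
      hence "u n / real n < L + e" using 1 k(2) by linarith
      thus "norm (u n / real n - L) < e" using low[OF n1(1)] by simp
    qed
  qed
  thus ?thesis using that by blast
qed

lemma funpow_shift: "(shift ^^ n) x = (\<lambda>i. x (i + int n))"
  by (induction n arbitrary: x) (auto simp: shift_def funpow_swap1 algebra_simps)

text \<open>A word is a point cut down to a window and \<open>undefined\<close> elsewhere. Unlike a
  list it keeps its positions, so words can be compared and glued coordinatewise.\<close>

definition word_count :: "(int \<Rightarrow> 'a) set \<Rightarrow> nat \<Rightarrow> nat" where
  "word_count X n = card ((\<lambda>x. restrict x {0..<int n}) ` X)"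

definition translate :: "int \<Rightarrow> (int \<Rightarrow> 'a) \<Rightarrow> int \<Rightarrow> 'a" where
  "translate k x = (\<lambda>i. x (i + k))"

lemma translate_apply [simp]: "translate k x i = x (i + k)"
  by (simp add: translate_def)

lemma translate_translate [simp]: "translate k (translate l x) = translate (k + l) x"
  by (auto simp: translate_def add.assoc)

lemma translate_0 [simp]: "translate 0 x = x"
  by (auto simp: translate_def)

lemma funpow_shift_eq: "(shift ^^ n) x = translate (int n) x"
  by (simp add: funpow_shift translate_def)

section \<open>Topology of a subshift in coordinates\<close>

locale subshift_space =
  fixes A :: "'a set" and X :: "(int \<Rightarrow> 'a) set"
  assumes subshift: "subshift A X"
begin

abbreviation T where "T \<equiv> shift_space A X"

lemma finite_A: "finite A" and ne: "X \<noteq> {}" and closed_X: "closedin (full_shift A) X"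
  and shift_X: "shift ` X = X"
  using subshift by (auto simp: subshift_def)

lemma X_subset: "X \<subseteq> UNIV \<rightarrow>\<^sub>E A"
  using closedin_subset[OF closed_X] by (simp add: full_shift_def)

lemma X_letter: "x \<in> X \<Longrightarrow> x i \<in> A"
  using X_subset by auto

lemma topspace_T [simp]: "topspace T = X"
  using closedin_subset[OF closed_X] by (auto simp: shift_space_def)

lemma compact_T: "compact_space T"
proof -
  have "compact_space (full_shift A)"
    unfolding full_shift_def
    by (simp add: compact_space_product_topology compact_space_discrete_topology finite_A)
  thus ?thesis unfolding shift_space_def
    using closed_X closedin_compact_space compact_space_subtopology by blast
qed

lemma translate_in [simp]: "x \<in> X \<Longrightarrow> translate k x \<in> X"
proof -
  have s: "shift = translate 1" by (auto simp: shift_def translate_def)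
  have f: "translate (int n) x \<in> X" if "x \<in> X" for n x
    using that
  proof (induction n)
    case (Suc n)
    have "translate (int (Suc n)) x = shift (translate (int n) x)" by (simp add: s)
    moreover have "translate (int n) x \<in> X" using Suc by blast
    ultimately show ?case using shift_X by blast
  qed simp
  have b: "translate (- int n) x \<in> X" if "x \<in> X" for n x
    using that
  proof (induction n)
    case (Suc n)
    then obtain y where "y \<in> X" "translate (- int n) x = shift y" using shift_X by blast
    have e: "translate (- int (Suc n)) x = translate (- 1) (translate (- int n) x)" by simp
    have "translate (- int (Suc n)) x = y"
      unfolding e \<open>translate (- int n) x = shift y\<close> s by simp
    thus ?case using \<open>y \<in> X\<close> by simp
  qed simp
  assume "x \<in> X"
  thus ?thesis using f b by (cases k rule: int_cases2) auto
qed

text \<open>Cylinders centred at the origin form a base. The radius is an integer, and a negative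
  radius imposes no condition.\<close>

lemma openin_T_iff:
  "openin T S \<longleftrightarrow> S \<subseteq> X \<and> (\<forall>x\<in>S. \<exists>k. \<forall>y\<in>X. (\<forall>i. \<bar>i\<bar> \<le> k \<longrightarrow> y i = x i) \<longrightarrow> y \<in> S)"
proof
  assume "openin T S"
  then obtain U where U: "openin (full_shift A) U" "S = U \<inter> X"
    by (auto simp: shift_space_def openin_subtopology)
  have "\<exists>k. \<forall>y\<in>X. (\<forall>i. \<bar>i\<bar> \<le> k \<longrightarrow> y i = x i) \<longrightarrow> y \<in> S" if x: "x \<in> S" for x
  proof -
    obtain V where V: "finite {i. V i \<noteq> A}" "x \<in> Pi\<^sub>E UNIV V" "Pi\<^sub>E UNIV V \<subseteq> U"
    proof -
      have "\<forall>x\<in>U. \<exists>V. finite {i \<in> UNIV. V i \<noteq> topspace (discrete_topology A)} \<and>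
          (\<forall>i\<in>UNIV. openin (discrete_topology A) (V i)) \<and> x \<in> Pi\<^sub>E UNIV V \<and> Pi\<^sub>E UNIV V \<subseteq> U"
        using U(1) unfolding full_shift_def openin_product_topology_alt .
      moreover have "x \<in> U" using U x by blast
      ultimately show ?thesis using that by (metis (mono_tags, lifting) Collect_cong UNIV_I topspace_discrete_topology)
    qed
    obtain k where k: "\<And>i. V i \<noteq> A \<Longrightarrow> \<bar>i\<bar> \<le> k"
      using V(1) finite_imageI[of "{i. V i \<noteq> A}" abs] bdd_above_finite
      by (metis (mono_tags, lifting) Max_ge imageI mem_Collect_eq)
    have "y \<in> S" if y: "y \<in> X" "\<forall>i. \<bar>i\<bar> \<le> k \<longrightarrow> y i = x i" for y
    proof -
      have "y i \<in> V i" for i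
      proof (cases "V i = A")
        case True thus ?thesis using X_letter y by simp
      next
        case False thus ?thesis using k[OF False] y V(2) by auto
      qed
      thus ?thesis using V(3) U y by auto
    qed
    thus ?thesis by blast
  qed
  thus "S \<subseteq> X \<and> (\<forall>x\<in>S. \<exists>k. \<forall>y\<in>X. (\<forall>i. \<bar>i\<bar> \<le> k \<longrightarrow> y i = x i) \<longrightarrow> y \<in> S)"
    using U by auto
next
  assume R: "S \<subseteq> X \<and> (\<forall>x\<in>S. \<exists>k. \<forall>y\<in>X. (\<forall>i. \<bar>i\<bar> \<le> k \<longrightarrow> y i = x i) \<longrightarrow> y \<in> S)"
  \<comment> \<open>\<open>U\<close> is the union of the cylinders of the full shift around points
    of \<open>S\<close> whose trace on \<open>X\<close> stays inside \<open>S\<close>.\<close>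
  define U where "U = {y \<in> UNIV \<rightarrow>\<^sub>E A. \<exists>x\<in>S. \<exists>k. (\<forall>i. \<bar>i\<bar> \<le> k \<longrightarrow> y i = x i) \<and>
     (\<forall>z\<in>X. (\<forall>i. \<bar>i\<bar> \<le> k \<longrightarrow> z i = x i) \<longrightarrow> z \<in> S)}"
  have "openin (full_shift A) U"
    unfolding full_shift_def openin_product_topology_alt
  proof
    fix y assume "y \<in> U"
    then obtain x k where y: "y \<in> UNIV \<rightarrow>\<^sub>E A" "x \<in> S" "\<forall>i. \<bar>i\<bar> \<le> k \<longrightarrow> y i = x i"
      "\<forall>z\<in>X. (\<forall>i. \<bar>i\<bar> \<le> k \<longrightarrow> z i = x i) \<longrightarrow> z \<in> S" unfolding U_def by blast
    define V where "V i = (if \<bar>i\<bar> \<le> k then {y i} else A)" for i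
    have "{i. V i \<noteq> A} \<subseteq> {-k..k}" unfolding V_def by auto
    hence 1: "finite {i. V i \<noteq> A}" using finite_subset by blast
    have 2: "\<forall>i. V i \<subseteq> A" "y \<in> Pi\<^sub>E UNIV V" using y(1) by (auto simp: V_def)
    have 3: "Pi\<^sub>E UNIV V \<subseteq> U"
    proof
      fix z assume z: "z \<in> Pi\<^sub>E UNIV V"
      have "z i = y i" if "\<bar>i\<bar> \<le> k" for i
      proof -
        have "z i \<in> V i" using z by auto
        thus ?thesis using that by (simp add: V_def)
      qed
      moreover have "z \<in> UNIV \<rightarrow>\<^sub>E A" using z 2(1) by auto
      ultimately show "z \<in> U" unfolding U_def using y by auto
    qed
    show "\<exists>V. finite {i \<in> UNIV. V i \<noteq> topspace (discrete_topology A)} \<and>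
      (\<forall>i\<in>UNIV. openin (discrete_topology A) (V i)) \<and> y \<in> Pi\<^sub>E UNIV V \<and> Pi\<^sub>E UNIV V \<subseteq> U"
      using 1 2 3 by (intro exI[of _ V]) auto
  qed
  moreover have "S = U \<inter> X"
  proof
    show "S \<subseteq> U \<inter> X"
    proof
      fix x assume x: "x \<in> S"
      then obtain k where "\<forall>y\<in>X. (\<forall>i. \<bar>i\<bar> \<le> k \<longrightarrow> y i = x i) \<longrightarrow> y \<in> S" using R by blast
      thus "x \<in> U \<inter> X" unfolding U_def using x R X_subset by blast
    qed
    show "U \<inter> X \<subseteq> S" unfolding U_def by auto
  qed
  ultimately show "openin T S" unfolding shift_space_def openin_subtopology by blast
qed

lemma continuous_T_iff:
  "continuous_map T T g \<longleftrightarrow> g ` X \<subseteq> X \<and>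
     (\<forall>x\<in>X. \<forall>i. \<exists>k. \<forall>y\<in>X. (\<forall>j. \<bar>j\<bar> \<le> k \<longrightarrow> y j = x j) \<longrightarrow> g y i = g x i)"
proof
  assume c: "continuous_map T T g"
  hence im: "g ` X \<subseteq> X" by (auto simp: continuous_map_def)
  have "\<exists>k. \<forall>y\<in>X. (\<forall>j. \<bar>j\<bar> \<le> k \<longrightarrow> y j = x j) \<longrightarrow> g y i = g x i" if x: "x \<in> X" for x i
  proof -
    have "openin T {z \<in> X. z i = g x i}"
      unfolding openin_T_iff by (auto intro!: exI[of _ "\<bar>i\<bar>"])
    hence "openin T {y \<in> X. g y \<in> {z \<in> X. z i = g x i}}"
      using openin_continuous_map_preimage[OF c] unfolding topspace_T by blast
    moreover have "x \<in> {y \<in> X. g y \<in> {z \<in> X. z i = g x i}}" using x im by auto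
    ultimately obtain k where "\<forall>y\<in>X. (\<forall>j. \<bar>j\<bar> \<le> k \<longrightarrow> y j = x j) \<longrightarrow> y \<in> {y \<in> X. g y \<in> {z \<in> X. z i = g x i}}"
      unfolding openin_T_iff by meson
    thus ?thesis by (intro exI[of _ k]) simp
  qed
  thus "g ` X \<subseteq> X \<and>
     (\<forall>x\<in>X. \<forall>i. \<exists>k. \<forall>y\<in>X. (\<forall>j. \<bar>j\<bar> \<le> k \<longrightarrow> y j = x j) \<longrightarrow> g y i = g x i)" using im by blast
next
  assume R: "g ` X \<subseteq> X \<and>
     (\<forall>x\<in>X. \<forall>i. \<exists>k. \<forall>y\<in>X. (\<forall>j. \<bar>j\<bar> \<le> k \<longrightarrow> y j = x j) \<longrightarrow> g y i = g x i)"
  have "openin T {x \<in> X. g x \<in> U}" if U: "openin T U" for U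
    unfolding openin_T_iff
  proof (intro conjI ballI)
    fix x assume x: "x \<in> {x \<in> X. g x \<in> U}"
    then obtain k where k: "\<And>y. y \<in> X \<Longrightarrow> (\<forall>i. \<bar>i\<bar> \<le> k \<longrightarrow> y i = g x i) \<Longrightarrow> y \<in> U"
      using U unfolding openin_T_iff by blast
    obtain K where K: "\<And>i y. y \<in> X \<Longrightarrow> (\<forall>j. \<bar>j\<bar> \<le> K i \<longrightarrow> y j = x j) \<Longrightarrow> g y i = g x i"
      using R x by (metis (no_types, lifting) mem_Collect_eq)
    \<comment> \<open>Finitely many coordinates are handled by a maximum; for \<open>k < 0\<close>
      there is none, and \<open>Max\<close> of the empty set is unspecified.\<close>
    define K' where "K' = (if k < 0 then 0 else Max (K ` {-k..k}))"
    have K': "K i \<le> K'" if "\<bar>i\<bar> \<le> k" for i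
      using that unfolding K'_def by (auto intro!: Max_ge imageI)
    have "g y \<in> U" if y: "y \<in> X" "\<forall>i. \<bar>i\<bar> \<le> K' \<longrightarrow> y i = x i" for y
    proof (rule k)
      show "g y \<in> X" using y R by auto
      show "\<forall>i. \<bar>i\<bar> \<le> k \<longrightarrow> g y i = g x i" using K[OF y(1)] y(2) K' by (meson order_trans)
    qed
    thus "\<exists>k. \<forall>y\<in>X. (\<forall>i. \<bar>i\<bar> \<le> k \<longrightarrow> y i = x i) \<longrightarrow> y \<in> {x \<in> X. g x \<in> U}" by blast
  qed auto
  thus "continuous_map T T g" using R by (auto simp: continuous_map_def)
qed

section \<open>Counting words\<close>

lemma finite_windows: "finite ((\<lambda>x. restrict x {a..<b::int}) ` X)"
proof (rule finite_subset)
  show "(\<lambda>x. restrict x {a..<b}) ` X \<subseteq> {a..<b} \<rightarrow>\<^sub>E A" using X_letter by auto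
  show "finite ({a..<b} \<rightarrow>\<^sub>E A)" using finite_A by (intro finite_PiE) auto
qed

lemma card_windows: "card ((\<lambda>x. restrict x {a..<a + int n}) ` X) = word_count X n"
proof -
  have "card ((\<lambda>x. restrict x {a..<a + int n}) ` X) = card ((\<lambda>x. restrict x {0..<int n}) ` X)"
  proof (rule bij_betw_same_card, rule bij_betw_imageI)
    let ?f = "\<lambda>w. restrict (\<lambda>i. w (i + a)) {0..<int n}"
    have f: "?f (restrict x {a..<a + int n}) = restrict (translate a x) {0..<int n}" for x :: "int \<Rightarrow> 'a"
      by auto
    show "inj_on ?f ((\<lambda>x. restrict x {a..<a + int n}) ` X)"
    proof (rule inj_onI, clarify)
      fix x y :: "int \<Rightarrow> 'a" assume "?f (restrict x {a..<a + int n}) = ?f (restrict y {a..<a + int n})"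
      hence *: "restrict (translate a x) {0..<int n} = restrict (translate a y) {0..<int n}"
        unfolding f .
      have "x i = y i" if "i \<in> {a..<a + int n}" for i
      proof -
        have "i - a \<in> {0..<int n}" using that by auto
        hence "translate a x (i - a) = translate a y (i - a)"
          using fun_cong[OF *, of "i - a"] by (simp only: restrict_apply if_True)
        thus ?thesis by simp
      qed
      thus "restrict x {a..<a + int n} = restrict y {a..<a + int n}" by (rule restrict_ext)
    qed
    show "?f ` (\<lambda>x. restrict x {a..<a + int n}) ` X = (\<lambda>x. restrict x {0..<int n}) ` X"
    proof (intro equalityI subsetI)
      fix w assume "w \<in> ?f ` (\<lambda>x. restrict x {a..<a + int n}) ` X"
      then obtain x where "x \<in> X" "w = ?f (restrict x {a..<a + int n})" by blast
      thus "w \<in> (\<lambda>x. restrict x {0..<int n}) ` X" unfolding f using translate_in by blast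
    next
      fix w assume "w \<in> (\<lambda>x. restrict x {0..<int n}) ` X"
      then obtain x where x: "x \<in> X" "w = restrict x {0..<int n}" by blast
      hence "w = ?f (restrict (translate (-a) x) {a..<a + int n})" unfolding f by simp
      thus "w \<in> ?f ` (\<lambda>x. restrict x {a..<a + int n}) ` X" using x(1) translate_in by blast
    qed
  qed
  thus ?thesis by (simp add: word_count_def)
qed

lemma word_count_pos: "word_count X n \<ge> 1"
  using ne finite_windows[of 0 "int n"] by (simp add: word_count_def Suc_le_eq card_gt_0_iff)

lemma word_count_submult: "word_count X (m + n) \<le> word_count X m * word_count X n"
proof -
  let ?R = "\<lambda>a b. (\<lambda>x. restrict x {a..<b::int}) ` X"
  have "word_count X (m + n) = card (?R 0 (int (m + n)))" by (simp add: word_count_def)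
  also have "\<dots> \<le> card (?R 0 (int m) \<times> ?R (int m) (int m + int n))"
  proof (rule card_inj_on_le)
    let ?f = "\<lambda>w. (restrict w {0..<int m}, restrict w {int m..<int m + int n})"
    show "inj_on ?f (?R 0 (int (m + n)))"
    proof (rule inj_onI)
      fix v w assume v: "v \<in> ?R 0 (int (m + n))" and w: "w \<in> ?R 0 (int (m + n))" and eq: "?f v = ?f w"
      show "v = w"
      proof
        fix i
        have 1: "restrict v {0..<int m} i = restrict w {0..<int m} i"
          and 2: "restrict v {int m..<int m + int n} i = restrict w {int m..<int m + int n} i"
          using eq by simp_all
        have 3: "v i = w i" if "i \<notin> {0..<int (m + n)}" using v w that by auto
        show "v i = w i" using 1 2 3 by (cases "i \<in> {0..<int m}"; cases "i \<in> {int m..<int m + int n}") auto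
      qed
    qed
    show "?f ` ?R 0 (int (m + n)) \<subseteq> ?R 0 (int m) \<times> ?R (int m) (int m + int n)"
      by (auto simp: image_iff intro!: bexI restrict_ext)
    show "finite (?R 0 (int m) \<times> ?R (int m) (int m + int n))"
      using finite_windows by blast
  qed
  also have "\<dots> = word_count X m * word_count X n"
    using card_windows[of 0 m] card_windows[of "int m" n] by (simp add: card_cartesian_product)
  finally show ?thesis .
qed

section \<open>Minimal subcovers of iterated joins and the word count\<close>

lemma open_cover_finite_subcover:
  assumes "open_cover T \<U>"
  obtains \<V> where "\<V> \<subseteq> \<U>" "finite \<V>" "\<Union>\<V> = X"
proof -
  have *: "\<And>U. U \<in> \<U> \<Longrightarrow> openin T U" "\<Union>\<U> = X" using assms by (auto simp: open_cover_def)
  obtain \<V> where \<V>: "finite \<V>" "\<V> \<subseteq> \<U>" "X \<subseteq> \<Union>\<V>"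
    using compact_T * unfolding compact_space_def compactin_def topspace_T by (metis order_refl)
  moreover have "\<Union>\<V> = X" using \<V>(2,3) *(2) by blast
  ultimately show ?thesis using that[of \<V>] by simp
qed

lemma cover_number_le:
  "\<V> \<subseteq> \<U> \<Longrightarrow> finite \<V> \<Longrightarrow> \<Union>\<V> = X \<Longrightarrow> cover_number T \<U> \<le> card \<V>"
  unfolding cover_number_def by (rule Least_le) auto

lemma cover_number_attained:
  assumes "\<V> \<subseteq> \<U>" "finite \<V>" "\<Union>\<V> = X"
  obtains \<W> where "\<W> \<subseteq> \<U>" "finite \<W>" "\<Union>\<W> = X" "card \<W> = cover_number T \<U>"
proof -
  let ?P = "\<lambda>n. \<exists>\<V>\<subseteq>\<U>. finite \<V> \<and> card \<V> = n \<and> \<Union>\<V> = topspace T"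
  have "?P (card \<V>)" using assms by auto
  hence "?P (LEAST n. ?P n)" by (rule LeastI)
  thus ?thesis using that unfolding cover_number_def by auto
qed

lemma iterated_joinE:
  assumes "S \<in> iterated_join T shift \<U> n"
  obtains F where "S = {x \<in> X. \<forall>k<n. (shift ^^ k) x \<in> F k}" "\<forall>k<n. F k \<in> \<U>"
  using assms unfolding iterated_join_def topspace_T by blast

lemma finite_iterated_join:
  assumes "finite \<V>"
  shows "finite (iterated_join T shift \<V> n)"
proof (rule finite_subset)
  let ?g = "\<lambda>U. {x \<in> topspace T. \<forall>k<n. (shift ^^ k) x \<in> U k}"
  show "iterated_join T shift \<V> n \<subseteq> ?g ` ({..<n} \<rightarrow>\<^sub>E \<V>)"
  proof
    fix S assume "S \<in> iterated_join T shift \<V> n"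
    then obtain U where U: "S = ?g U" "\<forall>k<n. U k \<in> \<V>" unfolding iterated_join_def by blast
    have "S = ?g (restrict U {..<n})" using U(1) by auto
    moreover have "restrict U {..<n} \<in> {..<n} \<rightarrow>\<^sub>E \<V>" using U(2) by auto
    ultimately show "S \<in> ?g ` ({..<n} \<rightarrow>\<^sub>E \<V>)" by blast
  qed
  show "finite (?g ` ({..<n} \<rightarrow>\<^sub>E \<V>))" using assms by (intro finite_imageI finite_PiE) auto
qed

lemma iterated_join_mono: "\<V> \<subseteq> \<U> \<Longrightarrow> iterated_join T shift \<V> n \<subseteq> iterated_join T shift \<U> n"
  unfolding iterated_join_def by blast

lemma Union_iterated_join:
  assumes "\<Union>\<V> = X"
  shows "\<Union>(iterated_join T shift \<V> n) = X"
proof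
  show "X \<subseteq> \<Union>(iterated_join T shift \<V> n)"
  proof
    fix x assume x: "x \<in> X"
    have "\<forall>k. \<exists>V\<in>\<V>. (shift ^^ k) x \<in> V" using x unfolding Union_iff[symmetric] assms funpow_shift_eq by simp
    then obtain U where "\<forall>k. U k \<in> \<V> \<and> (shift ^^ k) x \<in> U k" by metis
    thus "x \<in> \<Union>(iterated_join T shift \<V> n)" using x unfolding iterated_join_def by auto
  qed
qed (auto simp: iterated_join_def)

lemma iterated_join_subcover:
  assumes "open_cover T \<U>"
  obtains \<W> where "\<W> \<subseteq> iterated_join T shift \<U> n" "finite \<W>" "\<Union>\<W> = X"
    "card \<W> = cover_number T (iterated_join T shift \<U> n)"
proof -
  obtain \<V> where "\<V> \<subseteq> \<U>" "finite \<V>" "\<Union>\<V> = X" using open_cover_finite_subcover[OF assms] .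
  thus ?thesis
    using cover_number_attained[OF iterated_join_mono finite_iterated_join Union_iterated_join] that
    by metis
qed

lemma cover_number_iterated_join_pos:
  assumes "open_cover T \<U>"
  shows "1 \<le> cover_number T (iterated_join T shift \<U> n)"
proof -
  obtain \<W> where "finite \<W>" "\<Union>\<W> = X" "card \<W> = cover_number T (iterated_join T shift \<U> n)"
    using iterated_join_subcover[OF assms] .
  thus ?thesis using ne by (metis Suc_leI Sup_empty card_gt_0_iff One_nat_def)
qed

lemma cover_number_iterated_join_submult:
  assumes "open_cover T \<U>"
  shows "cover_number T (iterated_join T shift \<U> (m + n))
    \<le> cover_number T (iterated_join T shift \<U> m) * cover_number T (iterated_join T shift \<U> n)"
proof -
  obtain \<V> where \<V>: "\<V> \<subseteq> iterated_join T shift \<U> m" "finite \<V>" "\<Union>\<V> = X"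
    "card \<V> = cover_number T (iterated_join T shift \<U> m)"
    using iterated_join_subcover[OF assms] .
  obtain \<W> where \<W>: "\<W> \<subseteq> iterated_join T shift \<U> n" "finite \<W>" "\<Union>\<W> = X"
    "card \<W> = cover_number T (iterated_join T shift \<U> n)"
    using iterated_join_subcover[OF assms] .
  let ?f = "\<lambda>(V, W). V \<inter> {x \<in> X. (shift ^^ m) x \<in> W}"
  have "cover_number T (iterated_join T shift \<U> (m + n)) \<le> card (?f ` (\<V> \<times> \<W>))"
  proof (rule cover_number_le)
    show "?f ` (\<V> \<times> \<W>) \<subseteq> iterated_join T shift \<U> (m + n)"
    proof clarify
      fix V W assume "V \<in> \<V>" "W \<in> \<W>"
      hence V: "V \<in> iterated_join T shift \<U> m" and W: "W \<in> iterated_join T shift \<U> n"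
        using \<V>(1) \<W>(1) by blast+
      obtain F where F: "V = {x \<in> X. \<forall>k<m. (shift ^^ k) x \<in> F k}" "\<forall>k<m. F k \<in> \<U>"
        using iterated_joinE[OF V] .
      obtain G where G: "W = {x \<in> X. \<forall>k<n. (shift ^^ k) x \<in> G k}" "\<forall>k<n. G k \<in> \<U>"
        using iterated_joinE[OF W] .
      define H where "H k = (if k < m then F k else G (k - m))" for k
      have 1: "(\<forall>k<m + n. (shift ^^ k) x \<in> H k) \<longleftrightarrow>
          (\<forall>k<m. (shift ^^ k) x \<in> F k) \<and> (\<forall>k<n. (shift ^^ (k + m)) x \<in> G k)" for x
      proof safe
        fix k assume a: "\<forall>k<m + n. (shift ^^ k) x \<in> H k" 
        { assume "k < m" thus "(shift ^^ k) x \<in> F k" using a[rule_format, of k] by (simp add: H_def) }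
        { assume "k < n" thus "(shift ^^ (k + m)) x \<in> G k" using a[rule_format, of "k + m"] by (simp add: H_def) }
      next
        fix k assume a: "\<forall>k<m. (shift ^^ k) x \<in> F k" "\<forall>k<n. (shift ^^ (k + m)) x \<in> G k" "k < m + n"
        show "(shift ^^ k) x \<in> H k"
          using a(1)[rule_format, of k] a(2)[rule_format, of "k - m"] a(3) by (auto simp: H_def)
      qed
      have 2: "\<forall>k<m + n. H k \<in> \<U>" using F(2) G(2) by (auto simp: H_def)
      have "V \<inter> {x \<in> X. (shift ^^ m) x \<in> W} = {x \<in> X. \<forall>k<m + n. (shift ^^ k) x \<in> H k}"
        unfolding F(1) G(1) 1 by (auto simp: funpow_add funpow_shift_eq)
      thus "V \<inter> {x \<in> X. (shift ^^ m) x \<in> W} \<in> iterated_join T shift \<U> (m + n)"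
        using 2 unfolding iterated_join_def topspace_T by blast
    qed
    show "\<Union>(?f ` (\<V> \<times> \<W>)) = X"
    proof
      show "X \<subseteq> \<Union>(?f ` (\<V> \<times> \<W>))"
      proof
        fix x assume x: "x \<in> X"
        obtain V where "V \<in> \<V>" "x \<in> V" using \<V>(3) x by blast
        moreover have "(shift ^^ m) x \<in> X" using x by (simp add: funpow_shift_eq)
        then obtain W where "W \<in> \<W>" "(shift ^^ m) x \<in> W" using \<W>(3) by blast
        ultimately show "x \<in> \<Union>(?f ` (\<V> \<times> \<W>))" using x by auto
      qed
    qed auto
  qed (use \<V> \<W> in auto)
  also have "\<dots> \<le> card (\<V> \<times> \<W>)" using \<V> \<W> by (intro card_image_le) auto
  finally show ?thesis using \<V> \<W> by (simp add: card_cartesian_product)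
qed

lemma lebesgue_window:
  assumes "open_cover T \<U>"
  obtains K :: nat where "\<And>x. x \<in> X \<Longrightarrow> \<exists>U\<in>\<U>. \<forall>y\<in>X. (\<forall>i. \<bar>i\<bar> \<le> int K \<longrightarrow> y i = x i) \<longrightarrow> y \<in> U"
proof -
  have "\<exists>U\<in>\<U>. \<exists>k::int. \<forall>y\<in>X. (\<forall>i. \<bar>i\<bar> \<le> k \<longrightarrow> y i = x i) \<longrightarrow> y \<in> U" if x: "x \<in> X" for x
  proof -
    obtain U where U: "U \<in> \<U>" "x \<in> U" using assms x by (auto simp: open_cover_def)
    hence "openin T U" using assms by (auto simp: open_cover_def)
    thus ?thesis using U unfolding openin_T_iff by blast
  qed
  then obtain k :: "_ \<Rightarrow> int" where k: "\<And>x. x \<in> X \<Longrightarrow>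
      \<exists>U\<in>\<U>. \<forall>y\<in>X. (\<forall>i. \<bar>i\<bar> \<le> k x \<longrightarrow> y i = x i) \<longrightarrow> y \<in> U" by metis
  let ?c = "\<lambda>x. {y \<in> X. \<forall>i. \<bar>i\<bar> \<le> k x \<longrightarrow> y i = x i}"
  have "open_cover T (?c ` X)"
    unfolding open_cover_def openin_T_iff by fastforce
  then obtain \<V> where \<V>: "\<V> \<subseteq> ?c ` X" "finite \<V>" "\<Union>\<V> = X"
    by (rule open_cover_finite_subcover)
  then obtain S where S: "S \<subseteq> X" "finite S" "\<V> = ?c ` S" by (meson finite_subset_image)
  define K where "K = nat (Max (insert 0 (k ` S)))"
  have K: "k s \<le> int K" if "s \<in> S" for s
  proof -
    have "k s \<le> Max (insert 0 (k ` S))" "0 \<le> Max (insert 0 (k ` S))"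
      using S(2) that by (auto intro!: Max_ge)
    thus ?thesis unfolding K_def by simp
  qed
  show ?thesis
  proof (rule that)
    fix x assume x: "x \<in> X"
    have "x \<in> \<Union>(?c ` S)" using x unfolding S(3)[symmetric] \<V>(3) .
    then obtain s where s: "s \<in> S" "x \<in> ?c s" by (rule UN_E)
    then obtain U where U: "U \<in> \<U>" "\<And>y. y \<in> X \<Longrightarrow> (\<forall>i. \<bar>i\<bar> \<le> k s \<longrightarrow> y i = s i) \<Longrightarrow> y \<in> U"
      using k S(1) by blast
    have "y \<in> U" if "y \<in> X" "\<forall>i. \<bar>i\<bar> \<le> int K \<longrightarrow> y i = x i" for y
      using U(2)[OF that(1)] that(2) s(2) K[OF s(1)] by auto
    thus "\<exists>U\<in>\<U>. \<forall>y\<in>X. (\<forall>i. \<bar>i\<bar> \<le> int K \<longrightarrow> y i = x i) \<longrightarrow> y \<in> U" using U(1) by blast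
  qed
qed

text \<open>A Lebesgue number argument: the letters within distance \<open>K\<close> of a coordinate
  select a member of the cover, so the word on \<open>[-K, n + K]\<close> selects a member of the
  \<open>n\<close>-th join.\<close>

lemma cover_number_le_word_count:
  assumes "open_cover T \<U>"
  obtains c where "\<And>n. cover_number T (iterated_join T shift \<U> n) \<le> word_count X (n + c)"
proof -
  obtain K where "\<And>x. x \<in> X \<Longrightarrow> \<exists>U\<in>\<U>. \<forall>y\<in>X. (\<forall>i. \<bar>i\<bar> \<le> int K \<longrightarrow> y i = x i) \<longrightarrow> y \<in> U"
    using lebesgue_window[OF assms] by metis
  then obtain E where E: "\<And>x. x \<in> X \<Longrightarrow> E x \<in> \<U>"
     "\<And>x y. x \<in> X \<Longrightarrow> y \<in> X \<Longrightarrow> (\<forall>i. \<bar>i\<bar> \<le> int K \<longrightarrow> y i = x i) \<Longrightarrow> y \<in> E x" by metis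
  have "cover_number T (iterated_join T shift \<U> n) \<le> word_count X (n + (2 * K + 1))" for n
  proof -
    define I where "I = {- int K..<- int K + int (n + (2 * K + 1))}"
    \<comment> \<open>One point is chosen for every word, since the selected member of the join has
      to depend on the word alone.\<close>
    define p where "p w = (SOME x. x \<in> X \<and> restrict x I = w)" for w
    have p: "p (restrict x I) \<in> X \<and> restrict (p (restrict x I)) I = restrict x I" if "x \<in> X" for x
      unfolding p_def by (rule someI[of _ x]) (use that in auto)
    define g where "g w = {x \<in> X. \<forall>k<n. (shift ^^ k) x \<in> E ((shift ^^ k) (p w))}" for w
    let ?R = "(\<lambda>x. restrict x I) ` X"
    have "cover_number T (iterated_join T shift \<U> n) \<le> card (g ` ?R)"
    proof (rule cover_number_le)
      show "g ` ?R \<subseteq> iterated_join T shift \<U> n"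
      proof clarify
        fix x assume "x \<in> X"
        hence "\<forall>k<n. E ((shift ^^ k) (p (restrict x I))) \<in> \<U>"
          using p E(1) by (simp add: funpow_shift_eq)
        thus "g (restrict x I) \<in> iterated_join T shift \<U> n"
          unfolding g_def iterated_join_def topspace_T
          by (intro CollectI exI[of _ "\<lambda>k. E ((shift ^^ k) (p (restrict x I)))"]) simp
      qed
      show "finite (g ` ?R)" unfolding I_def using finite_windows by blast
      show "\<Union>(g ` ?R) = X"
      proof
        show "X \<subseteq> \<Union>(g ` ?R)"
        proof
          fix x assume x: "x \<in> X"
          have eq: "p (restrict x I) i = x i" if "i \<in> I" for i
            using p[OF x] that by (metis restrict_apply')
          have "x i = p (restrict x I) i" if "k < n" "\<bar>i - int k\<bar> \<le> int K" for i k
            using that by (intro eq[symmetric]) (auto simp: I_def)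
          hence "x \<in> g (restrict x I)"
            unfolding g_def funpow_shift_eq by (auto intro!: E(2) simp: x p)
          thus "x \<in> \<Union>(g ` ?R)" using x by blast
        qed
      qed (auto simp: g_def)
    qed
    also have "\<dots> \<le> card ?R" unfolding I_def by (intro card_image_le finite_windows)
    also have "\<dots> = word_count X (n + (2 * K + 1))" unfolding I_def by (rule card_windows)
    finally show ?thesis .
  qed
  thus ?thesis using that by blast
qed

text \<open>For the partition by the letter at 0 the nonempty members of the join are disjoint
  cylinders, one for each word, so a subcover cannot omit any of them.\<close>

lemma word_count_le_cover_number:
  obtains \<U> where "open_cover T \<U>"
    "\<And>n. word_count X n \<le> cover_number T (iterated_join T shift \<U> n)"
proof -
  define \<U> where "\<U> = {{x \<in> X. x 0 = a} | a. a \<in> A}"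
  have oc: "open_cover T \<U>"
    unfolding open_cover_def openin_T_iff
  proof (intro conjI ballI)
    fix U x assume "U \<in> \<U>" "x \<in> U"
    thus "\<exists>k. \<forall>y\<in>X. (\<forall>i. \<bar>i\<bar> \<le> k \<longrightarrow> y i = x i) \<longrightarrow> y \<in> U"
      by (auto simp: \<U>_def intro!: exI[of _ 0])
  qed (use X_letter in \<open>auto simp: \<U>_def\<close>)
  have "word_count X n \<le> cover_number T (iterated_join T shift \<U> n)" for n
  proof -
    obtain \<W> where \<W>: "\<W> \<subseteq> iterated_join T shift \<U> n" "finite \<W>" "\<Union>\<W> = X"
      "card \<W> = cover_number T (iterated_join T shift \<U> n)"
      using iterated_join_subcover[OF oc] .
    define p where "p w = (SOME x. x \<in> X \<and> restrict x {0..<int n} = w)" for w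
    let ?R = "(\<lambda>x. restrict x {0..<int n}) ` X"
    have p: "p w \<in> X" "restrict (p w) {0..<int n} = w" if w: "w \<in> ?R" for w
      using someI_ex[of "\<lambda>x. x \<in> X \<and> restrict x {0..<int n} = w"] w unfolding p_def by auto
    have "\<forall>w\<in>?R. \<exists>V\<in>\<W>. p w \<in> V" using p \<W>(3) by blast
    then obtain V where V: "\<And>w. w \<in> ?R \<Longrightarrow> V w \<in> \<W>" "\<And>w. w \<in> ?R \<Longrightarrow> p w \<in> V w" by metis
    have "card ?R \<le> card \<W>"
    proof (rule card_inj_on_le)
      show "inj_on V ?R"
      proof (rule inj_onI)
        fix v w assume v: "v \<in> ?R" and w: "w \<in> ?R" and eq: "V v = V w"
        have "V v \<in> iterated_join T shift \<U> n" using V v \<W>(1) by blast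
        then obtain F where F: "V v = {x \<in> X. \<forall>k<n. (shift ^^ k) x \<in> F k}" "\<forall>k<n. F k \<in> \<U>"
          by (rule iterated_joinE)
        have "p v i = p w i" if i: "i \<in> {0..<int n}" for i
        proof -
          have k: "nat i < n" "int (nat i) = i" using i by auto
          have "(shift ^^ nat i) (p v) \<in> F (nat i)" "(shift ^^ nat i) (p w) \<in> F (nat i)"
            using V(2)[OF v] V(2)[OF w] k(1) unfolding eq[symmetric] unfolding F(1) by auto
          moreover have "F (nat i) \<in> \<U>" using F(2) k by auto
          ultimately show ?thesis using k by (auto simp: \<U>_def funpow_shift_eq)
        qed
        hence "restrict (p v) {0..<int n} = restrict (p w) {0..<int n}" by (rule restrict_ext)
        thus "v = w" using p(2)[OF v] p(2)[OF w] by simp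
      qed
    qed (use V \<W> in auto)
    thus ?thesis using \<W>(4) by (simp add: word_count_def)
  qed
  thus ?thesis using oc that by blast
qed

lemma entropy_eq_word_growth:
  obtains h where "(\<lambda>n. ln (real (word_count X n)) / real n) \<longlonglongrightarrow> h"
    "topological_entropy T shift = ereal h"
proof -
  let ?N = "\<lambda>\<U> n. cover_number T (iterated_join T shift \<U> n)"
  have conv: "\<exists>L. (\<lambda>n. ln (real (f n)) / real n) \<longlonglongrightarrow> L"
    if pos: "\<And>n. 1 \<le> f n" and sub: "\<And>m n. f (m + n) \<le> f m * f n" for f :: "nat \<Rightarrow> nat"
  proof -
    have "ln (real (f (m + n))) \<le> ln (real (f m)) + ln (real (f n))" for m n
    proof -
      have "0 < f m" "0 < f n" "0 < f (m + n)" using pos by (auto simp: Suc_le_eq)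
      have "real (f (m + n)) \<le> real (f m) * real (f n)"
        using sub[of m n] by (metis of_nat_le_iff of_nat_mult)
      hence "ln (real (f (m + n))) \<le> ln (real (f m) * real (f n))"
        using \<open>0 < f m\<close> \<open>0 < f n\<close> \<open>0 < f (m + n)\<close> by (subst ln_le_cancel_iff) auto
      thus ?thesis using \<open>0 < f m\<close> \<open>0 < f n\<close> by (simp add: ln_mult)
    qed
    moreover have "0 \<le> ln (real (f n))" for n using pos[of n] by simp
    ultimately obtain L where "(\<lambda>n. ln (real (f n)) / real n) \<longlonglongrightarrow> L"
      by (rule subadditive_quotients_converge[of "\<lambda>n. ln (real (f n))"])
    thus ?thesis by blast
  qed
  obtain h where h: "(\<lambda>n. ln (real (word_count X n)) / real n) \<longlonglongrightarrow> h"
    using conv[of "word_count X"] word_count_pos word_count_submult by blast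
  have ent: "\<exists>L. (\<lambda>n. ln (real (?N \<U> n)) / real n) \<longlonglongrightarrow> L \<and> cover_entropy T shift \<U> = ereal L"
    if oc: "open_cover T \<U>" for \<U>
  proof -
    obtain L where L: "(\<lambda>n. ln (real (?N \<U> n)) / real n) \<longlonglongrightarrow> L"
      using conv[of "?N \<U>"] cover_number_iterated_join_pos[OF oc]
        cover_number_iterated_join_submult[OF oc] by blast
    hence "(\<lambda>n. ereal (ln (real (?N \<U> n)) / real n)) \<longlonglongrightarrow> ereal L" by simp
    hence "cover_entropy T shift \<U> = ereal L" unfolding cover_entropy_def by (rule limI)
    thus ?thesis using L by blast
  qed
  have upper: "cover_entropy T shift \<U> \<le> ereal h" if oc: "open_cover T \<U>" for \<U>
  proof -
    obtain L where L: "(\<lambda>n. ln (real (?N \<U> n)) / real n) \<longlonglongrightarrow> L" "cover_entropy T shift \<U> = ereal L"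
      using ent[OF oc] by blast
    obtain c where c: "\<And>n. ?N \<U> n \<le> word_count X (n + c)" using cover_number_le_word_count[OF oc] by metis
    \<comment> \<open>The fixed lengthening by \<open>c\<close> is absorbed in a factor that tends
      to 1.\<close>
    have "(\<lambda>n. ln (real (word_count X (n + c))) / real (n + c) * (real (n + c) / real n)) \<longlonglongrightarrow> h * 1"
    proof (rule tendsto_mult)
      show "(\<lambda>n. ln (real (word_count X (n + c))) / real (n + c)) \<longlonglongrightarrow> h"
        using h by (rule LIMSEQ_ignore_initial_segment)
      have "(\<lambda>n. 1 + real c * inverse (real n)) \<longlonglongrightarrow> 1 + real c * 0"
        by (intro tendsto_intros lim_inverse_n)
      hence "(\<lambda>n. 1 + real c * inverse (real n)) \<longlonglongrightarrow> 1" by simp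
      thus "(\<lambda>n. real (n + c) / real n) \<longlonglongrightarrow> 1"
        by (rule Lim_transform_eventually)
          (auto intro!: eventually_mono[OF eventually_gt_at_top[of 0]] simp: field_simps)
    qed
    moreover have "\<exists>N. \<forall>n\<ge>N. ln (real (?N \<U> n)) / real n
        \<le> ln (real (word_count X (n + c))) / real (n + c) * (real (n + c) / real n)"
    proof (intro exI[of _ 1] allI impI)
      fix n :: nat assume n: "1 \<le> n"
      have "ln (real (?N \<U> n)) \<le> ln (real (word_count X (n + c)))"
        using c[of n] cover_number_iterated_join_pos[OF oc, of n] by (subst ln_le_cancel_iff) auto
      thus "ln (real (?N \<U> n)) / real n
        \<le> ln (real (word_count X (n + c))) / real (n + c) * (real (n + c) / real n)"
        using n by (simp add: divide_right_mono)
    qed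
    ultimately have "L \<le> h * 1" using L(1) by (intro LIMSEQ_le)
    thus ?thesis using L by simp
  qed
  obtain \<U> where \<U>: "open_cover T \<U>" "\<And>n. word_count X n \<le> ?N \<U> n"
    using word_count_le_cover_number by metis
  obtain L where L: "(\<lambda>n. ln (real (?N \<U> n)) / real n) \<longlonglongrightarrow> L" "cover_entropy T shift \<U> = ereal L"
    using ent[OF \<U>(1)] by blast
  have "h \<le> L"
  proof (rule LIMSEQ_le[OF h L(1)], intro exI allI impI divide_right_mono)
    fix n show "ln (real (word_count X n)) \<le> ln (real (?N \<U> n))"
      using \<U>(2)[of n] word_count_pos[of n] by (subst ln_le_cancel_iff) auto
  qed simp
  have "topological_entropy T shift = ereal h"
    unfolding topological_entropy_def
  proof (rule antisym)
    show "(SUP \<U>\<in>{\<U>. open_cover T \<U>}. cover_entropy T shift \<U>) \<le> ereal h"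
      by (rule SUP_least) (use upper in simp)
    have "ereal h \<le> cover_entropy T shift \<U>" using \<open>h \<le> L\<close> L by simp
    also have "\<dots> \<le> (SUP \<U>\<in>{\<U>. open_cover T \<U>}. cover_entropy T shift \<U>)"
      by (rule SUP_upper) (use \<U> in simp)
    finally show "ereal h \<le> (SUP \<U>\<in>{\<U>. open_cover T \<U>}. cover_entropy T shift \<U>)" .
  qed
  thus ?thesis using h that by blast
qed

end

section \<open>Subgroups of small index that miss an element\<close>

definition centralizer_of :: "('g, 'm) monoid_scheme \<Rightarrow> 'g \<Rightarrow> 'g set" where
  "centralizer_of G g = {c \<in> carrier G. c \<otimes>\<^bsub>G\<^esub> g = g \<otimes>\<^bsub>G\<^esub> c}"

text \<open>The last clause says that \<open>H \<inter> C\<close> has index at most \<open>d\<close> in \<open>C\<close> when \<open>C\<close> is a subgroup.\<close>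

definition separable_by_index :: "('g, 'm) monoid_scheme \<Rightarrow> 'g set \<Rightarrow> 'g \<Rightarrow> nat \<Rightarrow> bool" where
  "separable_by_index G C h d \<longleftrightarrow> (\<exists>H. subgroup H G \<and> h \<notin> H \<and>
    (\<forall>S\<subseteq>C. finite S \<and> d < card S \<longrightarrow> (\<exists>a\<in>S. \<exists>b\<in>S. a \<noteq> b \<and> a \<otimes>\<^bsub>G\<^esub> inv\<^bsub>G\<^esub> b \<in> H)))"

lemma (in group) centralizer_of_inv:
  assumes "g \<in> carrier G"
  shows "centralizer_of G (inv g) = centralizer_of G g"
proof -
  have "centralizer_of G g \<subseteq> centralizer_of G (inv g)" if g: "g \<in> carrier G" for g
  proof
    fix c assume "c \<in> centralizer_of G g"
    hence c: "c \<in> carrier G" "c \<otimes> g = g \<otimes> c" by (auto simp: centralizer_of_def)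
    have "c \<otimes> inv g = inv g \<otimes> (g \<otimes> c) \<otimes> inv g" using g c(1) by (simp add: m_assoc[symmetric])
    also have "\<dots> = inv g \<otimes> c" unfolding c(2)[symmetric] using g c(1) by (simp add: m_assoc)
    finally have "inv g \<otimes> c = c \<otimes> inv g" ..
    thus "c \<in> centralizer_of G (inv g)" using c by (simp add: centralizer_of_def)
  qed
  from this[of g] this[of "inv g"] show ?thesis using assms by auto
qed

lemma (in group) centralizer_of_pow:
  assumes "g \<in> carrier G" "c \<in> centralizer_of G g"
  shows "c \<in> centralizer_of G (g [^] (k::nat))"
proof -
  have c: "c \<in> carrier G" "c \<otimes> g = g \<otimes> c" using assms by (auto simp: centralizer_of_def)
  have "c \<otimes> g [^] k = g [^] k \<otimes> c"
  proof (induction k)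
    case (Suc k)
    have "c \<otimes> (g [^] k \<otimes> g) = g [^] k \<otimes> (c \<otimes> g)"
      using Suc c(1) assms(1) by (metis m_assoc nat_pow_closed)
    also have "\<dots> = g [^] k \<otimes> g \<otimes> c" using c assms(1) by (simp add: m_assoc)
    finally show ?case by simp
  qed (use c in auto)
  thus ?thesis using c by (simp add: centralizer_of_def)
qed

text \<open>The separating subgroup is pulled back along \<open>\<psi>\<close>. Distinct elements of
  \<open>C\<close> stay distinct and land in \<open>C'\<close>, so the pigeonhole bound passes from
  \<open>C'\<close> to \<open>C\<close> with the same \<open>d\<close>.\<close>

lemma separable_by_index_iso:
  assumes G: "group G" and G': "group G'" and \<psi>: "\<psi> \<in> hom G G'" and inj: "inj_on \<psi> (carrier G)"
    and C: "C \<subseteq> carrier G" "\<psi> ` C \<subseteq> C'" and h: "h \<in> carrier G"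
    and sep: "separable_by_index G' C' (\<psi> h) d"
  shows "separable_by_index G C h d"
proof -
  interpret group_hom G G' \<psi> by (intro group_hom.intro group_hom_axioms.intro G G' \<psi>)
  from sep[unfolded separable_by_index_def] obtain H where H: "subgroup H G'" "\<psi> h \<notin> H"
    "\<forall>S\<subseteq>C'. finite S \<and> d < card S \<longrightarrow> (\<exists>a\<in>S. \<exists>b\<in>S. a \<noteq> b \<and> a \<otimes>\<^bsub>G'\<^esub> inv\<^bsub>G'\<^esub> b \<in> H)"
    by (elim exE conjE)
  interpret H: subgroup H G' by (rule H(1))
  let ?K = "{x \<in> carrier G. \<psi> x \<in> H}"
  have "subgroup ?K G"
  proof (rule G.subgroupI)
    have "\<one>\<^bsub>G\<^esub> \<in> ?K" by simp
    thus "?K \<noteq> {}" by blast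
  qed auto
  moreover have "\<exists>a\<in>S. \<exists>b\<in>S. a \<noteq> b \<and> a \<otimes>\<^bsub>G\<^esub> inv\<^bsub>G\<^esub> b \<in> ?K"
    if S: "S \<subseteq> C" "finite S" "d < card S" for S
  proof -
    have "inj_on \<psi> S" using inj S C by (meson inj_on_subset subset_trans)
    hence "d < card (\<psi> ` S)" using S by (simp add: card_image)
    moreover have "\<psi> ` S \<subseteq> C'" using S(1) C(2) by blast
    ultimately obtain a b where "a \<in> S" "b \<in> S" "\<psi> a \<noteq> \<psi> b" "\<psi> a \<otimes>\<^bsub>G'\<^esub> inv\<^bsub>G'\<^esub> \<psi> b \<in> H"
      using H(3)[rule_format, of "\<psi> ` S"] S(2) by auto
    moreover have "a \<in> carrier G" "b \<in> carrier G" using calculation S(1) C(1) by auto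
    ultimately show ?thesis by (intro bexI[of _ a] bexI[of _ b]) auto
  qed
  ultimately show ?thesis using H(2) h unfolding separable_by_index_def by (intro exI[of _ ?K]) auto
qed

section \<open>Three-cycles and subsets of small index in a symmetric group\<close>

hide_const (open) Finite_Cartesian_Product.transpose

text \<open>The product \<open>transpose a b \<circ> transpose a c\<close> is the cycle that sends
  \<open>a\<close> to \<open>c\<close>, \<open>c\<close> to \<open>b\<close> and \<open>b\<close> to
  \<open>a\<close>; the same cycle may be spelled from any of its points.\<close>

lemma transpose_conj_cycle:
  assumes "a \<noteq> b" "b \<noteq> c" "a \<noteq> c"
  shows "transpose a b \<circ> transpose a c = transpose b c \<circ> transpose b a"
  using assms by (auto simp: fun_eq_iff Transposition.transpose_def)

lemma transpose_cycle_order_three: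
  assumes "a \<noteq> b" "a \<noteq> c" "b \<noteq> c" and "p = transpose a b \<circ> transpose a c"
  shows "p \<circ> p \<circ> p = id"
  using assms by (auto simp: fun_eq_iff Transposition.transpose_def)

text \<open>The conjugating cycle sends \<open>a\<close> to \<open>v\<close> and fixes
  \<open>b\<close> and \<open>c\<close>, so it turns a 3-cycle on \<open>a, b, c\<close> into one on
  \<open>v, b, c\<close>.\<close>

lemma conj_by_cycle:
  assumes "a \<noteq> b" "a \<noteq> c" "b \<noteq> c" "a \<noteq> u" "a \<noteq> v" "u \<noteq> v" "b \<noteq> u" "b \<noteq> v" "c \<noteq> u" "c \<noteq> v"
  shows "(transpose a u \<circ> transpose a v) \<circ> (transpose a b \<circ> transpose a c) \<circ> (transpose a v \<circ> transpose a u)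
    = transpose v b \<circ> transpose v c"
  using assms by (auto simp: fun_eq_iff Transposition.transpose_def)

text \<open>
  The index of \<open>K\<close> in \<open>Sym(W)\<close> enters only through pigeonhole on the transpositions \<open>(a y)\<close>, which
  produces 3-cycles in \<open>K\<close>. Two such 3-cycles sharing a point generate all 3-cycles on their union.
\<close>

lemma three_cycles_in_small_index:
  fixes W :: "'w set" and K :: "('w \<Rightarrow> 'w) set"
  assumes fin: "finite W"
    and comp: "\<And>p q. p \<in> K \<Longrightarrow> q \<in> K \<Longrightarrow> p \<circ> q \<in> K"
    and pigeon: "\<And>a Y. a \<in> W \<Longrightarrow> Y \<subseteq> W \<Longrightarrow> d < card Y \<Longrightarrow>
        \<exists>y\<in>Y. \<exists>y'\<in>Y. y \<noteq> y' \<and> transpose a y \<circ> transpose a y' \<in> K"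
    and big: "2 * d + 2 < card W"
    and abc: "a \<in> W" "b \<in> W" "c \<in> W" "a \<noteq> b" "a \<noteq> c" "b \<noteq> c"
  shows "transpose a b \<circ> transpose a c \<in> K"
proof -
  define good where "good a b c \<longleftrightarrow> a \<noteq> b \<and> b \<noteq> c \<and> a \<noteq> c \<and> transpose a b \<circ> transpose a c \<in> K" for a b c
  have rot: "good b c a" if "good a b c" for a b c
    using that transpose_conj_cycle[of a b c] by (auto simp: good_def)
  \<comment> \<open>\<open>K\<close> is closed under composition, and the inverse of a 3-cycle is
    its square.\<close>
  have inv: "good a c b" if g: "good a b c" for a b c
  proof -
    have "(transpose a b \<circ> transpose a c) \<circ> (transpose a b \<circ> transpose a c) \<in> K"
      using g comp by (simp add: good_def)
    moreover have "(transpose a b \<circ> transpose a c) \<circ> (transpose a b \<circ> transpose a c)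
        = transpose a c \<circ> transpose a b"
      using g by (auto simp: good_def fun_eq_iff Transposition.transpose_def)
    ultimately show ?thesis using g by (auto simp: good_def)
  qed
  have trans: "good a x z" if "good a x y" "good a y z" "x \<noteq> z" for a x y z
  proof -
    have "(transpose a x \<circ> transpose a y) \<circ> (transpose a y \<circ> transpose a z) \<in> K"
      using that comp by (simp add: good_def)
    moreover have "(transpose a x \<circ> transpose a y) \<circ> (transpose a y \<circ> transpose a z)
        = transpose a x \<circ> transpose a z"
      by (simp add: fun_eq_iff)
    ultimately show ?thesis using that by (simp add: good_def)
  qed
  have share: "good a b u" if g: "good a b c" "good a u v" and "b \<noteq> u" for a b c u v
  proof -
    consider "c = u" | "b = v" | "c = v" "c \<noteq> u" | "c \<noteq> u" "b \<noteq> v" "c \<noteq> v" by blast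
    thus ?thesis
    proof cases
      case 1 thus ?thesis using g by simp
    next
      case 2 thus ?thesis using inv g by simp
    next
      case 3 thus ?thesis using trans[of a b c u] inv g \<open>b \<noteq> u\<close> by blast
    next
      \<comment> \<open>Now the two cycles share only \<open>a\<close>. Conjugating the first by the
        second replaces \<open>a\<close> by \<open>u\<close>; the two resulting cycles through
        \<open>b\<close> and \<open>c\<close> combine to one on \<open>a, b, u\<close>.\<close>
      case 4
      have "(transpose a v \<circ> transpose a u) \<circ> (transpose a b \<circ> transpose a c) \<circ> (transpose a u \<circ> transpose a v) \<in> K"
        using g inv[OF g(2)] comp by (simp add: good_def)
      hence "good u b c" using conj_by_cycle[of a b c v u] 4 g \<open>b \<noteq> u\<close> by (auto simp: good_def)
      hence "good b c u" by (rule rot)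
      moreover have "good b a c" using inv[OF rot[OF g(1)]] .
      ultimately have "good b a u" using trans[of b a c u] g by (auto simp: good_def)
      thus ?thesis using rot inv by blast
    qed
  qed
  \<comment> \<open>Distinct points are related when a 3-cycle of \<open>K\<close> passes through
    both. This is an equivalence relation, and the count below leaves it a single class.\<close>
  define rel where "rel x y \<longleftrightarrow> x = y \<or> (\<exists>z. good x y z)" for x y
  have rel_sym: "rel y x" if "rel x y" for x y using that rot inv unfolding rel_def by blast
  have rel_trans: "rel x z" if xyz: "rel x y" "rel y z" for x y z
  proof (cases "x = y \<or> y = z \<or> x = z")
    case False
    then obtain u v where "good x y u" "good y z v" using xyz False by (auto simp: rel_def)
    hence "good y x u" using rot inv by blast
    hence "good y x z" using share[OF _ \<open>good y z v\<close>] False by blast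
    thus ?thesis using rot inv unfolding rel_def by blast
  qed (use xyz in \<open>auto simp: rel_def\<close>)
  have few: "card {y \<in> W. \<not> rel x y} \<le> d" if x: "x \<in> W" for x
  proof (rule ccontr)
    assume "\<not> card {y \<in> W. \<not> rel x y} \<le> d"
    then obtain y y' where "y \<in> W" "y' \<in> W" "\<not> rel x y" "\<not> rel x y'" "y \<noteq> y'" "transpose x y \<circ> transpose x y' \<in> K"
      using pigeon[OF x, of "{y \<in> W. \<not> rel x y}"] by auto
    moreover have "x \<noteq> y" "x \<noteq> y'" using calculation by (auto simp: rel_def)
    ultimately have "good x y y'" by (simp add: good_def)
    thus False using \<open>\<not> rel x y\<close> by (auto simp: rel_def)
  qed
  have all: "rel x y" if x: "x \<in> W" and y: "y \<in> W" for x y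
  proof -
    \<comment> \<open>Each point is unrelated to at most \<open>d\<close> others, so two points have
      a common relative as soon as \<open>W\<close> has more than \<open>2 * d\<close>
      elements.\<close>
    have "card ({z \<in> W. \<not> rel x z} \<union> {z \<in> W. \<not> rel y z}) \<le> 2 * d"
      using few[OF x] few[OF y] card_Un_le[of "{z \<in> W. \<not> rel x z}" "{z \<in> W. \<not> rel y z}"] by linarith
    hence "\<not> W \<subseteq> {z \<in> W. \<not> rel x z} \<union> {z \<in> W. \<not> rel y z}"
      using big card_mono[of "{z \<in> W. \<not> rel x z} \<union> {z \<in> W. \<not> rel y z}" W] fin by auto
    then obtain z where "rel x z" "rel y z" by blast
    thus ?thesis using rel_trans rel_sym by blast
  qed
  obtain u v where "good a b u" "good a c v" using all[OF abc(1,2)] all[OF abc(1,3)] abc by (auto simp: rel_def)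
  hence "good a b c" using share abc by blast
  thus ?thesis by (simp add: good_def)
qed

lemma order_three_permutes:
  assumes "p \<circ> p \<circ> p = id" "\<And>w. w \<in> W \<Longrightarrow> p w \<in> W" "\<And>w. w \<notin> W \<Longrightarrow> p w = w"
  shows "p permutes W"
proof (rule bij_imp_permutes)
  have ppp: "p (p (p w)) = w" for w using fun_cong[OF assms(1), of w] by simp
  show "bij_betw p W W"
    by (rule bij_betw_byWitness[of _ "\<lambda>w. p (p w)"]) (use ppp assms(2) in auto)
qed (use assms(3) in auto)

text \<open>Induction on the number of moved points, splitting off one cycle at a time. In the
  application \<open>R\<close> is \<open>same_ends\<close>, so every cycle stays inside one class of
  blocks.\<close>

lemma order_three_is_product_of_cycles:
  fixes W :: "'w set" and K :: "('w \<Rightarrow> 'w) set"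
  assumes fin: "finite W" and id: "id \<in> K" and comp: "\<And>p q. p \<in> K \<Longrightarrow> q \<in> K \<Longrightarrow> p \<circ> q \<in> K"
    and cyc: "\<And>a b c. a \<in> W \<Longrightarrow> b \<in> W \<Longrightarrow> c \<in> W \<Longrightarrow> R a b \<Longrightarrow> R a c \<Longrightarrow> a \<noteq> b \<Longrightarrow> a \<noteq> c \<Longrightarrow> b \<noteq> c \<Longrightarrow>
        transpose a b \<circ> transpose a c \<in> K"
    and R_trans: "\<And>a b c. R a b \<Longrightarrow> R b c \<Longrightarrow> R a c"
    and p: "p permutes W" "p \<circ> p \<circ> p = id" "\<And>w. w \<in> W \<Longrightarrow> R w (p w)"
  shows "p \<in> K"
  using p
proof (induction "card {w. p w \<noteq> w}" arbitrary: p rule: less_induct)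
  case less
  have ppp: "p (p (p w)) = w" for w using fun_cong[OF less.prems(2), of w] by simp
  show ?case
  proof (cases "\<exists>a. p a \<noteq> a")
    case False
    hence "p = id" by auto
    thus ?thesis using id by simp
  next
    case True
    then obtain a where a: "p a \<noteq> a" by blast
    define b where "b = p a"
    define c where "c = p b"
    have pc: "p c = a" unfolding c_def b_def by (rule ppp)
    have d: "a \<noteq> b" "a \<noteq> c" "b \<noteq> c" using a pc unfolding b_def c_def by (metis ppp)+
    have W: "a \<in> W" "b \<in> W" "c \<in> W"
      using less.prems(1) a unfolding b_def c_def by (metis permutes_def permutes_in_image)+
    \<comment> \<open>\<open>q\<close> is \<open>p\<close> with the cycle of \<open>a\<close>
      frozen.\<close>
    define q where "q w = (if w \<in> {a, b, c} then w else p w)" for w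
    have qi: "p w \<notin> {a, b, c}" if "w \<notin> {a, b, c}" for w
    proof
      assume "p w \<in> {a, b, c}"
      hence "p (p (p w)) \<in> p ` p ` {a, b, c}" by blast
      hence "p (p (p w)) \<in> {a, b, c}" by (auto simp: b_def c_def ppp)
      thus False using that ppp by simp
    qed
    have qqq: "q \<circ> q \<circ> q = id" using qi ppp by (auto simp: q_def fun_eq_iff)
    have 1: "q \<in> K"
    proof (rule less.hyps)
      have "{w. q w \<noteq> w} \<subset> {w. p w \<noteq> w}" using a by (auto simp: q_def)
      moreover have "finite {w. p w \<noteq> w}"
        using less.prems(1) fin by (rule_tac finite_subset[of _ W]) (auto simp: permutes_def)
      ultimately show "card {w. q w \<noteq> w} < card {w. p w \<noteq> w}" by (rule psubset_card_mono[rotated])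
      show "q permutes W"
      proof (rule order_three_permutes[OF qqq])
        show "q w \<in> W" if "w \<in> W" for w
          using that less.prems(1) by (auto simp: q_def permutes_in_image)
        show "q w = w" if "w \<notin> W" for w using that less.prems(1) by (auto simp: q_def permutes_def)
      qed
      show "q \<circ> q \<circ> q = id" by (rule qqq)
      show "R w (q w)" if "w \<in> W" for w
      proof (cases "w \<in> {a, b, c}")
        case True
        \<comment> \<open>Going once around the cycle gives reflexivity of \<open>R\<close> at its
          points, which \<open>q\<close> now fixes.\<close>
        hence "R w (p w)" "R (p w) (p (p w))" "R (p (p w)) (p (p (p w)))"
          using that less.prems(1,3) by (auto simp: permutes_in_image)
        hence "R w w" using ppp R_trans by metis
        thus ?thesis using True by (simp add: q_def)
      qed (use less.prems(3) that in \<open>auto simp: q_def\<close>)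
    qed
    have "R a b" "R b c" using less.prems(3) W unfolding b_def c_def by auto
    hence 2: "transpose a c \<circ> transpose a b \<in> K" using cyc[of a c b] W d R_trans by blast
    have "p = q \<circ> (transpose a c \<circ> transpose a b)"
      using d pc by (auto simp: fun_eq_iff q_def Transposition.transpose_def b_def c_def)
    thus ?thesis using comp[OF 1 2] by simp
  qed
qed

section \<open>The stabilized automorphism group of a subshift\<close>

text \<open>As a simp rule this would also rewrite eta-expanded occurrences of \<open>translate k x\<close>.\<close>

declare translate_apply [simp del]

context subshift_space
begin

abbreviation G where "G \<equiv> stabilized_aut_group T shift"

definition s :: "(int \<Rightarrow> 'a) \<Rightarrow> int \<Rightarrow> 'a" where "s = restrict shift X"

lemma hausdorff_T: "Hausdorff_space T"
  unfolding shift_space_def full_shift_def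
  by (intro Hausdorff_space_subtopology) (simp add: Hausdorff_space_product_topology)

text \<open>A continuous bijection of a compact Hausdorff space is a homeomorphism, so continuity of
  the inverse comes for free.\<close>

lemma auts_iff:
  "g \<in> auts T (shift ^^ n) \<longleftrightarrow> g \<in> extensional X \<and> bij_betw g X X \<and>
     (\<forall>x\<in>X. \<forall>i. \<exists>k. \<forall>y\<in>X. (\<forall>j. \<bar>j\<bar> \<le> k \<longrightarrow> y j = x j) \<longrightarrow> g y i = g x i) \<and>
     (\<forall>x\<in>X. g (translate (int n) x) = translate (int n) (g x))"
proof -
  have "homeomorphic_map T T g \<longleftrightarrow> continuous_map T T g" if "bij_betw g X X"
    using that continuous_imp_homeomorphic_map[OF _ compact_T hausdorff_T, of g] homeomorphic_imp_continuous_map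
    by (auto simp: bij_betw_def)
  thus ?thesis
    unfolding auts_def Bij_def topspace_T continuous_T_iff funpow_shift_eq by (auto simp: bij_betw_def)
qed

lemma commute_translate_multiple:
  assumes "\<forall>x\<in>X. g (translate k x) = translate k (g x)" "x \<in> X"
  shows "g (translate (int n * k) x) = translate (int n * k) (g x)"
proof (induction n)
  case (Suc n)
  have "g (translate (int (Suc n) * k) x) = g (translate k (translate (int n * k) x))"
    by (simp add: algebra_simps)
  also have "\<dots> = translate k (translate (int n * k) (g x))"
    using Suc assms by (simp del: translate_translate)
  finally show ?case by (simp add: algebra_simps)
qed simp

lemma group_G: "group G" and carrier_G: "carrier G = (\<Union>n\<in>{1..}. auts T (shift ^^ n))"
  and mult_G: "\<And>a b. a \<in> carrier G \<Longrightarrow> b \<in> carrier G \<Longrightarrow> a \<otimes>\<^bsub>G\<^esub> b = compose X a b"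
  and one_G: "\<one>\<^bsub>G\<^esub> = restrict (\<lambda>x. x) X"
proof -
  show c: "carrier G = (\<Union>n\<in>{1..}. auts T (shift ^^ n))"
    by (simp add: stabilized_aut_group_def stabilized_auts_def)
  have sub: "carrier G \<subseteq> Bij X" unfolding c by (auto simp: auts_def)
  show m: "a \<otimes>\<^bsub>G\<^esub> b = compose X a b" if "a \<in> carrier G" "b \<in> carrier G" for a b
    using that sub by (auto simp: stabilized_aut_group_def BijGroup_def)
  show "\<one>\<^bsub>G\<^esub> = restrict (\<lambda>x. x) X"
    by (simp add: stabilized_aut_group_def BijGroup_def)
  have "subgroup (carrier G) (BijGroup X)"
  proof (rule group.subgroupI[OF group_BijGroup])
    show "carrier G \<subseteq> carrier (BijGroup X)" using sub by (simp add: BijGroup_def)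
    have "restrict (\<lambda>x. x) X \<in> auts T (shift ^^ 1)"
      unfolding auts_iff by (auto simp: bij_betw_def inj_on_def intro!: exI[of _ "\<bar>i\<bar>" for i])
    thus "carrier G \<noteq> {}" unfolding c by blast
  next
    fix a assume "a \<in> carrier G"
    then obtain n where n: "n \<ge> 1" "a \<in> auts T (shift ^^ n)" unfolding c by auto
    have a: "a \<in> Bij X" "bij_betw a X X" "\<forall>x\<in>X. a (translate (int n) x) = translate (int n) (a x)"
      using n auts_iff sub \<open>a \<in> carrier G\<close> by auto
    have inv: "inv\<^bsub>BijGroup X\<^esub> a = restrict (inv_into X a) X" by (rule inv_BijGroup[OF a(1)])
    have "homeomorphic_map T T a" using n(2) by (simp add: auts_def)
    then obtain b where b: "homeomorphic_maps T T a b" unfolding homeomorphic_map_maps by blast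
    have b': "continuous_map T T b" "\<And>x. x \<in> X \<Longrightarrow> b (a x) = x" "\<And>x. x \<in> X \<Longrightarrow> a (b x) = x"
      "\<And>x. x \<in> X \<Longrightarrow> b x \<in> X"
      using b unfolding homeomorphic_maps_def by (auto simp: continuous_map_def)
    have eq: "inv_into X a x = b x" if "x \<in> X" for x
      using a(2) b' that by (intro inv_into_f_eq) (auto simp: bij_betw_def)
    have com: "b (translate (int n) x) = translate (int n) (b x)" if x: "x \<in> X" for x
    proof -
      have "a (translate (int n) (b x)) = translate (int n) x" using a(3) b' x by simp
      thus ?thesis using b'(2)[of "translate (int n) (b x)"] b'(4)[OF x] by simp
    qed
    have "restrict (inv_into X a) X \<in> auts T (shift ^^ n)"
      unfolding auts_iff
    proof (intro conjI)
      show "bij_betw (restrict (inv_into X a) X) X X"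
        using bij_betw_inv_into[OF a(2)] by (simp add: bij_betw_restrict_eq)
      show "\<forall>x\<in>X. \<forall>i. \<exists>k. \<forall>y\<in>X. (\<forall>j. \<bar>j\<bar> \<le> k \<longrightarrow> y j = x j) \<longrightarrow>
        restrict (inv_into X a) X y i = restrict (inv_into X a) X x i"
        using b'(1) unfolding continuous_T_iff by (simp add: eq)
    qed (use com eq in auto)
    thus "inv\<^bsub>BijGroup X\<^esub> a \<in> carrier G" using n(1) unfolding inv c by auto
  next
    fix a b assume ab: "a \<in> carrier G" "b \<in> carrier G"
    then obtain n m where n: "n \<ge> 1" "a \<in> auts T (shift ^^ n)" and m: "m \<ge> 1" "b \<in> auts T (shift ^^ m)"
      unfolding c by auto
    have ca: "continuous_map T T a" "continuous_map T T b"
      using n m by (auto simp: auts_def homeomorphic_imp_continuous_map)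
    have "continuous_map T T (a \<circ> b)" using ca by (metis continuous_map_compose)
    hence cc: "continuous_map T T (compose X a b)"
      by (rule continuous_map_eq) (simp add: compose_def)
    have bb: "bij_betw b X X" "bij_betw a X X" using n m auts_iff by auto
    \<comment> \<open>Maps commuting with the \<open>n\<close>-th and the \<open>m\<close>-th power
      of the shift both commute with the \<open>n * m\<close>-th one; this is why the union over all
      powers is a group.\<close>
    have "compose X a b \<in> auts T (shift ^^ (n * m))"
      unfolding auts_iff
    proof (intro conjI ballI)
      show "bij_betw (compose X a b) X X" using bb bij_betw_compose by blast
      fix x assume x: "x \<in> X"
      have bx: "b x \<in> X" using bb(1) x by (auto simp: bij_betw_def)
      have "b (translate (int n * int m) x) = translate (int n * int m) (b x)"
        using m x auts_iff by (intro commute_translate_multiple) auto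
      moreover have "a (translate (int m * int n) (b x)) = translate (int m * int n) (a (b x))"
        using n bx auts_iff by (intro commute_translate_multiple) auto
      ultimately show "compose X a b (translate (int (n * m)) x) = translate (int (n * m)) (compose X a b x)"
        using x by (simp add: compose_def mult.commute)
    qed (use cc in \<open>auto simp: continuous_T_iff compose_def\<close>)
    thus "a \<otimes>\<^bsub>BijGroup X\<^esub> b \<in> carrier G"
      using ab sub n(1) m(1) unfolding c
      by (auto simp: BijGroup_def)
  qed
  thus "group G"
    using subgroup.subgroup_is_group[OF _ group_BijGroup, of "carrier G" X]
    by (simp add: stabilized_aut_group_def)
qed

sublocale group G by (rule group_G)

lemma mult_apply: "a \<in> carrier G \<Longrightarrow> b \<in> carrier G \<Longrightarrow> x \<in> X \<Longrightarrow> (a \<otimes>\<^bsub>G\<^esub> b) x = a (b x)"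
  by (simp add: mult_G compose_def)

lemma one_apply: "x \<in> X \<Longrightarrow> \<one>\<^bsub>G\<^esub> x = x"
  by (simp add: one_G)

lemma carrier_bij: "a \<in> carrier G \<Longrightarrow> bij_betw a X X"
  by (auto simp: carrier_G auts_iff)

lemma carrier_in: "a \<in> carrier G \<Longrightarrow> x \<in> X \<Longrightarrow> a x \<in> X"
  using carrier_bij bij_betwE by blast

lemma carrier_continuous:
  assumes "a \<in> carrier G" "x \<in> X"
  obtains k where "\<And>y. y \<in> X \<Longrightarrow> (\<And>j. \<bar>j\<bar> \<le> k \<Longrightarrow> y j = x j) \<Longrightarrow> a y i = a x i"
proof -
  obtain n where "a \<in> auts T (shift ^^ n)" using assms(1) unfolding carrier_G by blast
  thus ?thesis using assms(2) that unfolding auts_iff by meson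
qed

lemma carrier_eqI:
  assumes "a \<in> carrier G" "b \<in> carrier G" "\<And>x. x \<in> X \<Longrightarrow> a x = b x"
  shows "a = b"
  using assms by (auto simp: carrier_G auts_iff intro: extensionalityI)

lemma carrierI:
  assumes "n \<ge> 1" "bij_betw f X X" "\<And>x. x \<in> X \<Longrightarrow> f (translate (int n) x) = translate (int n) (f x)"
    "\<And>x i. x \<in> X \<Longrightarrow> \<exists>k. \<forall>y\<in>X. (\<forall>j. \<bar>j\<bar> \<le> k \<longrightarrow> y j = x j) \<longrightarrow> f y i = f x i"
  shows "restrict f X \<in> carrier G"
proof -
  have "restrict f X \<in> auts T (shift ^^ n)"
    unfolding auts_iff using assms by simp
  thus ?thesis using assms(1) unfolding carrier_G by auto
qed

lemma carrier_commute:
  assumes "a \<in> carrier G"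
  obtains n where "n \<ge> 1" "\<And>x. x \<in> X \<Longrightarrow> a (translate (int n) x) = translate (int n) (a x)"
proof -
  obtain n where "n \<ge> 1" "a \<in> auts T (shift ^^ n)" using assms(1) unfolding carrier_G by auto
  thus ?thesis using that unfolding auts_iff by meson
qed

lemma s_carrier: "s \<in> carrier G" and s_apply: "x \<in> X \<Longrightarrow> s x = translate 1 x"
proof -
  have e: "shift = translate 1" by (auto simp: shift_def translate_def)
  show "x \<in> X \<Longrightarrow> s x = translate 1 x" by (simp add: s_def e)
  have "restrict (translate 1) X \<in> carrier G"
  proof (rule carrierI[of 1])
    show "bij_betw (translate 1) X X"
      by (rule bij_betw_byWitness[of _ "translate (-1)"]) auto
    show "\<exists>k. \<forall>y\<in>X. (\<forall>j. \<bar>j\<bar> \<le> k \<longrightarrow> y j = x j) \<longrightarrow> translate 1 y i = translate 1 x i" for x i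
      by (rule exI[of _ "\<bar>i + 1\<bar>"]) (auto simp: translate_apply)
  qed auto
  thus "s \<in> carrier G" by (simp add: s_def e[symmetric])
qed

lemma pow_s_apply: "x \<in> X \<Longrightarrow> (s [^]\<^bsub>G\<^esub> n) x = translate (int n) x"
proof (induction n arbitrary: x)
  case 0 thus ?case by (simp add: one_apply)
next
  case (Suc n)
  have "(s [^]\<^bsub>G\<^esub> Suc n) x = (s [^]\<^bsub>G\<^esub> n) (s x)"
    using s_carrier Suc.prems by (simp add: mult_apply)
  thus ?case using Suc by (simp add: s_apply add.commute)
qed

text \<open>For \<open>n \<ge> 1\<close> this is the automorphism group of the \<open>n\<close>-th
  power of the shift, so the finite levels are visible in the abstract group once the powers of
  \<open>s\<close> are known.\<close>

lemma centralizer_of_pow_s_iff: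
  "c \<in> centralizer_of G (s [^]\<^bsub>G\<^esub> n) \<longleftrightarrow>
    c \<in> carrier G \<and> (\<forall>x\<in>X. c (translate (int n) x) = translate (int n) (c x))"
proof (cases "c \<in> carrier G")
  case True
  have sn: "s [^]\<^bsub>G\<^esub> n \<in> carrier G" using s_carrier by simp
  have "c \<otimes>\<^bsub>G\<^esub> s [^]\<^bsub>G\<^esub> n = s [^]\<^bsub>G\<^esub> n \<otimes>\<^bsub>G\<^esub> c \<longleftrightarrow>
      (\<forall>x\<in>X. (c \<otimes>\<^bsub>G\<^esub> s [^]\<^bsub>G\<^esub> n) x = (s [^]\<^bsub>G\<^esub> n \<otimes>\<^bsub>G\<^esub> c) x)"
    using True sn by (auto intro!: carrier_eqI)
  also have "\<dots> \<longleftrightarrow> (\<forall>x\<in>X. c (translate (int n) x) = translate (int n) (c x))"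
    using True sn by (simp add: mult_apply pow_s_apply carrier_in)
  finally show ?thesis using True by (simp add: centralizer_of_def)
qed (simp add: centralizer_of_def)

end

section \<open>Mixing shifts of finite type\<close>

text \<open>The working form of the hypotheses. Mixing gives a gap for each pair of words; one gap
  \<open>M\<close> serves for all points because, by the local rule, only the finitely many words of
  length \<open>N\<close> matter.\<close>

locale mixing_sft = subshift_space +
  fixes N M :: nat
  assumes N_pos: "1 \<le> N"
    and local_rule: "\<And>x. (\<And>i. \<exists>y\<in>X. \<forall>j. 0 \<le> j \<and> j < int N \<longrightarrow> x (i + j) = y (i + j)) \<Longrightarrow> x \<in> X"
    and gluing: "\<And>x y i. x \<in> X \<Longrightarrow> y \<in> X \<Longrightarrow>
      \<exists>z\<in>X. (\<forall>j<i. z j = x j) \<and> (\<forall>j\<ge>i + int M. z j = y j)"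
    and two_letters: "\<exists>x\<in>X. \<exists>y\<in>X. x 0 \<noteq> y 0"

text \<open>A window of \<open>N\<close> letters starting at or before \<open>i\<close> lies in the
  part taken from \<open>x\<close>; one starting later sees only letters of \<open>y\<close>,
  because the points agree on the overlap. It is stated outside the locale since it serves to
  establish gluing.\<close>

lemma overlap_in:
  assumes local_rule: "\<And>x. (\<And>i. \<exists>y\<in>X. \<forall>j. 0 \<le> j \<and> j < int N \<longrightarrow> x (i + j) = y (i + j)) \<Longrightarrow> x \<in> X"
    and x: "x \<in> X" and y: "y \<in> X" and eq: "\<And>j. i \<le> j \<Longrightarrow> j < i + int N \<Longrightarrow> x j = y j"
  shows "(\<lambda>j. if j < i + int N then x j else y j) \<in> X"
proof (rule local_rule)
  fix k
  show "\<exists>z\<in>X. \<forall>j. 0 \<le> j \<and> j < int N \<longrightarrow> (if k + j < i + int N then x (k + j) else y (k + j)) = z (k + j)"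
  proof (cases "k \<le> i")
    case True thus ?thesis using x by (intro bexI[of _ x]) auto
  next
    case False thus ?thesis using y eq by (intro bexI[of _ y]) auto
  qed
qed

lemma mixing_sft_exists:
  assumes sft: "shift_of_finite_type A X" and mix: "mixing X" and nt: "\<not> trivial_shift X"
  shows "\<exists>N M. mixing_sft A X N M"
proof -
  interpret subshift_space A X
    using sft by (simp add: shift_of_finite_type_def subshift_space_def)
  obtain F where F: "finite F" "X = {x. range x \<subseteq> A \<and> (\<forall>w\<in>F. \<not> occurs w x)}"
    using sft unfolding shift_of_finite_type_def by blast
  \<comment> \<open>The 1 keeps \<open>N\<close> positive even when no word is forbidden.\<close>
  define N where "N = Max (insert 1 (length ` F))"
  have N1: "1 \<le> N" and NF: "\<And>w. w \<in> F \<Longrightarrow> length w \<le> N"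
    unfolding N_def using F(1) by (auto intro: Max_ge)
  have local_rule: "x \<in> X"
    if *: "\<And>i. \<exists>y\<in>X. \<forall>j. 0 \<le> j \<and> j < int N \<longrightarrow> x (i + j) = y (i + j)" for x
  proof -
    have "x i \<in> A" for i
    proof -
      obtain y where "y \<in> X" and y: "\<forall>j. 0 \<le> j \<and> j < int N \<longrightarrow> x (i + j) = y (i + j)" using * by blast
      have "x i = y i" using y[rule_format, of 0] N1 by simp
      thus ?thesis using X_letter[OF \<open>y \<in> X\<close>] by simp
    qed
    moreover have "\<not> occurs w x" if w: "w \<in> F" for w
    proof
      assume "occurs w x"
      then obtain i where i: "\<forall>k<length w. x (i + int k) = w ! k" by (auto simp: occurs_def)
      obtain y where y: "y \<in> X" "\<forall>j. 0 \<le> j \<and> j < int N \<longrightarrow> x (i + j) = y (i + j)" using * by blast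
      have "y (i + int k) = w ! k" if "k < length w" for k
        using i y(2)[rule_format, of "int k"] NF[OF w] that by auto
      hence "occurs w y" by (auto simp: occurs_def)
      thus False using y(1) w unfolding F(2) by blast
    qed
    ultimately show ?thesis unfolding F(2) by auto
  qed
  have overlap: "(\<lambda>j. if j < i + int N then x j else y j) \<in> X"
    if "x \<in> X" "y \<in> X" "\<And>j. i \<le> j \<Longrightarrow> j < i + int N \<Longrightarrow> x j = y j" for x y i
    by (rule overlap_in[OF _ that]) (fact local_rule)
  define word where "word x i = map (\<lambda>k. x (i + int k)) [0..<N]" for x :: "int \<Rightarrow> 'a" and i
  define L where "L = {word x i | x i. x \<in> X}"
  have "L \<subseteq> {w. set w \<subseteq> A \<and> length w = N}" using X_letter by (auto simp: L_def word_def)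
  hence fin: "finite L" using finite_lists_length_eq[OF finite_A] finite_subset by blast
  have lang: "L \<subseteq> language X" unfolding L_def language_def occurs_def word_def by auto blast
  have "\<forall>u\<in>L. \<forall>v\<in>L. \<exists>M. \<forall>m\<ge>M. \<exists>w. length w = m \<and> u @ w @ v \<in> language X"
    using mix lang unfolding mixing_def by blast
  then obtain g where g: "\<And>u v m. u \<in> L \<Longrightarrow> v \<in> L \<Longrightarrow> m \<ge> g u v \<Longrightarrow>
      \<exists>w. length w = m \<and> u @ w @ v \<in> language X" by metis
  \<comment> \<open>Finitely many pairs of words have a common bound on their gaps. Mixing gives
    connecting words of every length from there on, hence one of length exactly \<open>M\<close> for
    each pair.\<close>
  define M where "M = Max (insert 0 ((\<lambda>(u, v). g u v) ` (L \<times> L)))"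
  have M: "g u v \<le> M" if "u \<in> L" "v \<in> L" for u v
    unfolding M_def using fin that by (intro Max_ge) auto
  have gluing: "\<exists>z\<in>X. (\<forall>j<i. z j = x j) \<and> (\<forall>j\<ge>i + int M. z j = y j)"
    if x: "x \<in> X" and y: "y \<in> X" for x y i
  proof -
    have "word x (i - int N) \<in> L" "word y (i + int M) \<in> L" using x y by (auto simp: L_def)
    then obtain w where w: "length w = M" "word x (i - int N) @ w @ word y (i + int M) \<in> language X"
      using g M by meson
    define W where "W = word x (i - int N) @ w @ word y (i + int M)"
    obtain q k where q: "q \<in> X" "\<And>t. t < length W \<Longrightarrow> q (k + int t) = W ! t"
      using w(2) unfolding W_def[symmetric] language_def occurs_def by (elim CollectE bexE exE) blast
    have lenW: "length W = 2 * N + M" using w(1) by (simp add: W_def word_def)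
    \<comment> \<open>\<open>r\<close> shows the connecting word with its gap starting at
      \<open>i\<close>; it is spliced to \<open>x\<close> on the left and to \<open>y\<close> on the
      right.\<close>
    define r where "r = translate (k - (i - int N)) q"
    have r: "r \<in> X" using q(1) by (simp add: r_def)
    have r1: "r j = x j" if "i - int N \<le> j" "j < i" for j
    proof -
      define t where "t = nat (j - (i - int N))"
      have t: "t < N" "j = i - int N + int t" using that by (auto simp: t_def)
      have "r j = q (k + int t)" by (simp add: r_def t(2) translate_apply algebra_simps)
      also have "\<dots> = W ! t" using q(2) t lenW by simp
      also have "\<dots> = x j" using t by (simp add: W_def word_def nth_append)
      finally show ?thesis .
    qed
    have r2: "r j = y j" if "i + int M \<le> j" "j < i + int M + int N" for j
    proof -
      define t where "t = nat (j - (i + int M))"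
      have t: "t < N" "j = i + int M + int t" using that by (auto simp: t_def)
      have "r j = q (k + int (N + M + t))" by (simp add: r_def t(2) translate_apply algebra_simps)
      also have "\<dots> = W ! (N + M + t)" by (rule q(2)) (use t lenW in simp)
      also have "\<dots> = y j" using t w(1) by (simp add: W_def word_def nth_append)
      finally show ?thesis .
    qed
    define z where "z = (\<lambda>j. if j < i - int N + int N then x j else r j)"
    have z: "z \<in> X" unfolding z_def using overlap[OF x r, of "i - int N"] r1 by simp
    have z2: "z j = y j" if "i + int M \<le> j" "j < i + int M + int N" for j
      using r2 that by (simp add: z_def)
    have "(\<lambda>j. if j < i + int M + int N then z j else y j) \<in> X" using overlap[OF z y z2] .
    moreover have "(if j < i + int M + int N then z j else y j) = x j" if "j < i" for j using that by (simp add: z_def)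
    moreover have "(if j < i + int M + int N then z j else y j) = y j" if "j \<ge> i + int M" for j using z2 that by simp
    ultimately show ?thesis by (intro bexI[of _ "\<lambda>j. if j < i + int M + int N then z j else y j"]) auto
  qed
  have "\<exists>x\<in>X. \<exists>y\<in>X. x 0 \<noteq> y 0"
  proof (rule ccontr)
    \<comment> \<open>If all points had the same letter at 0, shift invariance would leave a single
      point, fixed by the shift.\<close>
    assume "\<not> ?thesis"
    hence e0: "x 0 = y 0" if "x \<in> X" "y \<in> X" for x y using that by blast
    have e: "x = y" if "x \<in> X" "y \<in> X" for x y
    proof
      fix i show "x i = y i" using e0[of "translate i x" "translate i y"] that by (simp add: translate_apply)
    qed
    obtain x where x: "x \<in> X" using ne by blast
    hence X: "X = {x}" using e by blast
    have "(\<lambda>i. x (i + n)) = x" for n using e[OF translate_in[OF x, of n] x] by (simp add: translate_def)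
    hence "X = orbit x" unfolding X orbit_def by auto
    moreover have "finite X" unfolding X by simp
    ultimately show False using nt unfolding trivial_shift_def by blast
  qed
  hence "mixing_sft A X N M"
    using N1 local_rule gluing by unfold_locales blast+
  thus ?thesis by blast
qed

context mixing_sft
begin

text \<open>After a gap of \<open>M\<close> letters, either of two letters can follow any word. This
  yields both positive entropy and arbitrarily large classes of blocks.\<close>

lemma word_count_double: "2 * word_count X n \<le> word_count X (n + M + 1)"
proof -
  obtain u v where u: "u \<in> X" and v: "v \<in> X" and uv: "u 0 \<noteq> v 0" using two_letters by blast
  let ?R = "\<lambda>n. (\<lambda>x. restrict x {0..<int n}) ` X"
  define e where "e b = (if b then u else v)" for b
  have ex: "\<exists>z. z \<in> X \<and> restrict z {0..<int n} = w \<and> z (int n + int M) = e b 0" if w: "w \<in> ?R n" for w b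
  proof -
    obtain x where x: "x \<in> X" "w = restrict x {0..<int n}" using w by blast
    have "translate (- (int n + int M)) (e b) \<in> X" using u v by (simp add: e_def)
    from gluing[OF x(1) this, of "int n"] obtain z where z: "z \<in> X" "\<And>j. j < int n \<Longrightarrow> z j = x j"
      "\<And>j. j \<ge> int n + int M \<Longrightarrow> z j = translate (- (int n + int M)) (e b) j" by blast
    thus ?thesis using x(2) by (intro exI[of _ z]) (auto simp: translate_apply)
  qed
  define z where "z w b = (SOME z. z \<in> X \<and> restrict z {0..<int n} = w \<and> z (int n + int M) = e b 0)" for w b
  have z: "z w b \<in> X \<and> restrict (z w b) {0..<int n} = w \<and> z w b (int n + int M) = e b 0" if "w \<in> ?R n" for w b
    unfolding z_def by (rule someI_ex[OF ex[OF that]])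
  let ?f = "\<lambda>(w, b). restrict (z w b) {0..<int (n + M + 1)}"
  have "card (?R n \<times> (UNIV :: bool set)) \<le> card (?R (n + M + 1))"
  proof (rule card_inj_on_le)
    show "?f ` (?R n \<times> UNIV) \<subseteq> ?R (n + M + 1)" using z by auto
    show "inj_on ?f (?R n \<times> UNIV)"
    proof (rule inj_onI, clarify)
      fix x y b b' assume xy: "x \<in> X" "y \<in> X"
        and eq: "restrict (z (restrict x {0..<int n}) b) {0..<int (n + M + 1)}
          = restrict (z (restrict y {0..<int n}) b') {0..<int (n + M + 1)}"
      let ?v = "restrict x {0..<int n}" and ?w = "restrict y {0..<int n}"
      have e: "z ?v b i = z ?w b' i" if "0 \<le> i" "i < int (n + M + 1)" for i
        using fun_cong[OF eq, of i] that by simp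
      have zv: "restrict (z ?v b) {0..<int n} = ?v" "z ?v b (int n + int M) = e b 0"
        and zw: "restrict (z ?w b') {0..<int n} = ?w" "z ?w b' (int n + int M) = e b' 0"
        using z[of ?v b] z[of ?w b'] xy by blast+
      have "restrict (z ?v b) {0..<int n} = restrict (z ?w b') {0..<int n}"
        by (rule restrict_ext) (use e in auto)
      hence "?v = ?w" using zv zw by simp
      moreover have "e b 0 = e b' 0" using e[of "int n + int M"] zv(2) zw(2) by simp
      hence "b = b'" using uv by (auto simp: e_def split: if_splits)
      ultimately show "?v = ?w \<and> b = b'" by blast
    qed
    show "finite (?R (n + M + 1))" by (rule finite_windows)
  qed
  thus ?thesis by (simp add: word_count_def card_cartesian_product)
qed

lemma word_count_exponential: "2 ^ k \<le> word_count X (k * (M + 1))"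
proof (induction k)
  case 0 show ?case using word_count_pos by simp
next
  case (Suc k)
  thus ?case using word_count_double[of "k * (M + 1)"] by (simp add: algebra_simps)
qed

lemma entropy_pos:
  assumes "(\<lambda>n. ln (real (word_count X n)) / real n) \<longlonglongrightarrow> h"
  shows "0 < h"
proof -
  have "strict_mono (\<lambda>k. k * (M + 1))" by (intro strict_monoI mult_strict_right_mono) auto
  hence "(\<lambda>k. ln (real (word_count X (k * (M + 1)))) / real (k * (M + 1))) \<longlonglongrightarrow> h"
    using LIMSEQ_subseq_LIMSEQ[OF assms, of "\<lambda>k. k * (M + 1)"] unfolding o_def by simp
  moreover have "\<exists>n. \<forall>k\<ge>n. ln 2 / real (M + 1) \<le> ln (real (word_count X (k * (M + 1)))) / real (k * (M + 1))"
  proof (intro exI[of _ 1] allI impI)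
    fix k :: nat assume k: "1 \<le> k"
    have "real (2 ^ k) \<le> real (word_count X (k * (M + 1)))"
      using word_count_exponential[of k] by (rule of_nat_mono)
    hence "ln (real (2 ^ k)) \<le> ln (real (word_count X (k * (M + 1))))"
      by (subst ln_le_cancel_iff) (use word_count_pos[of "k * (M + 1)"] in auto)
    hence "real k * ln 2 \<le> ln (real (word_count X (k * (M + 1))))" by (simp add: ln_realpow)
    hence "real k * ln 2 / real (k * (M + 1)) \<le> ln (real (word_count X (k * (M + 1)))) / real (k * (M + 1))"
      by (rule divide_right_mono) simp
    thus "ln 2 / real (M + 1) \<le> ln (real (word_count X (k * (M + 1)))) / real (k * (M + 1))"
      using k by (simp only: of_nat_mult) simp
  qed
  ultimately have "ln 2 / real (M + 1) \<le> h" by (rule LIMSEQ_le_const)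
  moreover have "0 < ln 2 / real (M + 1)" by simp
  ultimately show ?thesis by linarith
qed

subsection \<open>Periodic points\<close>

text \<open>A stretch of \<open>z\<close> whose first \<open>N\<close> letters recur after
  \<open>n\<close> steps can be repeated forever: every window of \<open>N\<close> letters of the
  result already occurs in \<open>z\<close>.\<close>

lemma periodic_point:
  assumes z: "z \<in> X" and n: "N \<le> n" and per: "\<And>i. a \<le> i \<Longrightarrow> i < a + int N \<Longrightarrow> z (i + int n) = z i"
  obtains y where "y \<in> X" "translate (int n) y = y" "\<And>i. a \<le> i \<Longrightarrow> i < a + int n + int N \<Longrightarrow> y i = z i"
proof -
  have n0: "0 < int n" using n N_pos by simp
  define y where "y i = z (a + (i - a) mod int n)" for i
  have eq: "y i = z i" if "a \<le> i" "i < a + int n + int N" for i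
  proof (cases "i < a + int n")
    case True thus ?thesis using that by (simp add: y_def)
  next
    case False
    define t where "t = i - a - int n"
    have t: "0 \<le> t" "t < int N" "i - a = t + int n" using False that by (auto simp: t_def)
    have "(i - a) mod int n = t" using t n by simp
    hence "y i = z (a + t)" by (simp add: y_def)
    moreover have "a + t + int n = i" by (simp add: t_def)
    ultimately show ?thesis using per[of "a + t"] t(1,2) by simp
  qed
  have per_y: "y (i + k * int n) = y i" for i k
  proof -
    have "(i + k * int n - a) mod int n = (i - a + k * int n) mod int n" by (simp add: algebra_simps)
    thus ?thesis by (simp add: y_def)
  qed
  have "y \<in> X"
  proof (rule local_rule)
    fix i
    \<comment> \<open>The window at \<open>i\<close> is moved into the period starting at
      \<open>a\<close>; beyond the end of that period \<open>y\<close> agrees with \<open>z\<close>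
      for \<open>N\<close> more letters.\<close>
    define q where "q = (i - a) div int n"
    have q: "a \<le> i - q * int n" "i - q * int n < a + int n"
    proof -
      have "i - q * int n - a = (i - a) mod int n" by (simp add: q_def minus_div_mult_eq_mod[symmetric])
      moreover have "0 \<le> (i - a) mod int n" "(i - a) mod int n < int n" using n0 by auto
      ultimately show "a \<le> i - q * int n" "i - q * int n < a + int n" by linarith+
    qed
    have "y (i + j) = translate (- (q * int n)) z (i + j)" if "0 \<le> j" "j < int N" for j
    proof -
      have "y (i + j) = y (i + j - q * int n)" using per_y[of "i + j - q * int n" q] by simp
      also have "\<dots> = z (i + j - q * int n)" using q that by (intro eq) auto
      finally show ?thesis by (simp add: translate_apply)
    qed
    thus "\<exists>x\<in>X. \<forall>j. 0 \<le> j \<and> j < int N \<longrightarrow> y (i + j) = x (i + j)"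
      using translate_in[OF z] by blast
  qed
  moreover have "translate (int n) y = y" using per_y[of _ 1] by (auto simp: translate_def)
  ultimately show ?thesis using eq that by blast
qed

lemma periodic_approximation:
  assumes x: "x \<in> X" and n: "int (2 * k + 2 * N + M + 1) \<le> int n"
  obtains y where "y \<in> X" "translate (int n) y = y" "\<And>i. \<bar>i\<bar> \<le> int k \<Longrightarrow> y i = x i"
proof -
  \<comment> \<open>\<open>x\<close> is followed, after a gap, by its own translate by
    \<open>n\<close>. The letters on \<open>[-k - N, -k)\<close> recur \<open>n\<close> places later
    once the second copy has begun there, whence the bound on \<open>n\<close>.\<close>
  from gluing[OF x translate_in[OF x, of "- int n"], of "int k + 1"]
  obtain z where z: "z \<in> X" "\<And>j. j < int k + 1 \<Longrightarrow> z j = x j"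
    "\<And>j. j \<ge> int k + 1 + int M \<Longrightarrow> z j = translate (- int n) x j" by blast
  have "z (i + int n) = z i" if "- int k - int N \<le> i" "i < - int k - int N + int N" for i
    using z(2)[of i] z(3)[of "i + int n"] that n by (simp add: translate_apply)
  then obtain y where y: "y \<in> X" "translate (int n) y = y"
    "\<And>i. - int k - int N \<le> i \<Longrightarrow> i < - int k - int N + int n + int N \<Longrightarrow> y i = z i"
    using periodic_point[OF z(1), of n "- int k - int N"] n by auto
  have "y i = x i" if "\<bar>i\<bar> \<le> int k" for i
    using y(3)[of i] z(2)[of i] that n by auto
  thus ?thesis using y that by blast
qed

section \<open>Stabilizers of periodic points as separating subgroups\<close>

lemma inv_apply:
  assumes "c \<in> carrier G" "z \<in> X"
  shows "(inv\<^bsub>G\<^esub> c) (c z) = z" "c ((inv\<^bsub>G\<^esub> c) z) = z"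
proof -
  show "(inv\<^bsub>G\<^esub> c) (c z) = z"
    using mult_apply[of "inv\<^bsub>G\<^esub> c" c z] assms by (simp add: one_apply)
  show "c ((inv\<^bsub>G\<^esub> c) z) = z"
    using mult_apply[of c "inv\<^bsub>G\<^esub> c" z] assms by (simp add: one_apply)
qed

lemma separable_upper:
  assumes h: "h \<in> carrier G" "h \<noteq> \<one>\<^bsub>G\<^esub>"
  obtains n0 where "\<And>n. n \<ge> n0 \<Longrightarrow> separable_by_index G (centralizer_of G (s [^]\<^bsub>G\<^esub> n)) h (word_count X n)"
proof -
  obtain x where x': "x \<in> X" "h x \<noteq> \<one>\<^bsub>G\<^esub> x"
    using carrier_eqI[OF h(1) one_closed] h(2) by blast
  then obtain i where x: "x \<in> X" "h x i \<noteq> x i" by (auto simp: one_apply fun_eq_iff)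
  obtain k0 where k0: "\<And>y. y \<in> X \<Longrightarrow> (\<And>j. \<bar>j\<bar> \<le> k0 \<Longrightarrow> y j = x j) \<Longrightarrow> h y i = h x i"
    using carrier_continuous[OF h(1) x(1), where i = i] by blast
  \<comment> \<open>The coordinate \<open>i\<close> is included so that \<open>y i = x i\<close>;
    then \<open>h y i = h x i\<close> differs from \<open>y i\<close>.\<close>
  define k where "k = nat (max k0 \<bar>i\<bar>)"
  have k: "k0 \<le> int k" "\<bar>i\<bar> \<le> int k" by (auto simp: k_def)
  have "separable_by_index G (centralizer_of G (s [^]\<^bsub>G\<^esub> n)) h (word_count X n)"
    if n: "n \<ge> 2 * k + 2 * N + M + 1" for n
  proof -
    obtain y where y: "y \<in> X" "translate (int n) y = y" "\<And>i. \<bar>i\<bar> \<le> int k \<Longrightarrow> y i = x i"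
      using periodic_approximation[OF x(1), of k n] n by auto
    have "h y i = h x i" by (rule k0) (use y k in auto)
    hence hy: "h y \<noteq> y" using x(2) y(3)[OF k(2)] by auto
    let ?H = "{c \<in> carrier G. c y = y}"
    let ?F = "{z \<in> X. translate (int n) z = z}"
    have "subgroup ?H G"
    proof (rule subgroupI)
      have "\<one>\<^bsub>G\<^esub> \<in> ?H" using y(1) by (simp add: one_apply)
      thus "?H \<noteq> {}" by blast
      fix a assume a: "a \<in> ?H"
      have "(inv\<^bsub>G\<^esub> a) y = y" using inv_apply(1)[of a y] a y(1) by auto
      thus "inv\<^bsub>G\<^esub> a \<in> ?H" using a by simp
    qed (auto simp: mult_apply y(1))
    moreover have "\<exists>a\<in>S. \<exists>b\<in>S. a \<noteq> b \<and> a \<otimes>\<^bsub>G\<^esub> inv\<^bsub>G\<^esub> b \<in> ?H"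
      if S: "S \<subseteq> centralizer_of G (s [^]\<^bsub>G\<^esub> n)" "finite S" "word_count X n < card S" for S
    proof -
      have Sc: "c \<in> carrier G" "\<And>x. x \<in> X \<Longrightarrow> c (translate (int n) x) = translate (int n) (c x)"
        if "c \<in> S" for c using S(1) that centralizer_of_pow_s_iff by blast+
      \<comment> \<open>Inverse images of \<open>y\<close> are compared, because their equality for
        \<open>a\<close> and \<open>b\<close> is what makes \<open>a \<otimes> inv b\<close> fix
        \<open>y\<close>.\<close>
      have im: "(\<lambda>c. (inv\<^bsub>G\<^esub> c) y) ` S \<subseteq> ?F"
      proof clarify
        fix c assume c: "c \<in> S"
        let ?u = "(inv\<^bsub>G\<^esub> c) y"
        have u: "?u \<in> X" using Sc(1)[OF c] y(1) by (simp add: carrier_in)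
        have "c (translate (int n) ?u) = y"
          using Sc(2)[OF c u] inv_apply(2)[OF Sc(1)[OF c] y(1)] y(2) by simp
        thus "?u \<in> X \<and> translate (int n) ?u = ?u"
          using inv_apply(1)[OF Sc(1)[OF c], of "translate (int n) ?u"] u by simp
      qed
      have n0: "0 < int n" using n by simp
      \<comment> \<open>One period determines a periodic point, so there are at most
        \<open>word_count X n\<close> of them.\<close>
      have inj: "inj_on (\<lambda>x. restrict x {0..<int n}) ?F"
      proof (rule inj_onI)
        fix u v assume u: "u \<in> ?F" and v: "v \<in> ?F" and eq: "restrict u {0..<int n} = restrict v {0..<int n}"
        have per: "w t = w (t mod int n)" if w: "w \<in> ?F" for w t
        proof -
          have 1: "w (t + int n) = w t" for t using w by (metis (mono_tags, lifting) mem_Collect_eq translate_apply)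
          have 2: "w (t + int k * int n) = w t" for t k
          proof (induction k)
            case (Suc k) thus ?case using 1[of "t + int k * int n"] by (simp add: algebra_simps)
          qed simp
          have 3: "w (t + q * int n) = w t" for t q
          proof (cases "0 \<le> q")
            case True thus ?thesis using 2[of t "nat q"] by simp
          next
            case False thus ?thesis using 2[of "t + q * int n" "nat (- q)"] by simp
          qed
          show ?thesis using 3[of t "- (t div int n)"] by (simp add: minus_div_mult_eq_mod)
        qed
        show "u = v"
        proof
          fix t
          have "u (t mod int n) = v (t mod int n)" using fun_cong[OF eq, of "t mod int n"] n0 by simp
          thus "u t = v t" using per[OF u, of t] per[OF v, of t] by simp
        qed
      qed
      have finF: "finite ?F"
        by (rule inj_on_finite[OF inj, of "(\<lambda>x. restrict x {0..<int n}) ` X"]) (use finite_windows in auto)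
      have "card ?F \<le> word_count X n"
        unfolding word_count_def by (rule card_inj_on_le[OF inj]) (use finite_windows in auto)
      hence "card ((\<lambda>c. (inv\<^bsub>G\<^esub> c) y) ` S) < card S" using card_mono[OF finF im] S(3) by linarith
      hence "\<not> inj_on (\<lambda>c. (inv\<^bsub>G\<^esub> c) y) S" by (rule pigeonhole)
      then obtain a b where ab: "a \<in> S" "b \<in> S" "a \<noteq> b" "(inv\<^bsub>G\<^esub> a) y = (inv\<^bsub>G\<^esub> b) y"
        by (auto simp: inj_on_def)
      have "(a \<otimes>\<^bsub>G\<^esub> inv\<^bsub>G\<^esub> b) y = y"
        using ab Sc(1) y(1) inv_apply(2)[of a y] by (simp add: mult_apply)
      thus ?thesis using ab Sc(1) by auto
    qed
    ultimately show ?thesis using hy unfolding separable_by_index_def by (intro exI[of _ ?H]) auto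
  qed
  thus ?thesis using that by blast
qed

subsection \<open>Block permutations\<close>

text \<open>
  At level \<open>n\<close> a point is cut into the windows \<open>[jn, jn + n + N)\<close>. Consecutive windows share \<open>N\<close>
  letters, so a permutation of the windows that keeps the first and the last \<open>N\<close> letters can be
  applied in all windows at once, and the result is again a point of the shift.
\<close>

definition win :: "nat \<Rightarrow> int \<Rightarrow> (int \<Rightarrow> 'a) \<Rightarrow> int \<Rightarrow> 'a" where
  "win n j x = restrict (translate (j * int n) x) {0..<int n + int N}"

definition blocks :: "nat \<Rightarrow> (int \<Rightarrow> 'a) set" where
  "blocks n = win n 0 ` X"

definition same_ends :: "nat \<Rightarrow> (int \<Rightarrow> 'a) \<Rightarrow> (int \<Rightarrow> 'a) \<Rightarrow> bool" where
  "same_ends n v w \<longleftrightarrow>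
    (\<forall>t. 0 \<le> t \<and> t < int N \<longrightarrow> v t = w t \<and> v (int n + t) = w (int n + t))"

definition block_perms :: "nat \<Rightarrow> ((int \<Rightarrow> 'a) \<Rightarrow> int \<Rightarrow> 'a) set" where
  "block_perms n = {p. p permutes blocks n \<and> (\<forall>w\<in>blocks n. same_ends n w (p w))}"

text \<open>The last \<open>N\<close> positions of a window also belong to the next window; each
  coordinate is read in the window where it is among the first \<open>n\<close>.\<close>

definition act :: "nat \<Rightarrow> ((int \<Rightarrow> 'a) \<Rightarrow> int \<Rightarrow> 'a) \<Rightarrow> (int \<Rightarrow> 'a) \<Rightarrow> int \<Rightarrow> 'a" where
  "act n p x = (\<lambda>i. p (win n (i div int n) x) (i mod int n))"

definition block_aut :: "nat \<Rightarrow> ((int \<Rightarrow> 'a) \<Rightarrow> int \<Rightarrow> 'a) \<Rightarrow> (int \<Rightarrow> 'a) \<Rightarrow> int \<Rightarrow> 'a" where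
  "block_aut n p = restrict (act n p) X"

lemma same_ends_refl: "same_ends n v v"
  and same_ends_sym: "same_ends n v w \<Longrightarrow> same_ends n w v"
  and same_ends_trans: "same_ends n u v \<Longrightarrow> same_ends n v w \<Longrightarrow> same_ends n u w"
  by (auto simp: same_ends_def)

lemma win_apply: "0 \<le> t \<Longrightarrow> t < int n + int N \<Longrightarrow> win n j x t = x (j * int n + t)"
  by (simp add: win_def translate_apply add.commute)

lemma win_translate: "win n j (translate (k * int n) x) = win n (j + k) x"
  by (simp add: win_def algebra_simps)

lemma win_in_blocks: "x \<in> X \<Longrightarrow> win n j x \<in> blocks n"
  using win_translate[of n 0 j x] translate_in[of x "j * int n"] unfolding blocks_def
  by (metis add_0 imageI)

lemma finite_blocks: "finite (blocks n)"
proof -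
  have "blocks n = (\<lambda>x. restrict x {0..<int n + int N}) ` X" by (auto simp: blocks_def win_def)
  thus ?thesis using finite_windows by simp
qed

lemma blocks_outside: "w \<in> blocks n \<Longrightarrow> t \<notin> {0..<int n + int N} \<Longrightarrow> w t = undefined"
  by (auto simp: blocks_def win_def)

lemma blocks_eqI:
  assumes "v \<in> blocks n" "w \<in> blocks n" "\<And>t. 0 \<le> t \<Longrightarrow> t < int n + int N \<Longrightarrow> v t = w t"
  shows "v = w"
proof
  fix t show "v t = w t"
    using assms blocks_outside[of v n t] blocks_outside[of w n t] by (cases "t \<in> {0..<int n + int N}") auto
qed

lemma eq_if_windows_eq:
  assumes "1 \<le> n" "\<And>j. win n j x = win n j y"
  shows "x = y"
proof
  fix i
  have "0 \<le> i mod int n" "i mod int n < int n" using assms(1) by auto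
  hence "0 \<le> i mod int n" "i mod int n < int n + int N" by linarith+
  hence "x (i div int n * int n + i mod int n) = y (i div int n * int n + i mod int n)"
    using win_apply assms(2) by metis
  thus "x i = y i" by simp
qed

lemma block_perms_in: "p \<in> block_perms n \<Longrightarrow> w \<in> blocks n \<Longrightarrow> p w \<in> blocks n"
  by (simp add: block_perms_def permutes_in_image)

lemma block_perms_ends:
  assumes "p \<in> block_perms n" "x \<in> X" "0 \<le> t" "t < int N"
  shows "p (win n j x) t = x (j * int n + t)" "p (win n j x) (int n + t) = x (j * int n + int n + t)"
proof -
  have "same_ends n (win n j x) (p (win n j x))"
    using assms(1) win_in_blocks[OF assms(2)] by (simp add: block_perms_def)
  thus "p (win n j x) t = x (j * int n + t)" "p (win n j x) (int n + t) = x (j * int n + int n + t)"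
    using assms(3,4) win_apply[of t n j x] win_apply[of "int n + t" n j x]
    by (auto simp: same_ends_def add.assoc)
qed

lemma id_block_perm: "id \<in> block_perms n"
  by (simp add: block_perms_def permutes_id same_ends_refl)

lemma comp_block_perm:
  assumes "p \<in> block_perms n" "q \<in> block_perms n"
  shows "p \<circ> q \<in> block_perms n"
proof -
  have "same_ends n w (p (q w))" if "w \<in> blocks n" for w
    using same_ends_trans[of n w "q w" "p (q w)"] assms block_perms_in[OF assms(2) that] that
    by (simp add: block_perms_def)
  thus ?thesis using assms permutes_compose[of q "blocks n" p] by (simp add: block_perms_def)
qed

lemma transpose_block_perm:
  assumes "a \<in> blocks n" "b \<in> blocks n" "same_ends n a b"
  shows "Transposition.transpose a b \<in> block_perms n"
proof -
  have "same_ends n w (Transposition.transpose a b w)" for w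
    using assms(3) by (auto simp: Transposition.transpose_def same_ends_refl same_ends_sym)
  thus ?thesis using assms permutes_swap_id[of a "blocks n" b] by (simp add: block_perms_def)
qed

lemma act_apply: "0 \<le> t \<Longrightarrow> t < int n \<Longrightarrow> act n p x (j * int n + t) = p (win n j x) t"
  by (simp add: act_def)

text \<open>On the overlap the value is read in the next window. Both permuted windows keep their
  ends there, so both still show the letters of \<open>x\<close>.\<close>

lemma win_act:
  assumes n: "N \<le> n" and p: "p \<in> block_perms n" and x: "x \<in> X"
  shows "win n j (act n p x) = p (win n j x)"
proof
  fix t
  have n0: "0 < int n" using n N_pos by simp
  consider "t \<notin> {0..<int n + int N}" | "0 \<le> t" "t < int n" | "int n \<le> t" "t < int n + int N"
    by (meson atLeastLessThan_iff linorder_not_le)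
  thus "win n j (act n p x) t = p (win n j x) t"
  proof cases
    case 1
    thus ?thesis using blocks_outside[OF block_perms_in[OF p win_in_blocks[OF x]] 1] by (auto simp: win_def)
  next
    case 2
    thus ?thesis by (simp add: win_apply act_apply)
  next
    case 3
    define r where "r = t - int n"
    have r: "t = int n + r" "0 \<le> r" "r < int N" "r < int n" using 3 n by (auto simp: r_def)
    have "win n j (act n p x) t = act n p x ((j + 1) * int n + r)"
      using 3 r by (simp add: win_apply algebra_simps)
    also have "\<dots> = p (win n (j + 1) x) r" using r by (intro act_apply)
    also have "\<dots> = x ((j + 1) * int n + r)" using block_perms_ends(1)[OF p x r(2,3)] .
    also have "\<dots> = p (win n j x) t"
      unfolding r(1) using block_perms_ends(2)[OF p x r(2,3)] by (simp add: algebra_simps)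
    finally show ?thesis .
  qed
qed

text \<open>The overlap makes the local rule applicable: \<open>N\<close> letters starting at
  \<open>i\<close> fit into the window of \<open>i\<close>, and this window of the image is a block
  of \<open>X\<close>.\<close>

lemma act_in:
  assumes n: "N \<le> n" and p: "p \<in> block_perms n" and x: "x \<in> X"
  shows "act n p x \<in> X"
proof (rule local_rule)
  fix i
  have n0: "0 < int n" using n N_pos by simp
  define j t where "j = i div int n" and "t = i mod int n"
  have t: "0 \<le> t" "t < int n" "i = j * int n + t" using n0 by (auto simp: j_def t_def)
  have "p (win n j x) \<in> blocks n" using block_perms_in[OF p win_in_blocks[OF x]] .
  then obtain y where y: "y \<in> X" "p (win n j x) = win n 0 y" by (auto simp: blocks_def)
  have "act n p x (i + k) = translate (- (j * int n)) y (i + k)" if "0 \<le> k" "k < int N" for k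
  proof -
    have "act n p x (j * int n + (t + k)) = win n j (act n p x) (t + k)"
      using t that by (simp add: win_apply)
    also have "\<dots> = win n 0 y (t + k)" unfolding win_act[OF n p x] y(2) ..
    also have "\<dots> = y (t + k)" using t that by (simp add: win_apply)
    finally show ?thesis using t(3) by (simp add: translate_apply add.assoc)
  qed
  thus "\<exists>y\<in>X. \<forall>k. 0 \<le> k \<and> k < int N \<longrightarrow> act n p x (i + k) = y (i + k)"
    using translate_in[OF y(1)] by blast
qed

lemma act_comp:
  assumes "N \<le> n" "p \<in> block_perms n" "q \<in> block_perms n" "x \<in> X"
  shows "act n (p \<circ> q) x = act n p (act n q x)"
  by (rule eq_if_windows_eq[of n]) (simp_all add: win_act act_in comp_block_perm assms order_trans[OF N_pos[unfolded One_nat_def] assms(1)])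

lemma act_id:
  assumes "N \<le> n" "x \<in> X"
  shows "act n id x = x"
  by (rule eq_if_windows_eq[of n]) (simp_all add: win_act id_block_perm assms order_trans[OF N_pos[unfolded One_nat_def] assms(1)])

lemma inv_block_perm:
  assumes "p \<in> block_perms n"
  shows "inv_into UNIV p \<in> block_perms n"
proof -
  have p: "p permutes blocks n" using assms by (simp add: block_perms_def)
  have "same_ends n w (inv_into UNIV p w)" if "w \<in> blocks n" for w
  proof -
    have "inv_into UNIV p w \<in> blocks n" using permutes_inv[OF p] that by (simp add: permutes_in_image)
    hence "same_ends n (inv_into UNIV p w) (p (inv_into UNIV p w))" using assms by (simp add: block_perms_def)
    thus ?thesis using permutes_inverses(1)[OF p] by (simp add: same_ends_sym)
  qed
  thus ?thesis using permutes_inv[OF p] by (simp add: block_perms_def)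
qed

lemma act_bij:
  assumes "N \<le> n" "p \<in> block_perms n"
  shows "bij_betw (act n p) X X"
proof (rule bij_betw_byWitness[of _ "act n (inv_into UNIV p)"])
  have p: "p permutes blocks n" using assms by (simp add: block_perms_def)
  show "\<forall>x\<in>X. act n (inv_into UNIV p) (act n p x) = x" "\<forall>x\<in>X. act n p (act n (inv_into UNIV p) x) = x"
    using assms inv_block_perm permutes_inv_o[OF p] by (simp_all add: act_comp[symmetric] act_id)
  show "act n p ` X \<subseteq> X" "act n (inv_into UNIV p) ` X \<subseteq> X"
    using assms inv_block_perm act_in by auto
qed

lemma act_translate:
  assumes "1 \<le> n"
  shows "act n p (translate (k * int n) x) = translate (k * int n) (act n p x)"
proof
  fix i
  have "(i + k * int n) div int n = i div int n + k" using assms by simp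
  thus "act n p (translate (k * int n) x) i = translate (k * int n) (act n p x) i"
    by (simp add: act_def translate_apply win_translate)
qed

lemma block_aut_carrier:
  assumes "N \<le> n" "p \<in> block_perms n"
  shows "block_aut n p \<in> carrier G"
  unfolding block_aut_def
proof (rule carrierI[of n])
  show n: "1 \<le> n" using assms N_pos by simp
  show "bij_betw (act n p) X X" by (rule act_bij[OF assms])
  show "act n p (translate (int n) x) = translate (int n) (act n p x)" for x
    using act_translate[OF n, of p 1] by simp
  fix x i
  show "\<exists>k. \<forall>y\<in>X. (\<forall>j. \<bar>j\<bar> \<le> k \<longrightarrow> y j = x j) \<longrightarrow> act n p y i = act n p x i"
  proof (intro exI ballI impI)
    fix y assume *: "\<forall>j. \<bar>j\<bar> \<le> \<bar>i div int n * int n\<bar> + int n + int N \<longrightarrow> y j = x j"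
    have "win n (i div int n) y = win n (i div int n) x"
      unfolding win_def using * by (intro restrict_ext) (auto simp: translate_apply)
    thus "act n p y i = act n p x i" by (simp add: act_def)
  qed
qed

lemma block_aut_apply: "x \<in> X \<Longrightarrow> block_aut n p x = act n p x"
  by (simp add: block_aut_def)

lemma block_aut_centralizer:
  assumes "N \<le> n" "p \<in> block_perms n"
  shows "block_aut n p \<in> centralizer_of G (s [^]\<^bsub>G\<^esub> n)"
  using block_aut_carrier[OF assms] act_translate[of n p 1] assms N_pos
  by (simp add: centralizer_of_pow_s_iff block_aut_apply)

lemma block_aut_mult:
  assumes "N \<le> n" "p \<in> block_perms n" "q \<in> block_perms n"
  shows "block_aut n p \<otimes>\<^bsub>G\<^esub> block_aut n q = block_aut n (p \<circ> q)"
  using assms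
  by (intro carrier_eqI)
    (simp_all add: block_aut_carrier comp_block_perm mult_apply block_aut_apply act_comp act_in)

lemma block_aut_id: "N \<le> n \<Longrightarrow> block_aut n id = \<one>\<^bsub>G\<^esub>"
  by (intro carrier_eqI) (simp_all add: block_aut_carrier id_block_perm block_aut_apply act_id one_apply)

lemma block_aut_inj:
  assumes "N \<le> n" "p \<in> block_perms n" "q \<in> block_perms n" "block_aut n p = block_aut n q"
  shows "p = q"
proof
  fix w
  show "p w = q w"
  proof (cases "w \<in> blocks n")
    case True
    then obtain x where x: "x \<in> X" "w = win n 0 x" by (auto simp: blocks_def)
    have "act n p x = act n q x" using assms(4) x(1) by (metis block_aut_apply)
    thus ?thesis using win_act assms x by metis
  next
    case False
    thus ?thesis using assms permutes_not_in[of p "blocks n" w] permutes_not_in[of q "blocks n" w]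
      by (simp add: block_perms_def)
  qed
qed

text \<open>Besides the fixed ends and two gaps of \<open>M\<close> letters, a window has
  \<open>k = n - (N + 2 * M)\<close> free places, so its class has at least
  \<open>word_count X k\<close> members. Submultiplicativity bounds the cost of passing from
  \<open>k\<close> to \<open>n\<close> by a constant factor.\<close>

lemma word_count_le_class:
  assumes n: "N + 2 * M \<le> n" and w: "w \<in> blocks n"
  shows "word_count X n \<le> word_count X (N + 2 * M) * card {v \<in> blocks n. same_ends n w v}"
proof -
  define k where "k = n - (N + 2 * M)"
  have n_eq: "n = N + 2 * M + k" using n by (simp add: k_def)
  obtain x where x: "x \<in> X" "w = win n 0 x" using w by (auto simp: blocks_def)
  let ?R = "(\<lambda>x. restrict x {0..<int k}) ` X"
  let ?C = "{v \<in> blocks n. same_ends n w v}"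
  let ?f = "\<lambda>v. restrict (\<lambda>i. v (i + int (N + M))) {0..<int k}"
  have "?R \<subseteq> ?f ` ?C"
  proof clarify
    fix y assume y: "y \<in> X"
    obtain z1 where z1: "z1 \<in> X" "\<And>j. j < int N \<Longrightarrow> z1 j = x j"
      "\<And>j. j \<ge> int N + int M \<Longrightarrow> z1 j = translate (- int (N + M)) y j"
      using gluing[OF x(1) translate_in[OF y], of "int N"] by blast
    obtain z where z: "z \<in> X" "\<And>j. j < int (N + M + k) \<Longrightarrow> z j = z1 j"
      "\<And>j. j \<ge> int (N + M + k) + int M \<Longrightarrow> z j = x j"
      using gluing[OF z1(1) x(1), of "int (N + M + k)"] by blast
    have "win n 0 z \<in> blocks n" using z(1) win_in_blocks by blast
    moreover have "same_ends n w (win n 0 z)"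
      unfolding same_ends_def x(2) using z(2,3) z1(2) by (auto simp: win_apply n_eq)
    moreover have "restrict y {0..<int k} = ?f (win n 0 z)"
      by (rule restrict_ext) (use z(2) z1(3) in \<open>auto simp: win_apply n_eq translate_apply\<close>)
    ultimately show "restrict y {0..<int k} \<in> ?f ` ?C" by blast
  qed
  hence "word_count X k \<le> card ?C"
    unfolding word_count_def using finite_blocks surj_card_le[of ?C ?R ?f] by simp
  moreover have "word_count X n \<le> word_count X (N + 2 * M) * word_count X k"
    unfolding n_eq by (rule word_count_submult)
  ultimately show ?thesis by (meson le_trans mult_le_mono2)
qed

text \<open>The level comes from \<open>c * d < 2 ^ (c * d)\<close>. Uniformity in \<open>n\<close>
  matters because the bound is later used at level \<open>m\<close> and at level
  \<open>3 * m\<close>.\<close>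

lemma large_classes:
  "\<exists>m\<ge>N + 2 * M. \<forall>n\<ge>m. \<forall>w\<in>blocks n. c \<le> card {v \<in> blocks n. same_ends n w v}"
proof -
  define d where "d = word_count X (N + 2 * M)"
  define m where "m = N + 2 * M + (c * d) * (M + 1)"
  have d: "1 \<le> d" using word_count_pos by (simp add: d_def)
  have "c \<le> card {v \<in> blocks n. same_ends n w v}" if n: "m \<le> n" and w: "w \<in> blocks n" for n w
  proof -
    have mono: "word_count X k \<le> word_count X l" if "k \<le> l" for k l
    proof -
      have "(\<lambda>x. restrict x {0..<int k}) ` X
          = (\<lambda>w. restrict w {0..<int k}) ` (\<lambda>x. restrict x {0..<int l}) ` X"
        using that by (auto simp: image_image intro!: image_cong restrict_ext)
      thus ?thesis unfolding word_count_def by (simp only: card_image_le[OF finite_windows])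
    qed
    have "c * d < 2 ^ (c * d)" by (rule less_exp)
    also have "\<dots> \<le> word_count X ((c * d) * (M + 1))" by (rule word_count_exponential)
    also have "\<dots> \<le> word_count X n" using n by (intro mono) (simp add: m_def)
    also have "\<dots> \<le> d * card {v \<in> blocks n. same_ends n w v}"
      unfolding d_def using n w by (intro word_count_le_class) (auto simp: m_def)
    finally have "d * c < d * card {v \<in> blocks n. same_ends n w v}" by (simp add: mult.commute)
    thus ?thesis using d by simp
  qed
  thus ?thesis by (intro exI[of _ m]) (simp add: m_def)
qed

text \<open>If the bound failed, every class would have more than \<open>2 * d + 2\<close> members.
  The separating subgroup would then contain all 3-cycles inside classes, and with them
  \<open>p\<close>.\<close>

lemma separable_block_aut:
  assumes n: "N + 2 * M \<le> n" and p: "p \<in> block_perms n" "p \<circ> p \<circ> p = id"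
    and sep: "separable_by_index G (centralizer_of G (s [^]\<^bsub>G\<^esub> n)) (block_aut n p) d"
  shows "word_count X n \<le> word_count X (N + 2 * M) * (2 * d + 2)"
proof (rule ccontr)
  assume neg: "\<not> ?thesis"
  have nN: "N \<le> n" using n by simp
  from sep[unfolded separable_by_index_def]
  obtain H where H: "subgroup H G" "block_aut n p \<notin> H" and idx:
    "\<forall>S\<subseteq>centralizer_of G (s [^]\<^bsub>G\<^esub> n). finite S \<and> d < card S \<longrightarrow>
      (\<exists>a\<in>S. \<exists>b\<in>S. a \<noteq> b \<and> a \<otimes>\<^bsub>G\<^esub> inv\<^bsub>G\<^esub> b \<in> H)"
    by (elim exE conjE)
  define K where "K = {q \<in> block_perms n. block_aut n q \<in> H}"
  have comp: "p \<circ> q \<in> K" if "p \<in> K" "q \<in> K" for p q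
    using that subgroup.m_closed[OF H(1), of "block_aut n p" "block_aut n q"] block_aut_mult[OF nN, of p q] comp_block_perm[of p n q]
    by (simp add: K_def)
  have big: "2 * d + 2 < card {v \<in> blocks n. same_ends n w v}" if "w \<in> blocks n" for w
  proof (rule ccontr)
    assume "\<not> ?thesis"
    hence "word_count X (N + 2 * M) * card {v \<in> blocks n. same_ends n w v}
        \<le> word_count X (N + 2 * M) * (2 * d + 2)" by (intro mult_le_mono2) simp
    thus False using word_count_le_class[OF n that] neg by linarith
  qed
  have cyc: "Transposition.transpose a b \<circ> Transposition.transpose a c \<in> K"
    if abc: "a \<in> blocks n" "b \<in> blocks n" "c \<in> blocks n" "same_ends n a b" "same_ends n a c"
      "a \<noteq> b" "a \<noteq> c" "b \<noteq> c" for a b c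
  proof (rule three_cycles_in_small_index[where W = "{v \<in> blocks n. same_ends n a v}" and d = d])
    show "\<exists>y\<in>Y. \<exists>y'\<in>Y. y \<noteq> y' \<and> Transposition.transpose u y \<circ> Transposition.transpose u y' \<in> K"
      if u: "u \<in> {v \<in> blocks n. same_ends n a v}" and Y: "Y \<subseteq> {v \<in> blocks n. same_ends n a v}" "d < card Y"
      for u Y
    proof -
      let ?t = "\<lambda>y. Transposition.transpose u y"
      have t: "?t y \<in> block_perms n" if "y \<in> Y" for y
        using u Y that same_ends_trans same_ends_sym by (intro transpose_block_perm) blast+
      have "inj_on (\<lambda>y. block_aut n (?t y)) Y"
      proof (rule inj_onI)
        fix y y' assume "y \<in> Y" "y' \<in> Y" "block_aut n (?t y) = block_aut n (?t y')"
        hence "?t y = ?t y'" using block_aut_inj[OF nN] t by blast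
        hence "?t y u = ?t y' u" by simp
        thus "y = y'" by simp
      qed
      hence "d < card ((\<lambda>y. block_aut n (?t y)) ` Y)" using Y(2) by (simp add: card_image)
      moreover have "(\<lambda>y. block_aut n (?t y)) ` Y \<subseteq> centralizer_of G (s [^]\<^bsub>G\<^esub> n)"
        using block_aut_centralizer[OF nN t] by blast
      moreover have "finite Y" using Y finite_blocks finite_subset by fastforce
      ultimately obtain y y' where y: "y \<in> Y" "y' \<in> Y" "block_aut n (?t y) \<noteq> block_aut n (?t y')"
        "block_aut n (?t y) \<otimes>\<^bsub>G\<^esub> inv\<^bsub>G\<^esub> block_aut n (?t y') \<in> H"
        using idx[rule_format, of "(\<lambda>y. block_aut n (?t y)) ` Y"] by blast
      \<comment> \<open>Transpositions are involutions, so the quotient supplied by the pigeonhole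
        principle is a product of two transpositions, hence a 3-cycle.\<close>
      have "block_aut n (?t y') \<otimes>\<^bsub>G\<^esub> block_aut n (?t y') = \<one>\<^bsub>G\<^esub>"
        using t[OF y(2)] nN by (simp add: block_aut_mult block_aut_id)
      hence "inv\<^bsub>G\<^esub> block_aut n (?t y') = block_aut n (?t y')"
        using block_aut_carrier[OF nN t[OF y(2)]] by (intro inv_equality) auto
      hence "block_aut n (?t y \<circ> ?t y') \<in> H" using y t nN by (simp add: block_aut_mult)
      hence "?t y \<circ> ?t y' \<in> K" using y t comp_block_perm by (simp add: K_def)
      thus ?thesis using y by (intro bexI[of _ y] bexI[of _ y'] conjI) auto
    qed
  qed (use abc big[OF abc(1)] finite_blocks comp same_ends_refl in auto)
  have "p \<in> K"
  proof (rule order_three_is_product_of_cycles[of "blocks n" K "same_ends n"])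
    show "id \<in> K" using subgroup.one_closed[OF H(1)] by (simp add: K_def id_block_perm block_aut_id nN)
  qed (use p comp cyc finite_blocks same_ends_trans in \<open>auto simp: block_perms_def\<close>)
  thus False using H(2) by (simp add: K_def)
qed

text \<open>This lets one automorphism be tested at every multiple of \<open>m\<close>. A long
  window of the image depends only on the same window of the point: its last \<open>N\<close>
  letters, although read in the next window, are left unchanged.\<close>

lemma act_refine:
  assumes m: "N \<le> m" and l: "1 \<le> l" and p: "p \<in> block_perms m" "p \<circ> p \<circ> p = id"
  obtains q where "q \<in> block_perms (m * l)" "q \<circ> q \<circ> q = id" "block_aut (m * l) q = block_aut m p"
proof -
  define n where "n = m * l"
  have nm: "m \<le> n" and n_eq: "int n = int l * int m" using l by (simp_all add: n_def)
  hence nN: "N \<le> n" using m by simp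
  have m0: "0 < int m" using m N_pos by simp
  let ?h = "act m p"
  have hX: "?h x \<in> X" if "x \<in> X" for x using act_in[OF m p(1) that] .
  have h_tr: "?h (translate (j * int n) x) = translate (j * int n) (?h x)" for j x
    using act_translate[of m p "j * int l" x] m N_pos by (simp add: n_eq mult.assoc)
  have h3: "?h (?h (?h x)) = x" if "x \<in> X" for x
    using that p m hX by (simp add: act_comp[symmetric] act_id comp_block_perm o_assoc)
  have h_start: "?h x (j * int n + t) = x (j * int n + t)" if "x \<in> X" "0 \<le> t" "t < int N" for x j t
    using act_apply[of t m p x "j * int l"] block_perms_ends(1)[OF p(1) that, of "j * int l"] that m
    by (simp add: n_eq mult.assoc)
  have local: "win n 0 (?h x) = win n 0 (?h y)" if x: "x \<in> X" and y: "y \<in> X" and eq: "win n 0 x = win n 0 y" for x y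
  proof (rule blocks_eqI)
    have e: "x t = y t" if "0 \<le> t" "t < int n + int N" for t
      using fun_cong[OF eq, of t] that by (simp add: win_apply)
    fix t assume t: "0 \<le> t" "t < int n + int N"
    show "win n 0 (?h x) t = win n 0 (?h y) t"
    proof (cases "t < int n")
      case True
      define j where "j = t div int m"
      have j: "0 \<le> j" "j < int l"
      proof -
        show "0 \<le> j" using t m0 by (simp add: j_def pos_imp_zdiv_nonneg_iff)
        have "t = j * int m + t mod int m" "0 \<le> t mod int m" using m0 by (simp_all add: j_def)
        moreover have "int l * int m \<le> j * int m" if "\<not> j < int l"
          using that m0 by (intro mult_right_mono) auto
        ultimately show "j < int l" using True unfolding n_eq by linarith
      qed
      have "(j + 1) * int m \<le> int l * int m" using j m0 by (intro mult_right_mono) auto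
      hence "j * int m + int m \<le> int n" by (simp add: n_eq algebra_simps)
      moreover have "0 \<le> j * int m" using j m0 by simp
      ultimately have "win m j x = win m j y"
        unfolding win_def by (intro restrict_ext) (auto simp: translate_apply intro!: e)
      hence "?h x t = ?h y t" by (simp add: act_def j_def)
      thus ?thesis using t by (simp add: win_apply)
    next
      case False
      thus ?thesis using h_start[OF x, of "t - int n" 1] h_start[OF y, of "t - int n" 1] e t by (simp add: win_apply)
    qed
  qed (use x y hX win_in_blocks in auto)
  \<comment> \<open>By \<open>local\<close> the result does not depend on the chosen point.\<close>
  define q where "q w = (if w \<in> blocks n then win n 0 (?h (SOME x. x \<in> X \<and> win n 0 x = w)) else w)" for w
  have q0: "q (win n 0 x) = win n 0 (?h x)" if x: "x \<in> X" for x
  proof -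
    have "(SOME y. y \<in> X \<and> win n 0 y = win n 0 x) \<in> X \<and>
        win n 0 (SOME y. y \<in> X \<and> win n 0 y = win n 0 x) = win n 0 x"
      by (rule someI[of _ x]) (use x in simp)
    hence "win n 0 (?h (SOME y. y \<in> X \<and> win n 0 y = win n 0 x)) = win n 0 (?h x)"
      using local[OF _ x] by blast
    thus ?thesis unfolding q_def if_P[OF win_in_blocks[OF x]] .
  qed
  have q: "q (win n j x) = win n j (?h x)" if "x \<in> X" for x j
    using q0[of "translate (j * int n) x"] that win_translate[of n 0 j] by (simp add: h_tr)
  have qb: "q w \<in> blocks n" if "w \<in> blocks n" for w
    using that q0 hX by (auto simp: blocks_def)
  have q3: "q \<circ> q \<circ> q = id"
  proof
    fix w
    show "(q \<circ> q \<circ> q) w = id w"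
    proof (cases "w \<in> blocks n")
      case True
      then obtain x where "x \<in> X" "w = win n 0 x" by (auto simp: blocks_def)
      thus ?thesis using q0 hX h3 by simp
    qed (simp add: q_def)
  qed
  have qp: "q \<in> block_perms n"
    unfolding block_perms_def
  proof (intro CollectI conjI ballI)
    show "q permutes blocks n"
      by (rule order_three_permutes[OF q3]) (use qb in \<open>auto simp: q_def\<close>)
    fix w assume "w \<in> blocks n"
    then obtain x where x: "x \<in> X" "w = win n 0 x" by (auto simp: blocks_def)
    show "same_ends n w (q w)"
      unfolding same_ends_def x(2) q0[OF x(1)]
      using h_start[OF x(1), of _ 0] h_start[OF x(1), of _ 1] by (simp add: win_apply)
  qed
  have "block_aut n q = block_aut m p"
  proof (rule carrier_eqI[OF block_aut_carrier[OF nN qp] block_aut_carrier[OF m p(1)]])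
    fix x assume x: "x \<in> X"
    have "act n q x = ?h x"
      by (rule eq_if_windows_eq[of n]) (simp_all add: win_act qp q x nN order_trans[OF N_pos[unfolded One_nat_def] nN])
    thus "block_aut n q x = block_aut m p x" using x by (simp add: block_aut_apply)
  qed
  thus ?thesis using that qp q3 unfolding n_def by blast
qed

text \<open>The automorphism comes from a 3-cycle inside a class with at least three members, and
  \<open>c\<close> counts the words of length \<open>N + 2 * M\<close>, the part of a window lost to
  ends and gaps. All are fixed before \<open>l\<close> varies.\<close>

lemma separable_lower:
  obtains m h c where "1 \<le> m" "h \<in> centralizer_of G (s [^]\<^bsub>G\<^esub> m)" "h \<noteq> \<one>\<^bsub>G\<^esub>"
    "\<And>l d. 1 \<le> l \<Longrightarrow> separable_by_index G (centralizer_of G (s [^]\<^bsub>G\<^esub> (m * l))) h d \<Longrightarrow>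
      word_count X (m * l) \<le> c * (2 * d + 2)"
proof -
  obtain m where m: "N + 2 * M \<le> m" "\<And>n w. m \<le> n \<Longrightarrow> w \<in> blocks n \<Longrightarrow> 3 \<le> card {v \<in> blocks n. same_ends n w v}"
    using large_classes[of 3] by blast
  have mN: "N \<le> m" using m by simp
  obtain x where "x \<in> X" using ne by blast
  hence a: "win m 0 x \<in> blocks m" (is "?a \<in> _") by (rule win_in_blocks)
  let ?C = "{v \<in> blocks m. same_ends m ?a v}"
  have "finite ?C" using finite_blocks by simp
  moreover have "1 \<le> card (?C - {?a})" "2 \<le> card (?C - {?a})"
    using m(2)[OF order_refl a] finite_blocks a by (auto simp: same_ends_refl)
  ultimately obtain b c where bc: "b \<in> ?C - {?a}" "c \<in> ?C - {?a}" "b \<noteq> c"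
    by (metis (no_types, lifting) One_nat_def card_le_Suc0_iff_eq finite_Diff not_less_eq_eq numeral_2_eq_2)
  define p where "p = Transposition.transpose ?a b \<circ> Transposition.transpose ?a c"
  have p: "p \<in> block_perms m"
    unfolding p_def using a bc by (intro comp_block_perm transpose_block_perm) auto
  have p3: "p \<circ> p \<circ> p = id"
    by (rule transpose_cycle_order_three[OF _ _ _ p_def]) (use bc in auto)
  have "p c \<noteq> id c" using bc by (simp add: p_def)
  hence "block_aut m p \<noteq> \<one>\<^bsub>G\<^esub>"
    using block_aut_inj[OF mN p id_block_perm] block_aut_id[OF mN] by auto
  moreover have "word_count X (m * l) \<le> word_count X (N + 2 * M) * (2 * d + 2)"
    if l: "1 \<le> l" and sep: "separable_by_index G (centralizer_of G (s [^]\<^bsub>G\<^esub> (m * l))) (block_aut m p) d" for l d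
  proof -
    obtain q where q: "q \<in> block_perms (m * l)" "q \<circ> q \<circ> q = id" "block_aut (m * l) q = block_aut m p"
      using act_refine[OF mN l p p3] .
    have "N + 2 * M \<le> m * l" using m(1) l by (metis le_trans mult.right_neutral mult_le_mono2)
    thus ?thesis using separable_block_aut[of "m * l" q d] q sep by simp
  qed
  ultimately show ?thesis
    using that[of m "block_aut m p" "word_count X (N + 2 * M)"] block_aut_centralizer[OF mN p] mN N_pos by simp
qed

end

section \<open>Elements with a power in every centralizer\<close>

lemma translate_periodic:
  assumes "translate (int n) x = x"
  shows "translate (j * int n) x = x"
proof -
  have *: "translate (int k * int n) x = x" for k
  proof (induction k)
    case (Suc k)
    have "translate (int (Suc k) * int n) x = translate (int k * int n) (translate (int n) x)"
      by (simp add: algebra_simps)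
    thus ?case using Suc assms by simp
  qed simp
  show ?thesis
  proof (cases "0 \<le> j")
    case True thus ?thesis using *[of "nat j"] by simp
  next
    case False
    have "translate (j * int n) (translate (int (nat (- j)) * int n) x) = x"
      using False by simp
    thus ?thesis unfolding * .
  qed
qed

lemma (in mixing_sft) overlap:
  assumes "x \<in> X" "y \<in> X" "\<And>j. i \<le> j \<Longrightarrow> j < i + int N \<Longrightarrow> x j = y j"
  shows "(\<lambda>j. if j < i + int N then x j else y j) \<in> X"
  by (rule overlap_in[OF _ assms]) (fact local_rule)

text \<open>\<open>E0\<close> and \<open>E1\<close> are spelled by two different loops at the same state of the shift.\<close>

locale two_loops = mixing_sft +
  fixes m :: nat and E0 E1
  assumes m: "N + 2 * M \<le> m"
    and classes: "\<And>n w. m \<le> n \<Longrightarrow> w \<in> blocks n \<Longrightarrow> 6 \<le> card {v \<in> blocks n. same_ends n w v}"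
    and E0: "E0 \<in> X" "translate (int m) E0 = E0" and E1: "E1 \<in> X" "translate (int m) E1 = E1"
    and ends: "\<And>t. 0 \<le> t \<Longrightarrow> t < int N \<Longrightarrow> E0 t = E1 t"
    and distinct: "win m 0 E0 \<noteq> win m 0 E1"
begin

abbreviation b where "b z j \<equiv> win m j z"
abbreviation e0 where "e0 \<equiv> win m 0 E0"
abbreviation e1 where "e1 \<equiv> win m 0 E1"

text \<open>Since \<open>E0\<close> and \<open>E1\<close> agree on \<open>[0, N)\<close>, cutting at
  \<open>N\<close> makes block -1, which reaches up to \<open>N\<close>, equal to \<open>e0\<close>
  and block 0 already equal to \<open>e1\<close>. The \<open>0 +\<close> matches the form in
  \<open>overlap\<close>.\<close>

definition wall :: "int \<Rightarrow> 'a" where "wall = (\<lambda>j. if j < 0 + int N then E0 j else E1 j)"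
text \<open>Three consecutive blocks read as one window of level \<open>3 * m\<close>, starting at
  any block and not only at every third one.\<close>

definition triple :: "(int \<Rightarrow> 'a) \<Rightarrow> int \<Rightarrow> int \<Rightarrow> 'a" where
  "triple z j = win (3 * m) 0 (translate (j * int m) z)"

lemma m1: "1 \<le> m" and mN: "N \<le> m" and m3N: "N \<le> 3 * m" and m31: "1 \<le> 3 * m"
  using m N_pos by auto

lemma b_E0: "b E0 j = e0" and b_E1: "b E1 j = e1"
  using win_translate[of m 0 j E0] win_translate[of m 0 j E1]
    translate_periodic[OF E0(2), of j] translate_periodic[OF E1(2), of j] by simp_all

lemma wall_in: "wall \<in> X"
  unfolding wall_def by (rule overlap[OF E0(1) E1(1)]) (use ends in auto)

lemma b_wall: "b wall j = (if j < 0 then e0 else e1)"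
proof (cases "j < 0")
  case True
  have "(j + 1) * int m \<le> 0" using True by (simp add: mult_nonpos_nonneg)
  hence "j * int m + int m \<le> 0" by (simp add: algebra_simps)
  hence "b wall j = b E0 j"
    unfolding win_def by (intro restrict_ext) (auto simp: translate_apply wall_def)
  thus ?thesis using True b_E0[of j] by simp
next
  case False
  have "0 \<le> j * int m" using False by simp
  hence "b wall j = b E1 j"
    unfolding win_def by (intro restrict_ext) (auto simp: translate_apply wall_def ends)
  thus ?thesis using False b_E1[of j] by simp
qed

lemma b_translate: "b (translate (k * int m) z) j = b z (j + k)"
  by (rule win_translate)

lemma b_apply: "0 \<le> t \<Longrightarrow> t < int m + int N \<Longrightarrow> b z j t = z (j * int m + t)"
  by (rule win_apply)

lemma triple_in: "z \<in> X \<Longrightarrow> triple z j \<in> blocks (3 * m)"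
  unfolding triple_def by (intro win_in_blocks translate_in)

lemma triple_apply: "0 \<le> t \<Longrightarrow> t < int (3 * m) + int N \<Longrightarrow> triple z j t = z (j * int m + t)"
  unfolding triple_def by (simp add: win_apply translate_apply add.commute)

lemma triple_translate: "triple (translate (k * int m) z) j = triple z (j + k)"
  by (simp add: triple_def algebra_simps)

lemma win_triple: "win (3 * m) k z = triple z (3 * k)"
proof -
  have "3 * k * int m = k * int (3 * m)" by simp
  thus ?thesis unfolding triple_def using win_translate[of "3 * m" 0 k z] by (simp only: add_0)
qed

lemma triple_eq_iff:
  assumes z: "z \<in> X" and w: "w \<in> X"
  shows "triple z j = triple w k \<longleftrightarrow>
    b z j = b w k \<and> b z (j + 1) = b w (k + 1) \<and> b z (j + 2) = b w (k + 2)"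
proof
  assume eq: "triple z j = triple w k"
  have "b z (j + i) = b w (k + i)" if i: "0 \<le> i" "i \<le> 2" for i
  proof (rule blocks_eqI)
    fix t assume t: "0 \<le> t" "t < int m + int N"
    have "0 \<le> i * int m" "i * int m \<le> 2 * int m" using i by (auto intro: mult_right_mono)
    hence "0 \<le> i * int m + t" "i * int m + t < int (3 * m) + int N" using t by auto
    hence "z (j * int m + (i * int m + t)) = w (k * int m + (i * int m + t))"
      using fun_cong[OF eq, of "i * int m + t"] by (simp only: triple_apply)
    thus "b z (j + i) t = b w (k + i) t" using t by (simp add: b_apply algebra_simps)
  qed (use z w win_in_blocks in auto)
  from this[of 0] this[of 1] this[of 2]
  show "b z j = b w k \<and> b z (j + 1) = b w (k + 1) \<and> b z (j + 2) = b w (k + 2)" by simp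
next
  assume eq: "b z j = b w k \<and> b z (j + 1) = b w (k + 1) \<and> b z (j + 2) = b w (k + 2)"
  show "triple z j = triple w k"
  proof (rule blocks_eqI[OF triple_in[OF z] triple_in[OF w]])
    fix t assume t: "0 \<le> t" "t < int (3 * m) + int N"
    have *: "z (j * int m + (i * int m + u)) = w (k * int m + (i * int m + u))"
      if "b z (j + i) = b w (k + i)" "0 \<le> u" "u < int m + int N" for i u
      using fun_cong[OF that(1), of u] that(2,3) by (simp add: b_apply algebra_simps)
    consider "t < int m" | "int m \<le> t" "t < 2 * int m" | "2 * int m \<le> t" by linarith
    hence "z (j * int m + t) = w (k * int m + t)"
    proof cases
      case 1 thus ?thesis using *[of 0 t] eq t by simp
    next
      case 2 thus ?thesis using *[of 1 "t - int m"] eq t by simp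
    next
      case 3 thus ?thesis using *[of 2 "t - 2 * int m"] eq t by simp
    qed
    thus "triple z j t = triple w k t" using t by (simp add: triple_apply)
  qed
qed

section \<open>Replacing triples of blocks and tracking fixed points\<close>

definition central :: "((int \<Rightarrow> 'a) \<Rightarrow> int \<Rightarrow> 'a) \<Rightarrow> bool" where
  "central f \<longleftrightarrow> f ` X \<subseteq> X \<and> (\<forall>x\<in>X. \<forall>k. f (translate k x) = translate k (f x)) \<and>
    (\<forall>x\<in>X. \<forall>p\<in>block_perms (3 * m). f (act (3 * m) p x) = act (3 * m) p (f x))"

text \<open>\<open>z'\<close> is the image of \<open>z\<close> under an invertible map that commutes
  with \<open>f\<close>, so being fixed passes back from \<open>z'\<close> to \<open>z\<close>.
  Conjugation with a translation puts the swapped window at \<open>q\<close>, although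
  \<open>act\<close> only cuts at multiples of \<open>3 * m\<close>.\<close>

lemma move:
  assumes z: "z \<in> X" and y: "y \<in> X"
    and ends: "\<And>t. 0 \<le> t \<Longrightarrow> t < int N \<Longrightarrow> y t = z (q * int m + t)"
      "\<And>t. 0 \<le> t \<Longrightarrow> t < int N \<Longrightarrow> y (int (3 * m) + t) = z (q * int m + int (3 * m) + t)"
  obtains z' where "z' \<in> X" "\<And>f. central f \<Longrightarrow> f z' = z' \<Longrightarrow> f z = z"
    "\<And>k. triple z' (q + 3 * k) = Transposition.transpose (triple z q) (triple y 0) (triple z (q + 3 * k))"
proof -
  define p where "p = Transposition.transpose (triple z q) (triple y 0)"
  have "same_ends (3 * m) (triple z q) (triple y 0)"
    unfolding same_ends_def using ends by (simp add: triple_apply add.assoc)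
  hence p: "p \<in> block_perms (3 * m)"
    unfolding p_def using triple_in[OF z] triple_in[OF y] by (intro transpose_block_perm)
  define u where "u = translate (q * int m) z"
  have u: "u \<in> X" using z by (simp add: u_def)
  have au: "act (3 * m) p u \<in> X" using act_in[OF m3N p u] .
  define z' where "z' = translate (- q * int m) (act (3 * m) p u)"
  show ?thesis
  proof (rule that)
    show z': "z' \<in> X" using au by (simp add: z'_def)
    show "triple z' (q + 3 * k) = Transposition.transpose (triple z q) (triple y 0) (triple z (q + 3 * k))" for k
    proof -
      have "triple z' (q + 3 * k) = triple (act (3 * m) p u) (3 * k)"
        unfolding z'_def triple_translate by simp
      also have "\<dots> = p (triple u (3 * k))"
        unfolding win_triple[symmetric] by (rule win_act[OF m3N p u])
      also have "triple u (3 * k) = triple z (q + 3 * k)"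
        unfolding u_def triple_translate by (simp add: add.commute)
      finally show ?thesis by (simp add: p_def)
    qed
    fix f assume f: "central f" and fix_z': "f z' = z'"
    have fX: "f z \<in> X" using f z by (auto simp: central_def)
    have "f z' = translate (- q * int m) (act (3 * m) p (translate (q * int m) (f z)))"
      using f z u au p unfolding z'_def central_def by (simp add: u_def)
    hence "translate (- q * int m) (act (3 * m) p (translate (q * int m) (f z)))
        = translate (- q * int m) (act (3 * m) p u)" using fix_z' by (simp add: z'_def)
    hence "translate (q * int m) (translate (- q * int m) (act (3 * m) p (translate (q * int m) (f z))))
        = translate (q * int m) (translate (- q * int m) (act (3 * m) p u))" by (rule arg_cong)
    hence "act (3 * m) p (translate (q * int m) (f z)) = act (3 * m) p u" by simp
    moreover have "inj_on (act (3 * m) p) X" using act_bij[OF m3N p] by (simp add: bij_betw_def)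
    ultimately have "translate (q * int m) (f z) = translate (q * int m) z"
      using u fX by (auto simp: u_def dest: inj_onD)
    hence "translate (- (q * int m)) (translate (q * int m) (f z)) = translate (- (q * int m)) (translate (q * int m) z)"
      by (rule arg_cong)
    thus "f z = z" by simp
  qed
qed

text \<open>The last conclusion lists the side effects: the two triples are exchanged at every
  position congruent to \<open>q\<close> modulo 3. The clause with \<open>q - 2\<close> and
  \<open>q + 2\<close> retains from this congruence that no other affected triple overlaps the one
  at \<open>q\<close>.\<close>

lemma move_blocks:
  assumes z: "z \<in> X" and y: "y \<in> X"
    and ends: "\<And>t. 0 \<le> t \<Longrightarrow> t < int N \<Longrightarrow> y t = z (q * int m + t)"
      "\<And>t. 0 \<le> t \<Longrightarrow> t < int N \<Longrightarrow> y (int (3 * m) + t) = z (q * int m + int (3 * m) + t)"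
  obtains z' where "z' \<in> X" "\<And>f. central f \<Longrightarrow> f z' = z' \<Longrightarrow> f z = z"
    "\<And>t. t \<in> {0, 1, 2} \<Longrightarrow> b z' (q + t) = b y t"
    "\<And>i. b z' i = b z i \<or> (\<exists>j. \<exists>t\<in>{0, 1, 2}. i = j + t \<and> (q - 2 \<le> j \<and> j \<le> q + 2 \<longrightarrow> j = q) \<and>
      ((\<forall>t\<in>{0, 1, 2}. b z (j + t) = b z (q + t)) \<and> b z' i = b y t \<or>
       (\<forall>t\<in>{0, 1, 2}. b z (j + t) = b y t) \<and> b z' i = b z (q + t)))"
proof -
  obtain z' where z': "z' \<in> X" "\<And>f. central f \<Longrightarrow> f z' = z' \<Longrightarrow> f z = z"
    "\<And>k. triple z' (q + 3 * k) = Transposition.transpose (triple z q) (triple y 0) (triple z (q + 3 * k))"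
    using move[OF assms] by blast
  show ?thesis
  proof (rule that)
    show "z' \<in> X" by (rule z'(1))
    show "f z = z" if "central f" "f z' = z'" for f using z'(2)[OF that] .
    have "triple z' q = triple y 0" using z'(3)[of 0] by simp
    thus "b z' (q + t) = b y t" if "t \<in> {0, 1, 2}" for t
      using that z'(1) y by (auto simp: triple_eq_iff)
    fix i
    define k where "k = (i - q) div 3"
    define j where "j = q + 3 * k"
    have "i - q = 3 * k + (i - q) mod 3" "0 \<le> (i - q) mod 3" "(i - q) mod 3 < 3" by (simp_all add: k_def)
    hence "i = j + (i - j)" "i - j \<in> {0, 1, 2}" by (auto simp: j_def)
    then obtain t where t: "t \<in> {0, 1, 2}" "i = j + t" by metis
    have j: "q - 2 \<le> j \<and> j \<le> q + 2 \<longrightarrow> j = q" unfolding j_def by presburger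
    have *: "triple z' j = Transposition.transpose (triple z q) (triple y 0) (triple z j)"
      unfolding j_def by (rule z'(3))
    consider "triple z j = triple z q" | "triple z j = triple y 0"
      | "triple z j \<noteq> triple z q" "triple z j \<noteq> triple y 0" by blast
    thus "b z' i = b z i \<or> (\<exists>j. \<exists>t\<in>{0, 1, 2}. i = j + t \<and> (q - 2 \<le> j \<and> j \<le> q + 2 \<longrightarrow> j = q) \<and>
      ((\<forall>t\<in>{0, 1, 2}. b z (j + t) = b z (q + t)) \<and> b z' i = b y t \<or>
       (\<forall>t\<in>{0, 1, 2}. b z (j + t) = b y t) \<and> b z' i = b z (q + t)))"
    proof cases
      case 1
      hence "triple z' j = triple y 0" using * by simp
      hence "b z' i = b y t" using t z'(1) y by (auto simp: triple_eq_iff)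
      moreover have "\<forall>t\<in>{0, 1, 2}. b z (j + t) = b z (q + t)" using 1 z by (auto simp: triple_eq_iff)
      ultimately show ?thesis using t j by blast
    next
      case 2
      hence "triple z' j = triple z q" using * by simp
      hence "b z' i = b z (q + t)" using t z'(1) z by (auto simp: triple_eq_iff)
      moreover have "\<forall>t\<in>{0, 1, 2}. b z (j + t) = b y t" using 2 z y by (auto simp: triple_eq_iff)
      ultimately show ?thesis using t j by blast
    next
      case 3
      hence "triple z' j = triple z j" using * by simp
      hence "b z' i = b z i" using t z'(1) z by (auto simp: triple_eq_iff)
      thus ?thesis ..
    qed
  qed
qed

text \<open>The boundary of \<open>wall\<close> lies between blocks -1 and 0, here between
  \<open>r\<close> and \<open>r + 1\<close>; the translation makes up the difference.\<close>

lemma wall_unique: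
  assumes "\<And>j. j \<le> r \<Longrightarrow> b z j = e0" "\<And>j. r < j \<Longrightarrow> b z j = e1"
  shows "z = translate ((- r - 1) * int m) wall"
proof (rule eq_if_windows_eq[OF m1])
  fix j
  show "b z j = b (translate ((- r - 1) * int m) wall) j"
    unfolding b_translate b_wall using assms(1)[of j] assms(2)[of j] by auto
qed

definition tails :: "int \<Rightarrow> int \<Rightarrow> (int \<Rightarrow> 'a) \<Rightarrow> bool" where
  "tails l r z \<longleftrightarrow> z \<in> X \<and> (\<forall>j<l. b z j = e0) \<and> (\<forall>j>r. b z j = e1)"

lemma third_block:
  assumes w: "w \<in> blocks m"
  obtains c where "c \<in> blocks m" "same_ends m w c" "c \<noteq> e0" "c \<noteq> e1"
proof -
  let ?C = "{v \<in> blocks m. same_ends m w v}"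
  have "\<not> ?C \<subseteq> {e0, e1}"
  proof
    assume "?C \<subseteq> {e0, e1}"
    hence "card ?C \<le> card {e0, e1}" by (intro card_mono) auto
    also have "\<dots> \<le> 2" by (simp add: card_insert_if)
    finally show False using classes[OF order_refl w] by simp
  qed
  thus ?thesis using that by blast
qed

text \<open>The replacement triple for \<open>shrink_generic\<close>. A point is led from
  \<open>x\<close> to \<open>E1\<close> within one block, which is possible since
  \<open>N + M \<le> m\<close>, and this block is exchanged for a third one of its class. The third
  block ensures that the triple does not occur in the constant tails.\<close>

lemma connecting_point:
  assumes x: "x \<in> X"
  obtains y where "y \<in> X" "b y 0 \<noteq> e0" "b y 0 \<noteq> e1" "b y 1 = e1" "b y 2 = e1" "b y 3 = e1"
    "\<And>t. 0 \<le> t \<Longrightarrow> t < int N \<Longrightarrow> y t = x t"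
proof -
  obtain u where u: "u \<in> X" "\<And>j. j < int N \<Longrightarrow> u j = x j" "\<And>j. int N + int M \<le> j \<Longrightarrow> u j = E1 j"
    using gluing[OF x E1(1), of "int N"] by blast
  obtain c where c: "c \<in> blocks m" "same_ends m (b u 0) c" "c \<noteq> e0" "c \<noteq> e1"
    using third_block[OF win_in_blocks[OF u(1)]] .
  obtain v where v: "v \<in> X" "c = b v 0" using c(1) by (auto simp: blocks_def)
  have vt: "v t = x t" "v (int m + t) = E1 (int m + t)" if "0 \<le> t" "t < int N" for t
    using c(2) that m u(2)[of t] u(3)[of "int m + t"]
    unfolding v(2) same_ends_def by (auto simp: b_apply)
  define y where "y = (\<lambda>j. if j < int m + int N then v j else E1 j)"
  have y: "y \<in> X" unfolding y_def
    by (rule overlap[OF v(1) E1(1)]) (use vt(2)[of "j - int m" for j] in auto)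
  have y1: "y j = E1 j" if "int m \<le> j" for j
    using vt(2)[of "j - int m"] that by (simp add: y_def)
  have "b y 0 = b v 0"
    unfolding win_def by (intro restrict_ext) (auto simp: translate_apply y_def)
  moreover have "b y j = e1" if "1 \<le> j" for j
  proof -
    have "int m \<le> j * int m" using that m1 mult_right_mono[of 1 j "int m"] by simp
    hence "b y j = b E1 j"
      unfolding win_def by (intro restrict_ext) (auto simp: translate_apply y1)
    thus ?thesis using b_E1[of j] by simp
  qed
  moreover have "y t = x t" if "0 \<le> t" "t < int N" for t using vt(1)[OF that] that mN by (simp add: y_def)
  ultimately show ?thesis using that[OF y] c(3,4) v(2) by simp
qed

lemma block_start: "b z j = e \<Longrightarrow> 0 \<le> t \<Longrightarrow> t < int N \<Longrightarrow> z (j * int m + t) = e t"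
  using b_apply[of t j z] by auto

text \<open>Here the swap leaves both tails alone. The old and the new triple at
  \<open>r - 1\<close> do not start with \<open>e0\<close>, so they do not meet the left tail;
  further right they would have to read \<open>e1 e1 e1\<close>, but the old one has another middle
  block and the new one another first block.\<close>

lemma shrink_generic:
  assumes z: "tails l r z" and r: "b z r \<noteq> e1" "b z (r - 1) \<noteq> e0"
  obtains z' where "tails l (r - 1) z'" "\<And>f. central f \<Longrightarrow> f z' = z' \<Longrightarrow> f z = z"
proof -
  define q where "q = r - 1"
  have zX: "z \<in> X" and left: "\<And>j. j < l \<Longrightarrow> b z j = e0" and right: "\<And>j. r < j \<Longrightarrow> b z j = e1"
    using z by (auto simp: tails_def)
  have "translate (q * int m) z \<in> X" using zX by simp
  from connecting_point[OF this] obtain y where y: "y \<in> X" "b y 0 \<noteq> e0" "b y 0 \<noteq> e1" "b y 1 = e1" "b y 2 = e1"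
    "b y 3 = e1" "\<And>t. 0 \<le> t \<Longrightarrow> t < int N \<Longrightarrow> y t = translate (q * int m) z t" by blast
  have "y (int (3 * m) + t) = z (q * int m + int (3 * m) + t)" if "0 \<le> t" "t < int N" for t
    using block_start[OF y(6) that] block_start[OF right[of "q + 3"] that] by (simp add: q_def algebra_simps)
  note end_r = this
  have end_l: "y t = z (q * int m + t)" if "0 \<le> t" "t < int N" for t
    using y(7)[OF that] by (simp add: translate_apply add.commute)
  obtain z' where z': "z' \<in> X" "\<And>f. central f \<Longrightarrow> f z' = z' \<Longrightarrow> f z = z"
    "\<And>t. t \<in> {0, 1, 2} \<Longrightarrow> b z' (q + t) = b y t"
    "\<And>i. b z' i = b z i \<or> (\<exists>j. \<exists>t\<in>{0, 1, 2}. i = j + t \<and> (q - 2 \<le> j \<and> j \<le> q + 2 \<longrightarrow> j = q) \<and>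
      ((\<forall>t\<in>{0, 1, 2}. b z (j + t) = b z (q + t)) \<and> b z' i = b y t \<or>
       (\<forall>t\<in>{0, 1, 2}. b z (j + t) = b y t) \<and> b z' i = b z (q + t)))"
    using move_blocks[OF zX y(1) end_l end_r] by blast
  have "tails l (r - 1) z'"
    unfolding tails_def
  proof (intro conjI allI impI)
    show "z' \<in> X" by (rule z'(1))
    fix i assume i: "i < l"
    from z'(4)[of i] show "b z' i = e0"
    proof (elim disjE exE bexE conjE)
      fix j t assume t: "t \<in> {0, 1, 2}" "i = j + t" and A: "\<forall>t\<in>{0, 1, 2}. b z (j + t) = b z (q + t)"
      have "b z j = e0" using t i by (intro left) auto
      thus ?thesis using A r(2) by (simp add: q_def)
    next
      fix j t assume t: "t \<in> {0, 1, 2}" "i = j + t" and B: "\<forall>t\<in>{0, 1, 2}. b z (j + t) = b y t"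
      have "b z j = e0" using t i by (intro left) auto
      thus ?thesis using B y(2) by simp
    qed (use left i in simp)
  next
    fix i assume i: "r - 1 < i"
    consider "i = q + 1" | "i = q + 2" | "q + 2 < i" using i unfolding q_def by linarith
    thus "b z' i = e1"
    proof cases
      case 3
      from z'(4)[of i] show ?thesis
      proof (elim disjE exE bexE conjE)
        fix j t assume t: "t \<in> {0, 1, 2}" "i = j + t" and j': "q - 2 \<le> j \<and> j \<le> q + 2 \<longrightarrow> j = q"
          and A: "\<forall>t\<in>{0, 1, 2}. b z (j + t) = b z (q + t)"
        have "q + 2 < j" using j' t 3 by auto
        hence "b z (j + 1) = e1" by (intro right) (simp add: q_def)
        thus ?thesis using A r(1) by (simp add: q_def)
      next
        fix j t assume t: "t \<in> {0, 1, 2}" "i = j + t" and j': "q - 2 \<le> j \<and> j \<le> q + 2 \<longrightarrow> j = q"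
          and B: "\<forall>t\<in>{0, 1, 2}. b z (j + t) = b y t"
        have "q + 2 < j" using j' t 3 by auto
        hence "b z j = e1" by (intro right) (simp add: q_def)
        thus ?thesis using B y(3) by simp
      qed (use right 3 in \<open>auto simp: q_def\<close>)
    qed (use z'(3)[of 1] z'(3)[of 2] y in auto)
  qed
  thus ?thesis using that z'(2) by blast
qed

text \<open>The triple at \<open>r - 1\<close> has the form \<open>e0 x e1\<close> and is exchanged
  with \<open>e0 e1 e1\<close>. The new triple may occur elsewhere, so side effects remain; they
  only change a block between an \<open>e0\<close> and an \<open>e1\<close>.\<close>

lemma shrink_wall:
  assumes z: "tails l r z" and r: "b z r \<noteq> e1" "b z (r - 1) = e0"
  obtains z' where "z' \<in> X" "\<And>f. central f \<Longrightarrow> f z' = z' \<Longrightarrow> f z = z"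
    "b z' (r - 1) = e0" "\<And>j. r - 1 < j \<Longrightarrow> b z' j = e1"
    "\<And>i. b z' i = b z i \<or> b z (i - 1) = e0 \<and> b z (i + 1) = e1 \<and>
       (b z i = b z r \<and> b z' i = e1 \<or> b z i = e1 \<and> b z' i = b z r)"
proof -
  define q where "q = r - 1"
  have zX: "z \<in> X" and right: "\<And>j. r < j \<Longrightarrow> b z j = e1"
    using z by (auto simp: tails_def)
  have zq: "b z q = e0" "b z (q + 1) = b z r" "b z (q + 2) = e1" "b z (q + 3) = e1"
    using r right by (auto simp: q_def)
  \<comment> \<open>This translate of the wall supplies the triple \<open>e0 e1 e1\<close>.\<close>
  define y where "y = translate ((- 1) * int m) wall"
  have y: "y \<in> X" unfolding y_def using wall_in by (rule translate_in)
  have yb: "b y 0 = e0" "b y 1 = e1" "b y 2 = e1" "b y 3 = e1"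
    unfolding y_def b_translate b_wall by auto
  have end_r: "y (int (3 * m) + t) = z (q * int m + int (3 * m) + t)" if "0 \<le> t" "t < int N" for t
    using block_start[OF yb(4) that] block_start[OF zq(4) that] by (simp add: algebra_simps)
  have end_l: "y t = z (q * int m + t)" if "0 \<le> t" "t < int N" for t
    using block_start[OF yb(1) that] block_start[OF zq(1) that] by simp
  obtain z' where z': "z' \<in> X" "\<And>f. central f \<Longrightarrow> f z' = z' \<Longrightarrow> f z = z"
    "\<And>t. t \<in> {0, 1, 2} \<Longrightarrow> b z' (q + t) = b y t"
    "\<And>i. b z' i = b z i \<or> (\<exists>j. \<exists>t\<in>{0, 1, 2}. i = j + t \<and> (q - 2 \<le> j \<and> j \<le> q + 2 \<longrightarrow> j = q) \<and>
      ((\<forall>t\<in>{0, 1, 2}. b z (j + t) = b z (q + t)) \<and> b z' i = b y t \<or>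
       (\<forall>t\<in>{0, 1, 2}. b z (j + t) = b y t) \<and> b z' i = b z (q + t)))"
    using move_blocks[OF zX y end_l end_r] by blast
  have change: "b z' i = b z i \<or> b z (i - 1) = e0 \<and> b z (i + 1) = e1 \<and>
       (b z i = b z r \<and> b z' i = e1 \<or> b z i = e1 \<and> b z' i = b z r)" for i
    using z'(4)[of i]
  proof (elim disjE exE bexE conjE)
    fix j t assume t: "t \<in> {0, 1, 2}" "i = j + t"
      and A: "\<forall>t\<in>{0, 1, 2}. b z (j + t) = b z (q + t)" "b z' i = b y t"
    have "b z j = e0" "b z (j + 1) = b z r" "b z (j + 2) = e1" using A(1) zq by auto
    thus ?thesis using t A(2) yb by (auto simp: add.commute)
  next
    fix j t assume t: "t \<in> {0, 1, 2}" "i = j + t"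
      and B: "\<forall>t\<in>{0, 1, 2}. b z (j + t) = b y t" "b z' i = b z (q + t)"
    have "b z j = e0" "b z (j + 1) = e1" "b z (j + 2) = e1" using B(1) yb by auto
    thus ?thesis using t B(2) zq by (auto simp: add.commute)
  qed simp
  show ?thesis
  proof (rule that)
    show "z' \<in> X" by (rule z'(1))
    show "f z = z" if "central f" "f z' = z'" for f by (rule z'(2)[OF that])
    show "b z' (r - 1) = e0" using z'(3)[of 0] yb by (simp add: q_def)
    show "b z' i = e1" if i: "r - 1 < i" for i
    proof -
      consider "i = q + 1" | "i = q + 2" | "r + 1 < i" using i unfolding q_def by linarith
      thus ?thesis
      proof cases
        case 3
        thus ?thesis using change[of i] right[of i] right[of "i - 1"] distinct by auto
      qed (use z'(3)[of 1] z'(3)[of 2] yb in auto)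
    qed
  qed (rule change)
qed

text \<open>
  A block at \<open>r\<close> that differs from \<open>e0\<close> and \<open>e1\<close> can be removed. If the right wall reads \<open>e0 e1\<close>, the
  same pattern may occur at the left wall, which then moves along; in that case the run of \<open>e0\<close> in
  front of the right wall gets shorter, and \<open>k\<close> measures its length.
\<close>

lemma tails_fixed:
  assumes f: "central f" "f wall = wall" and z: "tails l r z"
  shows "f z = z"
  using z
proof (induction "nat (r + 1 - l)" arbitrary: l r z rule: less_induct)
  case outer: less
  have finished: "f z = z" if "\<And>j. j \<le> r \<Longrightarrow> b z j = e0" "\<And>j. r < j \<Longrightarrow> b z j = e1" for z r
  proof -
    have "f (translate ((- r - 1) * int m) wall) = translate ((- r - 1) * int m) (f wall)"
      using f(1) wall_in by (auto simp: central_def)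
    thus ?thesis using wall_unique[OF that] f(2) by simp
  qed
  \<comment> \<open>The interval from \<open>l'\<close> to \<open>r'\<close> may slide to the left
    at constant width as long as \<open>k\<close> decreases; the other cases shorten it and use the
    outer induction.\<close>
  have key: "f z = z" if "tails l' r' z" "r' - l' = r - l" "l' \<le> r'" "b z (r' - int k) \<noteq> e0"
      "\<And>i. r' - int k < i \<Longrightarrow> i \<le> r' \<Longrightarrow> b z i = e0" for k l' r' z
    using that
  proof (induction k arbitrary: l' r' z rule: less_induct)
    case (less k)
    have e01: "e0 \<noteq> e1" by (rule distinct)
    have smaller: "f u = u" if "tails l' (r' - 1) u" for u
      using outer.hyps[OF _ that] less.prems(2,3) by auto
    consider "b z r' = e1" | "b z r' \<noteq> e1" "b z (r' - 1) \<noteq> e0"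
      | "b z r' \<noteq> e1" "b z (r' - 1) = e0" "b z r' \<noteq> e0" | "b z (r' - 1) = e0" "b z r' = e0" by blast
    thus ?case
    proof cases
      case 1
      have "b z j = e1" if "r' - 1 < j" for j
        using that 1 less.prems(1) by (cases "j = r'") (auto simp: tails_def)
      hence "tails l' (r' - 1) z" using less.prems(1) by (simp add: tails_def)
      thus ?thesis by (rule smaller)
    next
      case 2
      then obtain z' where "tails l' (r' - 1) z'" "\<And>f. central f \<Longrightarrow> f z' = z' \<Longrightarrow> f z = z"
        using shrink_generic[OF less.prems(1)] by blast
      thus ?thesis using smaller f(1) by blast
    next
      case 3
      obtain z' where z': "z' \<in> X" "\<And>f. central f \<Longrightarrow> f z' = z' \<Longrightarrow> f z = z"
        "b z' (r' - 1) = e0" "\<And>j. r' - 1 < j \<Longrightarrow> b z' j = e1"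
        and change: "\<And>i. b z' i = b z i \<or> b z (i - 1) = e0 \<and> b z (i + 1) = e1 \<and>
           (b z i = b z r' \<and> b z' i = e1 \<or> b z i = e1 \<and> b z' i = b z r')"
        using shrink_wall[OF less.prems(1) 3(1,2)] by blast
      \<comment> \<open>The exchanged middle blocks are \<open>b z r'\<close> and \<open>e1\<close>,
        both different from \<open>e0\<close>, so the left tail is untouched.\<close>
      have "b z' i = e0" if i: "i < l'" for i
      proof -
        have left: "\<And>j. j < l' \<Longrightarrow> b z j = e0" using less.prems(1) by (simp add: tails_def)
        show ?thesis using change[of i] left[OF i] 3(3) e01 by auto
      qed
      hence "tails l' (r' - 1) z'" using z' by (simp add: tails_def)
      thus ?thesis using smaller z'(2) f(1) by blast
    next
      case 4
      have k: "2 \<le> k"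
      proof (rule ccontr)
        assume "\<not> 2 \<le> k"
        hence "k = 0 \<or> k = 1" by auto
        thus False using less.prems(4) 4 by auto
      qed
      have r1: "b z r' \<noteq> e1" using 4(2) e01 by simp
      obtain z' where z': "z' \<in> X" "\<And>f. central f \<Longrightarrow> f z' = z' \<Longrightarrow> f z = z"
        "b z' (r' - 1) = e0" "\<And>j. r' - 1 < j \<Longrightarrow> b z' j = e1"
        and change': "\<And>i. b z' i = b z i \<or> b z (i - 1) = e0 \<and> b z (i + 1) = e1 \<and>
           (b z i = b z r' \<and> b z' i = e1 \<or> b z i = e1 \<and> b z' i = b z r')"
        using shrink_wall[OF less.prems(1) r1 4(1)] by blast
      have change: "b z' i = b z i \<or> b z i = e0 \<and> b z (i + 1) = e1 \<and> b z' i = e1 \<or>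
          b z i = e1 \<and> b z (i + 1) = e1 \<and> b z (i - 1) = e0 \<and> b z' i = e0" for i
        using change'[of i] unfolding 4(2) by blast
      have left: "\<And>j. j < l' \<Longrightarrow> b z j = e0" using less.prems(1) by (simp add: tails_def)
      \<comment> \<open>Now an \<open>e0\<close> can change, but only in front of an
        \<open>e1\<close>; in the left tail this can happen at \<open>l' - 1\<close> alone.\<close>
      have "b z' i = e0" if i: "i < l' - 1" for i
        using change[of i] left[of i] left[of "i + 1"] i e01 by auto
      hence t: "tails (l' - 1) (r' - 1) z'" using z' by (simp add: tails_def)
      have run: "b z i = e0" if "r' - int k < i" "i \<le> r'" for i using less.prems(5) that by blast
      have "f z' = z'"
      proof (rule less.IH[of "k - 1", OF _ t])
        show "k - 1 < k" using k by simp
        show "r' - 1 - (l' - 1) = r - l" "l' - 1 \<le> r' - 1" using less.prems by auto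
        have "r' - 1 - int (k - 1) = r' - int k" using k by simp
        \<comment> \<open>This block could become \<open>e0\<close> only in front of an
          \<open>e1\<close>, but it is followed by the run of \<open>e0\<close>.\<close>
        moreover have "b z' (r' - int k) \<noteq> e0"
          using change[of "r' - int k"] less.prems(4) run[of "r' - int k + 1"] k e01 by auto
        ultimately show "b z' (r' - 1 - int (k - 1)) \<noteq> e0" by simp
        fix i assume i: "r' - 1 - int (k - 1) < i" "i \<le> r' - 1"
        hence "b z i = e0" "b z (i + 1) = e0" using run k by auto
        thus "b z' i = e0" using change[of i] e01 by auto
      qed
      thus ?thesis using z'(2) f(1) by blast
    qed
  qed
  have right: "\<And>j. r < j \<Longrightarrow> b z j = e1" using outer.prems by (simp add: tails_def)
  show ?case
  proof (cases "\<forall>j\<le>r. b z j = e0")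
    case True thus ?thesis using finished right by blast
  next
    case False
    then obtain j where j: "j \<le> r" "b z j \<noteq> e0" by blast
    hence "l \<le> j" using outer.prems unfolding tails_def by (metis linorder_not_less)
    have ex: "b z (r - int (nat (r - j))) \<noteq> e0" using j by simp
    define k where "k = (LEAST k. b z (r - int k) \<noteq> e0)"
    have k: "b z (r - int k) \<noteq> e0" unfolding k_def by (rule LeastI[of "\<lambda>k. b z (r - int k) \<noteq> e0", OF ex])
    have "b z i = e0" if i: "r - int k < i" "i \<le> r" for i
    proof (rule ccontr)
      assume "b z i \<noteq> e0"
      hence "k \<le> nat (r - i)" unfolding k_def using i by (intro Least_le) simp
      thus False using i by linarith
    qed
    thus ?thesis using key[OF outer.prems refl _ k] \<open>l \<le> j\<close> j(1) by auto
  qed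
qed

lemma tails_dense:
  assumes x: "x \<in> X"
  obtains l r z where "tails l r z" "\<And>i. \<bar>i\<bar> \<le> int K \<Longrightarrow> z i = x i"
proof -
  \<comment> \<open>The centre of \<open>x\<close> is placed between \<open>E0\<close> and
    \<open>E1\<close>; \<open>a\<close> leaves room for the left gap outside
    \<open>[-K, K]\<close>.\<close>
  define a where "a = int K + int M + 1"
  obtain u where u: "u \<in> X" "\<And>j. j < - a \<Longrightarrow> u j = E0 j" "\<And>j. - a + int M \<le> j \<Longrightarrow> u j = x j"
    using gluing[OF E0(1) x, of "- a"] by blast
  obtain z where z: "z \<in> X" "\<And>j. j < a \<Longrightarrow> z j = u j" "\<And>j. a + int M \<le> j \<Longrightarrow> z j = E1 j"
    using gluing[OF u(1) E1(1), of a] by blast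
  have zl: "z j = E0 j" if "j < - a" for j using z(2)[of j] u(2)[of j] that by (simp add: a_def)
  have "b z j = e0" if j: "j < - (a + int N)" for j
  proof -
    have "(j + 1) * int m \<le> (j + 1) * 1" using j m1 by (intro mult_left_mono_neg) (auto simp: a_def)
    hence "j * int m + int m + int N \<le> - a" using j by (simp add: algebra_simps)
    hence "b z j = b E0 j"
      unfolding win_def by (intro restrict_ext) (auto simp: translate_apply intro!: zl)
    thus ?thesis using b_E0[of j] by simp
  qed
  moreover have "b z j = e1" if j: "a + int M < j" for j
  proof -
    have "j * 1 \<le> j * int m" using j m1 by (intro mult_left_mono) (auto simp: a_def)
    hence "b z j = b E1 j"
      unfolding win_def using j by (intro restrict_ext) (auto simp: translate_apply intro!: z(3))
    thus ?thesis using b_E1[of j] by simp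
  qed
  ultimately have "tails (- (a + int N)) (a + int M) z" using z(1) by (simp add: tails_def)
  moreover have "z i = x i" if "\<bar>i\<bar> \<le> int K" for i
    using z(2)[of i] u(3)[of i] that by (simp add: a_def)
  ultimately show ?thesis using that by blast
qed

lemma central_eq_id:
  assumes f: "central f" "f wall = wall"
    and cont: "\<And>x i. x \<in> X \<Longrightarrow> \<exists>k. \<forall>y\<in>X. (\<forall>j. \<bar>j\<bar> \<le> k \<longrightarrow> y j = x j) \<longrightarrow> f y i = f x i"
    and x: "x \<in> X"
  shows "f x = x"
proof
  fix i
  obtain k where k: "\<And>y. y \<in> X \<Longrightarrow> (\<forall>j. \<bar>j\<bar> \<le> k \<longrightarrow> y j = x j) \<Longrightarrow> f y i = f x i"
    using cont[OF x] by blast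
  define K where "K = nat (max k \<bar>i\<bar>)"
  have K: "k \<le> int K" "\<bar>i\<bar> \<le> int K" by (auto simp: K_def)
  obtain l r z where z: "tails l r z" "\<And>i. \<bar>i\<bar> \<le> int K \<Longrightarrow> z i = x i" using tails_dense[OF x] by blast
  have "f x i = f z i" using k[of z] z K(1) by (simp add: tails_def)
  also have "\<dots> = x i" using tails_fixed[OF f z(1)] z(2)[OF K(2)] by simp
  finally show "f x i = x i" .
qed

section \<open>The image of the wall under a central map\<close>

abbreviation wall_triples where "wall_triples \<equiv> triple wall ` {-3, -2, -1, 0}"

text \<open>The four triples are \<open>e0 e0 e0\<close>, \<open>e0 e0 e1\<close>,
  \<open>e0 e1 e1\<close> and \<open>e1 e1 e1\<close>; outside -3 to 0 a triple is constant.\<close>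

lemma triple_wall: "triple wall j \<in> wall_triples"
proof -
  have 1: "triple wall j = triple wall (if j \<le> -3 then -3 else if 0 \<le> j then 0 else j)"
    unfolding triple_eq_iff[OF wall_in wall_in] b_wall by auto
  have 2: "(if j \<le> -3 then -3 else if 0 \<le> j then 0 else j) \<in> {-3, -2, -1, 0}" by auto
  show ?thesis by (subst 1) (rule imageI[OF 2])
qed

text \<open>
  A transposition of two windows fixes a point iff neither window occurs in it, so a map commuting
  with all of them creates no window whose class contains a second unused one.
\<close>

lemma central_preserves_wall_triples:
  assumes f: "central f" and z: "z \<in> X" "\<And>j. triple z j \<in> wall_triples"
  shows "triple (f z) j \<in> wall_triples"
proof (rule ccontr)
  define w where "w = triple (f z) j"
  assume "triple (f z) j \<notin> wall_triples"
  hence w: "w \<notin> wall_triples" by (simp add: w_def)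
  have fz: "f z \<in> X" using f z(1) by (auto simp: central_def)
  have wb: "w \<in> blocks (3 * m)" unfolding w_def by (rule triple_in[OF fz])
  let ?C = "{v \<in> blocks (3 * m). same_ends (3 * m) w v}"
  \<comment> \<open>At most four triples of the wall and \<open>w\<close> itself are excluded, which
    is why classes of six members were required.\<close>
  have "\<not> ?C \<subseteq> insert w wall_triples"
  proof
    assume "?C \<subseteq> insert w wall_triples"
    hence "card ?C \<le> card (insert w wall_triples)" by (intro card_mono) auto
    also have "\<dots> \<le> Suc (card wall_triples)" by (simp add: card_insert_if)
    also have "\<dots> \<le> 5" using card_image_le[of "{-3, -2, -1, 0::int}" "triple wall"] by simp
    finally show False using classes[OF _ wb] by simp
  qed
  then obtain v where v: "v \<in> blocks (3 * m)" "same_ends (3 * m) w v" "v \<noteq> w" "v \<notin> wall_triples" by blast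
  define p where "p = Transposition.transpose w v"
  have p: "p \<in> block_perms (3 * m)" unfolding p_def using wb v by (intro transpose_block_perm)
  define u where "u = translate (j * int m) z"
  have u: "u \<in> X" using z(1) by (simp add: u_def)
  have "act (3 * m) p u = u"
  proof (rule eq_if_windows_eq[OF m31])
    fix k
    have "win (3 * m) k u = triple z (3 * k + j)" unfolding win_triple u_def triple_translate ..
    hence "win (3 * m) k u \<noteq> w" "win (3 * m) k u \<noteq> v" using z(2)[of "3 * k + j"] w v(4) by auto
    thus "win (3 * m) k (act (3 * m) p u) = win (3 * m) k u"
      unfolding win_act[OF m3N p u] unfolding p_def by (rule transpose_apply_other)
  qed
  hence "act (3 * m) p (f u) = f u" using f u p unfolding central_def by metis
  hence "win (3 * m) 0 (act (3 * m) p (f u)) = win (3 * m) 0 (f u)" by simp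
  moreover have "f u \<in> X" using f u by (auto simp: central_def)
  ultimately have "p (win (3 * m) 0 (f u)) = win (3 * m) 0 (f u)" by (simp add: win_act[OF m3N p])
  moreover have "win (3 * m) 0 (f u) = w"
  proof -
    have "f u = translate (j * int m) (f z)" using f z(1) by (simp add: u_def central_def)
    thus ?thesis by (simp add: w_def triple_def)
  qed
  ultimately show False using v(3) by (simp add: p_def)
qed

text \<open>In the four triples an \<open>e1\<close> is followed only by \<open>e1\<close>, so a
  point built from them changes its block at most once.\<close>

lemma wall_triples_classification:
  assumes z: "z \<in> X" "\<And>j. triple z j \<in> wall_triples"
  shows "z = E0 \<or> z = E1 \<or> (\<exists>k. z = translate (k * int m) wall)"
proof -
  have e01: "e0 \<noteq> e1" by (rule distinct)
  have bz: "b z j = e0 \<or> b z j = e1 \<and> b z (j + 1) = e1" for j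
  proof -
    obtain i where "triple z j = triple wall i" using z(2)[of j] by blast
    hence "b z j = b wall i" "b z (j + 1) = b wall (i + 1)" using z(1) wall_in triple_eq_iff by blast+
    thus ?thesis by (auto simp: b_wall)
  qed
  have up: "b z (j + int d) = e1" if "b z j = e1" for j d
  proof (induction d)
    case (Suc d)
    have "j + int (Suc d) = j + int d + 1" by simp
    thus ?case using bz[of "j + int d"] Suc e01 by metis
  qed (use that in simp)
  consider "\<forall>j. b z j = e0" | "\<forall>j. b z j = e1" | i j where "b z i = e0" "b z j = e1" using bz by metis
  thus ?thesis
  proof cases
    case 1
    have "z = E0"
    proof (rule eq_if_windows_eq[OF m1])
      show "b z j = b E0 j" for j using 1 b_E0[of j] by simp
    qed
    thus ?thesis ..
  next
    case 2
    have "z = E1"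
    proof (rule eq_if_windows_eq[OF m1])
      show "b z j = b E1 j" for j using 2 b_E1[of j] by simp
    qed
    thus ?thesis by blast
  next
    case 3
    have up': "b z k = e1" if "b z l = e1" "l \<le> k" for k l
      using up[OF that(1), of "nat (k - l)"] that(2) by simp
    have "i < j" using up'[of j i] 3 e01 by (metis linorder_not_less)
    hence ex: "b z (i + int (nat (j - i))) = e1" using 3 by simp
    define d where "d = (LEAST d. b z (i + int d) = e1)"
    have d: "b z (i + int d) = e1" unfolding d_def by (rule LeastI[of "\<lambda>d. b z (i + int d) = e1", OF ex])
    define r where "r = i + int d - 1"
    have "b z k = e1" if "r < k" for k using up'[OF d] that by (simp add: r_def)
    moreover have "b z k = e0" if k: "k \<le> r" for k
    proof (rule ccontr)
      assume "b z k \<noteq> e0"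
      hence k1: "b z k = e1" using bz by blast
      hence "i < k" using up'[OF k1, of i] 3(1) e01 by (metis linorder_not_less)
      hence "d \<le> nat (k - i)" unfolding d_def using k1 by (intro Least_le) simp
      thus False using k \<open>i < k\<close> by (simp add: r_def)
    qed
    ultimately have "z = translate ((- r - 1) * int m) wall" by (intro wall_unique)
    thus ?thesis by blast
  qed
qed

text \<open>\<open>E0\<close> and \<open>E1\<close> have period \<open>m\<close>, whereas an
  injective map commuting with translations cannot give this period to the image of the
  wall.\<close>

lemma central_moves_wall:
  assumes f: "central f" and inj: "inj_on f X"
  obtains k where "f wall = translate (k * int m) wall"
proof -
  have fw: "f wall \<in> X" using f wall_in by (auto simp: central_def)
  have "triple (f wall) j \<in> wall_triples" for j
    by (rule central_preserves_wall_triples[OF f wall_in triple_wall])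
  hence cases: "f wall = E0 \<or> f wall = E1 \<or> (\<exists>k. f wall = translate (k * int m) wall)"
    using wall_triples_classification fw by blast
  have "translate (int m) (f wall) \<noteq> f wall"
  proof
    assume "translate (int m) (f wall) = f wall"
    hence "f (translate (int m) wall) = f wall" using f wall_in by (simp add: central_def)
    hence "translate (int m) wall = wall" using inj wall_in by (auto dest: inj_onD)
    hence "b (translate (1 * int m) wall) (- 1) = b wall (- 1)" by simp
    thus False unfolding b_translate b_wall using distinct by simp
  qed
  thus ?thesis using cases E0(2) E1(2) that by metis
qed

end

section \<open>Recognizing powers of the shift by their centralizers\<close>

context mixing_sft
begin

text \<open>Gluing \<open>x\<close> to its own translate by \<open>m\<close> gives a block that ends
  as it begins. Every member of its class has the same property, and two of them close up to
  \<open>E0\<close> and \<open>E1\<close>.\<close>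

lemma two_loops_exist: "\<exists>m E0 E1. two_loops A X N M m E0 E1"
proof -
  obtain m where m: "N + 2 * M \<le> m" "\<And>n w. m \<le> n \<Longrightarrow> w \<in> blocks n \<Longrightarrow> 6 \<le> card {v \<in> blocks n. same_ends n w v}"
    using large_classes[of 6] by blast
  have mN: "N \<le> m" using m(1) by simp
  obtain x where x: "x \<in> X" using ne by blast
  obtain z where z: "z \<in> X" "\<And>j. j < int N \<Longrightarrow> z j = x j" "\<And>j. int N + int M \<le> j \<Longrightarrow> z j = translate (- int m) x j"
    using gluing[OF x translate_in[OF x], of "int N"] by blast
  define w where "w = win m 0 z"
  have w: "w \<in> blocks m" unfolding w_def by (rule win_in_blocks[OF z(1)])
  have loop: "w (int m + t) = w t" if "0 \<le> t" "t < int N" for t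
    using z(2)[of t] z(3)[of "int m + t"] that m(1) by (simp add: w_def win_apply translate_apply)
  let ?C = "{v \<in> blocks m. same_ends m w v}"
  have "\<not> ?C \<subseteq> {w}"
  proof
    assume "?C \<subseteq> {w}"
    hence "card ?C \<le> card {w}" by (intro card_mono) auto
    thus False using m(2)[OF order_refl w] by simp
  qed
  then obtain v where v: "v \<in> blocks m" "same_ends m w v" "v \<noteq> w" by blast
  have per: "\<exists>y\<in>X. translate (int m) y = y \<and> win m 0 y = u" if u: "u \<in> blocks m" "same_ends m w u" for u
  proof -
    obtain y where y: "y \<in> X" "u = win m 0 y" using u(1) by (auto simp: blocks_def)
    have "y (i + int m) = y i" if "0 \<le> i" "i < 0 + int N" for i
    proof -
      have "u (int m + i) = u i" using u(2) loop[of i] that by (simp add: same_ends_def)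
      thus ?thesis using that by (simp add: y(2) win_apply add.commute)
    qed
    then obtain y' where y': "y' \<in> X" "translate (int m) y' = y'"
      "\<And>i. 0 \<le> i \<Longrightarrow> i < 0 + int m + int N \<Longrightarrow> y' i = y i"
      using periodic_point[OF y(1) mN, of 0] by blast
    have "win m 0 y' = win m 0 y"
      unfolding win_def by (intro restrict_ext) (auto simp: translate_apply y'(3))
    thus ?thesis using y' y(2) by blast
  qed
  obtain E0 where E0: "E0 \<in> X" "translate (int m) E0 = E0" "win m 0 E0 = w"
    using per[OF w same_ends_refl] by blast
  obtain E1 where E1: "E1 \<in> X" "translate (int m) E1 = E1" "win m 0 E1 = v"
    using per[OF v(1,2)] by blast
  have "E0 t = E1 t" if "0 \<le> t" "t < int N" for t
    using v(2) that win_apply[of t m 0 E0] win_apply[of t m 0 E1] unfolding E0(3) E1(3) by (simp add: same_ends_def)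
  moreover have "win m 0 E0 \<noteq> win m 0 E1" using v(3) E0(3) E1(3) by simp
  ultimately have "two_loops A X N M m E0 E1"
    using m E0(1,2) E1(1,2) by unfold_locales blast+
  thus ?thesis by blast
qed

lemma carrier_commute_translate:
  assumes g: "g \<in> carrier G" "g \<otimes>\<^bsub>G\<^esub> s = s \<otimes>\<^bsub>G\<^esub> g" and x: "x \<in> X"
  shows "g (translate k x) = translate k (g x)"
proof -
  have 1: "g (translate 1 x) = translate 1 (g x)" if "x \<in> X" for x
  proof -
    have "(g \<otimes>\<^bsub>G\<^esub> s) x = (s \<otimes>\<^bsub>G\<^esub> g) x" using g(2) by simp
    thus ?thesis using g(1) s_carrier that by (simp add: mult_apply s_apply carrier_in)
  qed
  have 2: "g (translate (- 1) x) = translate (- 1) (g x)" if "x \<in> X" for x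
  proof -
    have "translate (- 1) (g (translate 1 (translate (- 1) x))) = translate (- 1) (translate 1 (g (translate (- 1) x)))"
      using 1[of "translate (- 1) x"] that by (simp only: translate_in)
    thus ?thesis by simp
  qed
  show ?thesis
  proof (cases "0 \<le> k")
    case True
    thus ?thesis using commute_translate_multiple[of g 1 x "nat k"] 1 x by simp
  next
    case False
    thus ?thesis using commute_translate_multiple[of g "- 1" x "nat (- k)"] 2 x by simp
  qed
qed

lemma centralizing_power_of_shift:
  assumes g: "g \<in> carrier G"
    and ghost: "\<And>h. h \<in> carrier G \<Longrightarrow> \<exists>n\<ge>1. h \<in> centralizer_of G (g [^]\<^bsub>G\<^esub> (n::nat))"
  obtains a k :: nat where "1 \<le> a" "g [^]\<^bsub>G\<^esub> a = s [^]\<^bsub>G\<^esub> k \<or> g [^]\<^bsub>G\<^esub> a = inv\<^bsub>G\<^esub> (s [^]\<^bsub>G\<^esub> k)"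
proof -
  obtain m E0 E1 where "two_loops A X N M m E0 E1" using two_loops_exist by blast
  then interpret two_loops A X N M m E0 E1 .
  \<comment> \<open>For finitely many elements the exponents can be multiplied. This suffices, since
    the block permutations of one level are finite in number.\<close>
  have common: "\<exists>n\<ge>1. \<forall>h\<in>F. h \<in> centralizer_of G (g [^]\<^bsub>G\<^esub> (n::nat))" if "finite F" "F \<subseteq> carrier G" for F
    using that
  proof (induction F rule: finite_induct)
    case (insert h F)
    then obtain n where n: "n \<ge> 1" "\<forall>h\<in>F. h \<in> centralizer_of G (g [^]\<^bsub>G\<^esub> (n::nat))" by auto
    obtain k where k: "k \<ge> 1" "h \<in> centralizer_of G (g [^]\<^bsub>G\<^esub> (k::nat))" using ghost[of h] insert.prems by blast
    have "\<forall>u\<in>insert h F. u \<in> centralizer_of G (g [^]\<^bsub>G\<^esub> (n * k))"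
      using centralizer_of_pow[of "g [^]\<^bsub>G\<^esub> n" _ k] centralizer_of_pow[of "g [^]\<^bsub>G\<^esub> k" _ n] n k g
      by (auto simp: nat_pow_pow mult.commute)
    moreover have "n * k \<ge> 1" using n(1) k(1) by simp
    ultimately show ?case by blast
  qed auto
  have "finite (block_perms (3 * m))"
    using finite_permutations[OF finite_blocks] by (rule rev_finite_subset) (auto simp: block_perms_def)
  hence fin: "finite (insert s (block_aut (3 * m) ` block_perms (3 * m)))" by simp
  have sub: "insert s (block_aut (3 * m) ` block_perms (3 * m)) \<subseteq> carrier G"
    using s_carrier block_aut_carrier[OF m3N] by blast
  obtain a where a0: "a \<ge> 1" "\<forall>h\<in>insert s (block_aut (3 * m) ` block_perms (3 * m)).
      h \<in> centralizer_of G (g [^]\<^bsub>G\<^esub> (a::nat))"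
    using common[OF fin sub] by blast
  have a: "a \<ge> 1" "s \<in> centralizer_of G (g [^]\<^bsub>G\<^esub> a)"
    "\<And>p. p \<in> block_perms (3 * m) \<Longrightarrow> block_aut (3 * m) p \<in> centralizer_of G (g [^]\<^bsub>G\<^esub> a)"
    using a0 by simp_all
  define u where "u = g [^]\<^bsub>G\<^esub> a"
  have u: "u \<in> carrier G" using g by (simp add: u_def)
  have tr: "u (translate k x) = translate k (u x)" if "x \<in> X" for k x
    using carrier_commute_translate[OF u _ that] a(2) by (simp add: u_def centralizer_of_def)
  have ac: "u (act (3 * m) p x) = act (3 * m) p (u x)" if "x \<in> X" "p \<in> block_perms (3 * m)" for x p
  proof -
    have "(block_aut (3 * m) p \<otimes>\<^bsub>G\<^esub> u) x = (u \<otimes>\<^bsub>G\<^esub> block_aut (3 * m) p) x"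
      using a(3)[OF that(2)] by (simp add: u_def centralizer_of_def)
    thus ?thesis using u block_aut_carrier[OF m3N that(2)] that
      by (simp add: mult_apply block_aut_apply carrier_in)
  qed
  have uX: "u x \<in> X" if "x \<in> X" for x using carrier_in[OF u that] .
  have "central u" unfolding central_def using tr ac uX by blast
  moreover have "inj_on u X" using carrier_bij[OF u] by (simp add: bij_betw_def)
  ultimately obtain j where j: "u wall = translate (j * int m) wall" using central_moves_wall by blast
  \<comment> \<open>The translation by \<open>- j * int m\<close> would already bring the wall back,
    but permutations at level \<open>3 * m\<close> are known to commute only with multiples of
    \<open>3 * m\<close>. The cube of \<open>u\<close> moves the wall by such a multiple.\<close>
  define D where "D = j * int (3 * m)"
  define f where "f x = translate (- D) (u (u (u x)))" for x
  have act_D: "act (3 * m) p (translate (- D) x) = translate (- D) (act (3 * m) p x)" for p x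
    using act_translate[OF m31, of p "- j" x] by (simp add: D_def)
  have "central f" unfolding central_def
    using tr ac uX by (auto simp: f_def act_D act_in[OF m3N] add.commute)
  moreover have "f wall = wall"
    using wall_in by (simp add: f_def j tr uX D_def algebra_simps)
  moreover have "\<exists>k. \<forall>y\<in>X. (\<forall>j. \<bar>j\<bar> \<le> k \<longrightarrow> y j = x j) \<longrightarrow> f y i = f x i" if xX: "x \<in> X" for x i
  proof -
    have u3: "u \<otimes>\<^bsub>G\<^esub> (u \<otimes>\<^bsub>G\<^esub> u) \<in> carrier G" using u by simp
    have e: "f y i = (u \<otimes>\<^bsub>G\<^esub> (u \<otimes>\<^bsub>G\<^esub> u)) y (i - D)" if "y \<in> X" for y
      using u uX that by (simp add: f_def mult_apply translate_apply)
    obtain k where k: "\<And>y. y \<in> X \<Longrightarrow> (\<And>j. \<bar>j\<bar> \<le> k \<Longrightarrow> y j = x j) \<Longrightarrow>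
        (u \<otimes>\<^bsub>G\<^esub> (u \<otimes>\<^bsub>G\<^esub> u)) y (i - D) = (u \<otimes>\<^bsub>G\<^esub> (u \<otimes>\<^bsub>G\<^esub> u)) x (i - D)"
      using carrier_continuous[OF u3 xX, where i = "i - D"] by blast
    show ?thesis
    proof (intro exI ballI impI)
      fix y assume y: "y \<in> X" and *: "\<forall>j. \<bar>j\<bar> \<le> k \<longrightarrow> y j = x j"
      show "f y i = f x i" unfolding e[OF y] e[OF xX] by (rule k[OF y]) (use * in blast)
    qed
  qed
  ultimately have fid: "f x = x" if "x \<in> X" for x using central_eq_id[OF _ _ _ that] by blast
  have u3: "u (u (u x)) = translate D x" if "x \<in> X" for x
  proof -
    have "translate D (f x) = translate D x" using fid[OF that] by simp
    thus ?thesis by (simp add: f_def)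
  qed
  have g3: "(g [^]\<^bsub>G\<^esub> (a * 3)) x = translate D x" if "x \<in> X" for x
  proof -
    have "g [^]\<^bsub>G\<^esub> (a * 3) = u [^]\<^bsub>G\<^esub> (3::nat)" using g by (simp add: u_def nat_pow_pow)
    also have "\<dots> = u \<otimes>\<^bsub>G\<^esub> u \<otimes>\<^bsub>G\<^esub> u" using u by (simp add: numeral_3_eq_3)
    finally show "(g [^]\<^bsub>G\<^esub> (a * 3)) x = translate D x" using u uX u3 that by (simp add: mult_apply)
  qed
  have gc: "g [^]\<^bsub>G\<^esub> (a * 3) \<in> carrier G" using g by simp
  show ?thesis
  proof (cases D rule: int_cases2)
    case (nonneg d)
    have "g [^]\<^bsub>G\<^esub> (a * 3) = s [^]\<^bsub>G\<^esub> d"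
      using gc s_carrier g3 by (intro carrier_eqI) (auto simp: pow_s_apply nonneg)
    thus ?thesis using that[of "a * 3" d] a(1) by simp
  next
    case (nonpos d)
    have sc: "s [^]\<^bsub>G\<^esub> d \<in> carrier G" using s_carrier by simp
    have "g [^]\<^bsub>G\<^esub> (a * 3) = inv\<^bsub>G\<^esub> (s [^]\<^bsub>G\<^esub> d)"
    proof (rule carrier_eqI[OF gc])
      show "inv\<^bsub>G\<^esub> (s [^]\<^bsub>G\<^esub> d) \<in> carrier G" using sc by simp
      fix x assume x: "x \<in> X"
      have "(s [^]\<^bsub>G\<^esub> d) (translate D x) = x" using x by (simp add: pow_s_apply nonpos)
      hence "(inv\<^bsub>G\<^esub> (s [^]\<^bsub>G\<^esub> d)) x = translate D x"
        using inv_apply(1)[OF sc, of "translate D x"] x by simp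
      thus "(g [^]\<^bsub>G\<^esub> (a * 3)) x = (inv\<^bsub>G\<^esub> (s [^]\<^bsub>G\<^esub> d)) x" using g3[OF x] by simp
    qed
    thus ?thesis using that[of "a * 3" d] a(1) by simp
  qed
qed

end

section \<open>Comparing the entropies\<close>

lemma (in mixing_sft) pow_s_nontrivial:
  assumes "1 \<le> (n::nat)"
  shows "s [^]\<^bsub>G\<^esub> n \<noteq> \<one>\<^bsub>G\<^esub>"
proof
  assume "s [^]\<^bsub>G\<^esub> n = \<one>\<^bsub>G\<^esub>"
  hence per: "translate (int n) x = x" if "x \<in> X" for x
    using pow_s_apply[OF that, of n] one_apply[OF that] by simp
  obtain x y where xy: "x \<in> X" "y \<in> X" "x 0 \<noteq> y 0" using two_letters by blast
  \<comment> \<open>A multiple of \<open>n\<close> beyond the gap: period \<open>n\<close> would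
    force \<open>z 0 = z k\<close>, while gluing lets these letters differ.\<close>
  define k where "k = int (1 + M) * int n"
  have k: "1 + int M \<le> k"
    using mult_left_mono[of 1 "int n" "int (1 + M)"] assms by (simp add: k_def)
  obtain z where z: "z \<in> X" "\<And>j. j < 1 \<Longrightarrow> z j = x j" "\<And>j. 1 + int M \<le> j \<Longrightarrow> z j = translate (- k) y j"
    using gluing[OF xy(1) translate_in[OF xy(2)], of 1] by blast
  have "z k = y 0" using z(3)[OF k] by (simp add: translate_apply)
  moreover have "translate k z = z" using translate_periodic[OF per[OF z(1)], of "int (1 + M)"] by (simp add: k_def)
  hence "z k = z 0" by (metis add_0 translate_apply)
  ultimately show False using z(2)[of 0] xy(3) by simp
qed

text \<open>The factor \<open>C\<close> contributes \<open>ln C / l\<close>, which tends to 0, and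
  sampling along multiples does not change an existing limit.\<close>

lemma growth_rate_le:
  fixes f g :: "nat \<Rightarrow> nat"
  assumes lim: "(\<lambda>n. ln (real (f n)) / real n) \<longlonglongrightarrow> x" "(\<lambda>n. ln (real (g n)) / real n) \<longlonglongrightarrow> y"
    and pos: "\<And>n. 1 \<le> f n" "\<And>n. 1 \<le> g n" and pq: "1 \<le> p" "1 \<le> q"
    and le: "\<And>l. L \<le> l \<Longrightarrow> f (p * l) \<le> C * g (q * l)"
  shows "real p * x \<le> real q * y"
proof -
  have sub: "(\<lambda>l. ln (real (f (p * l))) / real l) \<longlonglongrightarrow> real p * x"
    if lim: "(\<lambda>n. ln (real (f n)) / real n) \<longlonglongrightarrow> x" and p: "1 \<le> p" for f :: "nat \<Rightarrow> nat" and p x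
  proof -
    have "strict_mono (\<lambda>l. p * l)" using p by (intro strict_monoI mult_strict_left_mono) auto
    hence "(\<lambda>l. ln (real (f (p * l))) / real (p * l)) \<longlonglongrightarrow> x"
      using LIMSEQ_subseq_LIMSEQ[OF lim, of "\<lambda>l. p * l"] unfolding o_def by simp
    hence "(\<lambda>l. real p * (ln (real (f (p * l))) / real (p * l))) \<longlonglongrightarrow> real p * x"
      by (intro tendsto_intros)
    moreover have "real p * (ln (real (f (p * l))) / real (p * l)) = ln (real (f (p * l))) / real l" for l
      using p by simp
    ultimately show ?thesis by simp
  qed
  have C: "1 \<le> C"
  proof (rule ccontr)
    assume "\<not> 1 \<le> C"
    hence "C = 0" by simp
    thus False using le[OF order_refl] pos(1)[of "p * L"] by simp
  qed
  have "(\<lambda>l. ln (real C) * inverse (real l) + ln (real (g (q * l))) / real l) \<longlonglongrightarrow> ln (real C) * 0 + real q * y"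
    by (intro tendsto_intros lim_inverse_n sub[OF lim(2) pq(2)])
  moreover have "\<exists>N. \<forall>l\<ge>N. ln (real (f (p * l))) / real l \<le> ln (real C) * inverse (real l) + ln (real (g (q * l))) / real l"
  proof (intro exI[of _ L] allI impI)
    fix l assume "L \<le> l"
    hence "real (f (p * l)) \<le> real C * real (g (q * l))" using le by (metis of_nat_le_iff of_nat_mult)
    moreover have "0 < real (f (p * l))" "0 < real C" "0 < real (g (q * l))"
      using pos(1)[of "p * l"] pos(2)[of "q * l"] C by simp_all
    ultimately have "ln (real (f (p * l))) \<le> ln (real C * real (g (q * l)))" by simp
    hence "ln (real (f (p * l))) \<le> ln (real C) + ln (real (g (q * l)))"
      using \<open>0 < real C\<close> \<open>0 < real (g (q * l))\<close> by (simp add: ln_mult)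
    hence "ln (real (f (p * l))) / real l \<le> (ln (real C) + ln (real (g (q * l)))) / real l"
      by (rule divide_right_mono) simp
    thus "ln (real (f (p * l))) / real l \<le> ln (real C) * inverse (real l) + ln (real (g (q * l))) / real l"
      by (simp add: divide_inverse distrib_right)
  qed
  ultimately have "real p * x \<le> ln (real C) * 0 + real q * y"
    using sub[OF lim(1) pq(1)] by (intro LIMSEQ_le)
  thus ?thesis by simp
qed

lemma centralizer_of_hom:
  assumes "\<psi> \<in> hom G G'" "g \<in> carrier G" "c \<in> centralizer_of G g"
  shows "\<psi> c \<in> centralizer_of G' (\<psi> g)"
proof -
  have c: "c \<in> carrier G" "c \<otimes>\<^bsub>G\<^esub> g = g \<otimes>\<^bsub>G\<^esub> c" using assms(3) by (auto simp: centralizer_of_def)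
  have "\<psi> c \<otimes>\<^bsub>G'\<^esub> \<psi> g = \<psi> g \<otimes>\<^bsub>G'\<^esub> \<psi> c"
    using c assms by (metis hom_mult)
  thus ?thesis using assms(1) c(1) by (auto simp: centralizer_of_def hom_def)
qed

text \<open>The upper bound for \<open>\<psi> h\<close> in \<open>Y\<close> is pulled back to
  \<open>X\<close>, where it meets the lower bound for \<open>h\<close>. The power relation matches
  level \<open>a * n\<close> of \<open>X\<close> with level \<open>k * n\<close> of
  \<open>Y\<close>.\<close>

lemma entropy_le_of_iso:
  fixes A :: "'a set" and B :: "'b set"
  assumes X: "mixing_sft A X N M" and Y: "mixing_sft B Y N' M'"
    and \<psi>: "\<psi> \<in> iso (stabilized_aut_group (shift_space A X) shift) (stabilized_aut_group (shift_space B Y) shift)"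
    and a: "1 \<le> a" and k: "1 \<le> k"
    and pow: "\<psi> (subshift_space.s X [^]\<^bsub>stabilized_aut_group (shift_space A X) shift\<^esub> (a::nat)) \<in>
      {subshift_space.s Y [^]\<^bsub>stabilized_aut_group (shift_space B Y) shift\<^esub> (k::nat),
       inv\<^bsub>stabilized_aut_group (shift_space B Y) shift\<^esub>
         (subshift_space.s Y [^]\<^bsub>stabilized_aut_group (shift_space B Y) shift\<^esub> k)}"
    and limX: "(\<lambda>n. ln (real (word_count X n)) / real n) \<longlonglongrightarrow> hX"
    and limY: "(\<lambda>n. ln (real (word_count Y n)) / real n) \<longlonglongrightarrow> hY"
  shows "real a * hX \<le> real k * hY"
proof -
  interpret X: mixing_sft A X N M by (rule X)
  interpret Y: mixing_sft B Y N' M' by (rule Y)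
  have hom: "\<psi> \<in> hom X.G Y.G" and inj: "inj_on \<psi> (carrier X.G)"
    using \<psi> by (auto simp: iso_def bij_betw_def)
  interpret \<psi>: group_hom X.G Y.G \<psi>
    by (intro group_hom.intro group_hom_axioms.intro X.group_G Y.group_G hom)
  have img: "\<psi> c \<in> centralizer_of Y.G (Y.s [^]\<^bsub>Y.G\<^esub> (k * n))"
    if c: "c \<in> centralizer_of X.G (X.s [^]\<^bsub>X.G\<^esub> (a * n))" for c n
  proof -
    have "X.s [^]\<^bsub>X.G\<^esub> (a * n) \<in> carrier X.G" using X.s_carrier by simp
    hence 1: "\<psi> c \<in> centralizer_of Y.G (\<psi> (X.s [^]\<^bsub>X.G\<^esub> (a * n)))"
      using centralizer_of_hom[OF hom _ c] by simp
    have "\<psi> (X.s [^]\<^bsub>X.G\<^esub> (a * n)) = \<psi> (X.s [^]\<^bsub>X.G\<^esub> a) [^]\<^bsub>Y.G\<^esub> n"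
      using X.s_carrier by (simp add: X.nat_pow_pow[symmetric] \<psi>.hom_nat_pow)
    moreover have "(inv\<^bsub>Y.G\<^esub> (Y.s [^]\<^bsub>Y.G\<^esub> k)) [^]\<^bsub>Y.G\<^esub> n = inv\<^bsub>Y.G\<^esub> (Y.s [^]\<^bsub>Y.G\<^esub> (k * n))"
      using Y.s_carrier by (simp add: Y.nat_pow_inv Y.nat_pow_pow)
    moreover have "(Y.s [^]\<^bsub>Y.G\<^esub> k) [^]\<^bsub>Y.G\<^esub> n = Y.s [^]\<^bsub>Y.G\<^esub> (k * n)"
      using Y.s_carrier by (simp add: Y.nat_pow_pow)
    ultimately have "\<psi> (X.s [^]\<^bsub>X.G\<^esub> (a * n)) \<in>
        {Y.s [^]\<^bsub>Y.G\<^esub> (k * n), inv\<^bsub>Y.G\<^esub> (Y.s [^]\<^bsub>Y.G\<^esub> (k * n))}"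
      using pow by auto
    moreover have "Y.s [^]\<^bsub>Y.G\<^esub> (k * n) \<in> carrier Y.G" using Y.s_carrier by simp
    \<comment> \<open>An element and its inverse have the same centralizer, so the sign of the power
      does not matter.\<close>
    note Y.centralizer_of_inv[OF this]
    ultimately have "centralizer_of Y.G (\<psi> (X.s [^]\<^bsub>X.G\<^esub> (a * n))) = centralizer_of Y.G (Y.s [^]\<^bsub>Y.G\<^esub> (k * n))"
      by (elim insertE emptyE) (simp_all only:)
    thus ?thesis using 1 by simp
  qed
  obtain m h c where h: "1 \<le> m" "h \<in> centralizer_of X.G (X.s [^]\<^bsub>X.G\<^esub> m)" "h \<noteq> \<one>\<^bsub>X.G\<^esub>"
    and lower: "\<And>l d. 1 \<le> l \<Longrightarrow> separable_by_index X.G (centralizer_of X.G (X.s [^]\<^bsub>X.G\<^esub> (m * l))) h d \<Longrightarrow>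
      word_count X (m * l) \<le> c * (2 * d + 2)"
    using X.separable_lower by blast
  have hc: "h \<in> carrier X.G" using h(2) by (simp add: centralizer_of_def)
  have \<psi>h: "\<psi> h \<in> carrier Y.G" using hc by simp
  have \<psi>h1: "\<psi> h \<noteq> \<one>\<^bsub>Y.G\<^esub>"
    using inj hc h(3) by (metis X.one_closed \<psi>.hom_one inj_onD)
  obtain n0 where upper: "\<And>n. n \<ge> n0 \<Longrightarrow>
      separable_by_index Y.G (centralizer_of Y.G (Y.s [^]\<^bsub>Y.G\<^esub> n)) (\<psi> h) (word_count Y n)"
    using Y.separable_upper[OF \<psi>h \<psi>h1] by blast
  have "real (a * m) * hX \<le> real (k * m) * hY"
  proof (rule growth_rate_le[OF limX limY X.word_count_pos Y.word_count_pos])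
    \<comment> \<open>\<open>Suc\<close> ensures \<open>l \<ge> 1\<close> together with
      \<open>n0 \<le> k * m * l\<close>.\<close>
    fix l assume l: "Suc n0 \<le> l"
    have "l \<le> k * m * l" using h(1) k by simp
    hence "n0 \<le> k * m * l" using l by linarith
    hence 1: "separable_by_index Y.G (centralizer_of Y.G (Y.s [^]\<^bsub>Y.G\<^esub> (k * (m * l)))) (\<psi> h) (word_count Y (k * m * l))"
      using upper[of "k * m * l"] by (simp add: mult.assoc)
    have 2: "\<psi> ` centralizer_of X.G (X.s [^]\<^bsub>X.G\<^esub> (a * (m * l)))
        \<subseteq> centralizer_of Y.G (Y.s [^]\<^bsub>Y.G\<^esub> (k * (m * l)))" using img by blast
    have 3: "centralizer_of X.G (X.s [^]\<^bsub>X.G\<^esub> (a * (m * l))) \<subseteq> carrier X.G"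
      by (auto simp: centralizer_of_def)
    have "separable_by_index X.G (centralizer_of X.G (X.s [^]\<^bsub>X.G\<^esub> (a * (m * l)))) h (word_count Y (k * m * l))"
      by (rule separable_by_index_iso[where \<psi> = \<psi> and h = h, OF X.group_G Y.group_G hom inj 3 2 hc 1])
    moreover have e: "a * (m * l) = m * (a * l)" "1 \<le> a * l" using a l by simp_all
    ultimately have "word_count X (m * (a * l)) \<le> c * (2 * word_count Y (k * m * l) + 2)"
      using lower[of "a * l"] by simp
    also have "\<dots> \<le> c * (4 * word_count Y (k * m * l))"
      using Y.word_count_pos[of "k * m * l"] by (intro mult_le_mono2) simp
    finally show "word_count X (a * m * l) \<le> (c * 4) * word_count Y (k * m * l)"
      unfolding mult.assoc e(1) .
  qed (use a k h(1) in auto)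
  hence "real m * (real a * hX) \<le> real m * (real k * hY)" by (simp add: mult_ac)
  thus ?thesis using h(1) by simp
qed

theorem theorem2:
  fixes A :: "'a set" and B :: "'b set"
    and X :: "(int \<Rightarrow> 'a) set" and Y :: "(int \<Rightarrow> 'b) set"
  assumes "shift_of_finite_type A X" and "mixing X" and "\<not> trivial_shift X"
    and "shift_of_finite_type B Y" and "mixing Y" and "\<not> trivial_shift Y"
    and "stabilized_aut_group (shift_space A X) shift \<cong> stabilized_aut_group (shift_space B Y) shift"
  shows "topological_entropy (shift_space A X) shift / topological_entropy (shift_space B Y) shift
    \<in> ereal ` \<rat>"
proof -
  obtain N M where X: "mixing_sft A X N M" using mixing_sft_exists[OF assms(1-3)] by blast
  obtain N' M' where Y: "mixing_sft B Y N' M'" using mixing_sft_exists[OF assms(4-6)] by blast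
  interpret X: mixing_sft A X N M by (rule X)
  interpret Y: mixing_sft B Y N' M' by (rule Y)
  obtain hX where hX: "(\<lambda>n. ln (real (word_count X n)) / real n) \<longlonglongrightarrow> hX"
    "topological_entropy (shift_space A X) shift = ereal hX"
    by (rule X.entropy_eq_word_growth)
  obtain hY where hY: "(\<lambda>n. ln (real (word_count Y n)) / real n) \<longlonglongrightarrow> hY"
    "topological_entropy (shift_space B Y) shift = ereal hY"
    by (rule Y.entropy_eq_word_growth)
  obtain \<psi> where \<psi>: "\<psi> \<in> iso X.G Y.G" using assms(7) by (auto simp: is_iso_def)
  have hom: "\<psi> \<in> hom X.G Y.G" and bij: "bij_betw \<psi> (carrier X.G) (carrier Y.G)"
    using \<psi> by (auto simp: iso_def)
  interpret \<psi>: group_hom X.G Y.G \<psi>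
    by (intro group_hom.intro group_hom_axioms.intro X.group_G Y.group_G hom)
  have pow_s: "\<psi> X.s [^]\<^bsub>Y.G\<^esub> (n::nat) = \<psi> (X.s [^]\<^bsub>X.G\<^esub> n)" for n
    using X.s_carrier by (simp add: \<psi>.hom_nat_pow)
  \<comment> \<open>Every element of the stabilized group commutes with some positive power of the
    shift; \<open>\<psi>\<close> carries this property to the image of the shift.\<close>
  have ghost: "\<exists>n\<ge>1. h \<in> centralizer_of Y.G (\<psi> X.s [^]\<^bsub>Y.G\<^esub> (n::nat))" if hY: "h \<in> carrier Y.G" for h
  proof -
    obtain g where g: "g \<in> carrier X.G" "h = \<psi> g" using hY bij unfolding bij_betw_def by blast
    obtain n where n: "n \<ge> 1" "\<And>x. x \<in> X \<Longrightarrow> g (translate (int n) x) = translate (int n) (g x)"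
      using X.carrier_commute[OF g(1)] by blast
    have "g \<in> centralizer_of X.G (X.s [^]\<^bsub>X.G\<^esub> n)"
      using g(1) n(2) by (simp add: X.centralizer_of_pow_s_iff)
    hence "h \<in> centralizer_of Y.G (\<psi> X.s [^]\<^bsub>Y.G\<^esub> n)"
      unfolding pow_s g(2) using centralizer_of_hom[OF hom] X.s_carrier by simp
    thus ?thesis using n(1) by blast
  qed
  have \<psi>s: "\<psi> X.s \<in> carrier Y.G" using X.s_carrier by simp
  obtain a k :: nat where a: "1 \<le> a"
    and k: "\<psi> X.s [^]\<^bsub>Y.G\<^esub> a = Y.s [^]\<^bsub>Y.G\<^esub> k \<or> \<psi> X.s [^]\<^bsub>Y.G\<^esub> a = inv\<^bsub>Y.G\<^esub> (Y.s [^]\<^bsub>Y.G\<^esub> k)"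
    using Y.centralizing_power_of_shift[OF \<psi>s ghost] by blast
  have sa: "X.s [^]\<^bsub>X.G\<^esub> a \<in> carrier X.G" and sk: "Y.s [^]\<^bsub>Y.G\<^esub> k \<in> carrier Y.G"
    using X.s_carrier Y.s_carrier by simp_all
  have k1: "1 \<le> k"
  proof (rule ccontr)
    \<comment> \<open>Exponent 0 would make a positive power of the shift of \<open>X\<close>
      trivial.\<close>
    assume "\<not> 1 \<le> k"
    hence "k = 0" by simp
    hence "\<psi> (X.s [^]\<^bsub>X.G\<^esub> a) = \<psi> \<one>\<^bsub>X.G\<^esub>" using k unfolding pow_s by auto
    hence "X.s [^]\<^bsub>X.G\<^esub> a = \<one>\<^bsub>X.G\<^esub>" using bij sa X.one_closed unfolding bij_betw_def by (meson inj_onD)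
    thus False using X.pow_s_nontrivial[OF a] by simp
  qed
  define \<phi> where "\<phi> = inv_into (carrier X.G) \<psi>"
  have \<phi>: "\<phi> \<in> iso Y.G X.G" unfolding \<phi>_def by (rule X.iso_set_sym[OF \<psi>])
  have \<phi>\<psi>: "\<phi> (\<psi> x) = x" if "x \<in> carrier X.G" for x
    unfolding \<phi>_def using bij that by (simp add: bij_betw_def)
  \<comment> \<open>The relation is turned around so that the same inequality applies to the inverse
    isomorphism with the two shifts exchanged.\<close>
  have "\<psi> (X.s [^]\<^bsub>X.G\<^esub> a) = Y.s [^]\<^bsub>Y.G\<^esub> k \<or> \<psi> (inv\<^bsub>X.G\<^esub> (X.s [^]\<^bsub>X.G\<^esub> a)) = Y.s [^]\<^bsub>Y.G\<^esub> k"
    using k sa sk unfolding pow_s by auto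
  hence "\<phi> (Y.s [^]\<^bsub>Y.G\<^esub> k) \<in> {X.s [^]\<^bsub>X.G\<^esub> a, inv\<^bsub>X.G\<^esub> (X.s [^]\<^bsub>X.G\<^esub> a)}"
    using \<phi>\<psi> sa by (metis X.inv_closed insertCI)
  hence "real k * hY \<le> real a * hX"
    by (rule entropy_le_of_iso[OF Y X \<phi> k1 a _ hY(1) hX(1)])
  moreover have "real a * hX \<le> real k * hY"
    by (rule entropy_le_of_iso[OF X Y \<psi> a k1 _ hX(1) hY(1)]) (use k in \<open>auto simp: pow_s\<close>)
  ultimately have eq: "real a * hX = real k * hY" by simp
  \<comment> \<open>With a positive real denominator the extended quotient is the real one.\<close>
  have "0 < hY" using Y.entropy_pos[OF hY(1)] .
  hence "hX / hY = real k / real a" using eq a by (simp add: field_simps)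
  hence "topological_entropy (shift_space A X) shift / topological_entropy (shift_space B Y) shift
      = ereal (real k / real a)" using \<open>0 < hY\<close> by (simp add: hX(2) hY(2))
  moreover have "real k / real a \<in> \<rat>" by simp
  ultimately show ?thesis by blast
qed

end
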